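(* For every $k\ge2$ and every $\mathsf{A}=(A_1,\dots,A_k)\in\mathrm{GL}(2,\mathbb{R})^k$, if the one-step cocycle generated by $\mathsf{A}$ is dominated and $\mathsf{A}$ satisfies the NOC, then the restriction of the shift map $T$ to either Mather set $K^\top$ or $K^\bot$ has zero topological entropy.
   Context: Let $k^{\mathbb{Z}}=\{1,\dots,k\}^{\mathbb{Z}}$ with the product topology, and let $T$ be the shift, $(T\omega)_n=\omega_{n+1}$. $\mathcal{M}_T$ is the set of $T$-invariant Borel probability measures on $k^{\mathbb{Z}}$. The one-step cocycle generated by $\mathsf{A}$ is the pair $(T,A)$ with $A(\omega)=A_{\omega_0}$; its products are $A^{(n)}(\omega)=A_{\omega_{n-1}}\cdots A_{\omega_0}$ for $n\ge 0$. With $\|\cdot\|$ the Euclidean operator norm, $\lambda_1(A,\omega)=\lim_{n\to+\infty}\frac1n\log\|A^{(n)}(\omega)\|$, which exists $\mu$-a.e. for each $\mu\in\mathcal{M}_T$; $\lambda_1(A,\mu)=\int\lambda_1(A,\omega)\,d\mu(\omega)$; $\lambda_1^\top(\mathsf{A})=\sup_{\mu\in\mathcal{M}_T}\lambda_1(A,\mu)$, $\lambda_1^\bot(\mathsf{A})=\inf_{\mu\in\mathcal{M}_T}\lambda_1(A,\mu)$. The cocycle is dominated if for each $\omega\in k^{\mathbb{Z}}$ there is a splitting $\mathbb{R}^2=e_1(\omega)\oplus e_2(\omega)$ into one-dimensional subspaces such that $A(\omega)(e_i(\omega))=e_i(T\omega)$ for all $\omega$ and $i\in\{1,2\}$, and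 there are constants $c>0$, $\delta>0$ with $\|A^{(n)}(\omega)|e_1(\omega)\|\ge c e^{\delta n}\|A^{(n)}(\omega)|e_2(\omega)\|$ for all $\omega$ and $n\ge1$. Mather sets: for $\star\in\{\top,\bot\}$, $K^\star$ is the union of the supports of all $\mu\in\mathcal{M}_T$ with $\lambda_1(A,\mu)=\lambda_1^\star(\mathsf{A})$. When the cocycle is dominated, $K^\star$ is compact, nonempty and $T$-invariant. Multicones: let $\mathbb{R}^2_*=\mathbb{R}^2\setminus\{0\}$ and $C_+=\{(x,y)\in\mathbb{R}^2_*: xy\ge0\}$. A cone in $\mathbb{R}^2_*$ is an image of $C_+$ by a linear isomorphism. A multicone in $\mathbb{R}^2_*$ is a (nonempty) disjoint union of finitely many cones. A multicone $M$ is strictly forward-invariant with respect to $(A_1,\dots,A_k)$ if $\bigcup_i A_i(M)$ is contained in the interior of $M$. NOC (non-overlapping condition): $(A_1,\dots,A_k)$ satisfies the forward NOC if it has a strictly forward-invariant multicone $M\subset\mathbb{R}^2_*$ such that $A_i(M)\cap A_j(M)=\emptyset$ whenever $i\ne j$. It satisfies the backwards NOC if $(A_1^{-1},\dots,A_k^{-1})$ satisfies the forward NOC. It satisfies the NOC if it satisfies both the forward and the backwards NOC. *)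

theory Defs
  imports "HOL-Analysis.Analysis" "HOL-Probability.Probability"
begin

section \<open>The full shift and its invariant measures\<close>

text \<open>
  The type \<^typ>\<open>nat\<close> is a discrete space and \<^typ>\<open>int \<Rightarrow> nat\<close> carries the product topology, so the
  topology of \<open>{1,\<dots>,k}\<^sup>\<int>\<close> is the subspace topology and its Borel sets are those of
  \<^term>\<open>restrict_space borel\<close>.
\<close>

definition full_shift :: "nat \<Rightarrow> (int \<Rightarrow> nat) set" where
  "full_shift k = {\<omega>. \<forall>n. \<omega> n \<in> {1..k}}"

definition left_shift :: "(int \<Rightarrow> nat) \<Rightarrow> int \<Rightarrow> nat" where
  "left_shift \<omega> = (\<lambda>n. \<omega> (n + 1))"

definition invariant_measures :: "nat \<Rightarrow> (int \<Rightarrow> nat) measure set" where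
  "invariant_measures k =
     {\<mu>. prob_space \<mu> \<and> sets \<mu> = sets (restrict_space borel (full_shift k)) \<and> distr \<mu> \<mu> left_shift = \<mu>}"

definition measure_support :: "'a::topological_space measure \<Rightarrow> 'a set" where
  "measure_support \<mu> =
     {x \<in> space \<mu>. \<forall>U. open U \<and> x \<in> U \<longrightarrow> emeasure \<mu> (U \<inter> space \<mu>) > 0}"


section \<open>One-step cocycles and Lyapunov exponents\<close>

text \<open>
  A tuple \<open>(A\<^sub>1,\<dots>,A\<^sub>k)\<close> is a function on \<^typ>\<open>nat\<close> of which only the values on
  \<open>{1..k}\<close> are used. The norm of the type \<^typ>\<open>real^2^2\<close> is the Frobenius norm; the Euclidean
  operator norm of a matrix \<open>B\<close> is \<^term>\<open>onorm ((*v) B)\<close>.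
\<close>

primrec cocycle_prod :: "(nat \<Rightarrow> real^2^2) \<Rightarrow> nat \<Rightarrow> (int \<Rightarrow> nat) \<Rightarrow> real^2^2" where
  "cocycle_prod A 0 \<omega> = mat 1"
| "cocycle_prod A (Suc n) \<omega> = A (\<omega> (int n)) ** cocycle_prod A n \<omega>"

definition lyap_point :: "(nat \<Rightarrow> real^2^2) \<Rightarrow> (int \<Rightarrow> nat) \<Rightarrow> real" where
  "lyap_point A \<omega> = lim (\<lambda>n. ln (onorm ((*v) (cocycle_prod A n \<omega>))) / real n)"

definition lyap_measure :: "(nat \<Rightarrow> real^2^2) \<Rightarrow> (int \<Rightarrow> nat) measure \<Rightarrow> real" where
  "lyap_measure A \<mu> = (LINT \<omega>|\<mu>. lyap_point A \<omega>)"

definition lyap_top :: "nat \<Rightarrow> (nat \<Rightarrow> real^2^2) \<Rightarrow> real" where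
  "lyap_top k A = (SUP \<mu>\<in>invariant_measures k. lyap_measure A \<mu>)"

definition lyap_bot :: "nat \<Rightarrow> (nat \<Rightarrow> real^2^2) \<Rightarrow> real" where
  "lyap_bot k A = (INF \<mu>\<in>invariant_measures k. lyap_measure A \<mu>)"

definition mather_top :: "nat \<Rightarrow> (nat \<Rightarrow> real^2^2) \<Rightarrow> (int \<Rightarrow> nat) set" where
  "mather_top k A =
     \<Union> {measure_support \<mu> | \<mu>. \<mu> \<in> invariant_measures k \<and> lyap_measure A \<mu> = lyap_top k A}"

definition mather_bot :: "nat \<Rightarrow> (nat \<Rightarrow> real^2^2) \<Rightarrow> (int \<Rightarrow> nat) set" where
  "mather_bot k A =
     \<Union> {measure_support \<mu> | \<mu>. \<mu> \<in> invariant_measures k \<and> lyap_measure A \<mu> = lyap_bot k A}"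


section \<open>Domination\<close>

definition restr_norm :: "real^2^2 \<Rightarrow> (real^2) set \<Rightarrow> real" where
  "restr_norm B V = (SUP v\<in>{v \<in> V. norm v = 1}. norm (B *v v))"

definition line_splitting :: "(real^2) set \<Rightarrow> (real^2) set \<Rightarrow> bool" where
  "line_splitting V W \<longleftrightarrow>
     subspace V \<and> dim V = 1 \<and> subspace W \<and> dim W = 1 \<and>
     V \<inter> W = {0} \<and> {v + w | v w. v \<in> V \<and> w \<in> W} = UNIV"

definition dominated :: "nat \<Rightarrow> (nat \<Rightarrow> real^2^2) \<Rightarrow> bool" where
  "dominated k A \<longleftrightarrow>
     (\<exists>e1 e2.
        (\<forall>\<omega>\<in>full_shift k.
           line_splitting (e1 \<omega>) (e2 \<omega>) \<and>
           (*v) (A (\<omega> 0)) ` e1 \<omega> = e1 (left_shift \<omega>) \<and>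
           (*v) (A (\<omega> 0)) ` e2 \<omega> = e2 (left_shift \<omega>)) \<and>
        (\<exists>c>0. \<exists>\<delta>>0. \<forall>\<omega>\<in>full_shift k. \<forall>n\<ge>1.
           restr_norm (cocycle_prod A n \<omega>) (e1 \<omega>)
             \<ge> c * exp (\<delta> * real n) * restr_norm (cocycle_prod A n \<omega>) (e2 \<omega>)))"


section \<open>Multicones and the non-overlapping condition\<close>

definition standard_cone :: "(real^2) set" where
  "standard_cone = {v. v \<noteq> 0 \<and> v $ 1 * v $ 2 \<ge> 0}"

definition plane_cone :: "(real^2) set \<Rightarrow> bool" where
  "plane_cone C \<longleftrightarrow> (\<exists>L :: real^2^2. invertible L \<and> C = (*v) L ` standard_cone)"

definition multicone :: "(real^2) set \<Rightarrow> bool" where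
  "multicone M \<longleftrightarrow>
     (\<exists>\<C>. finite \<C> \<and> \<C> \<noteq> {} \<and> (\<forall>C\<in>\<C>. plane_cone C) \<and> disjoint \<C> \<and> M = \<Union> \<C>)"

text \<open>
  The punctured plane is open, so the interior of \<open>M\<close> in it is the interior of \<open>M\<close> in the plane.
\<close>

definition strictly_forward_invariant :: "nat \<Rightarrow> (nat \<Rightarrow> real^2^2) \<Rightarrow> (real^2) set \<Rightarrow> bool" where
  "strictly_forward_invariant k A M \<longleftrightarrow> (\<Union>i\<in>{1..k}. (*v) (A i) ` M) \<subseteq> interior M"

definition forward_NOC :: "nat \<Rightarrow> (nat \<Rightarrow> real^2^2) \<Rightarrow> bool" where
  "forward_NOC k A \<longleftrightarrow>
     (\<exists>M. multicone M \<and> strictly_forward_invariant k A M \<and>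
        (\<forall>i\<in>{1..k}. \<forall>j\<in>{1..k}. i \<noteq> j \<longrightarrow> (*v) (A i) ` M \<inter> (*v) (A j) ` M = {}))"

definition backwards_NOC :: "nat \<Rightarrow> (nat \<Rightarrow> real^2^2) \<Rightarrow> bool" where
  "backwards_NOC k A \<longleftrightarrow> forward_NOC k (\<lambda>i. matrix_inv (A i))"

definition NOC :: "nat \<Rightarrow> (nat \<Rightarrow> real^2^2) \<Rightarrow> bool" where
  "NOC k A \<longleftrightarrow> forward_NOC k A \<and> backwards_NOC k A"


section \<open>Topological entropy\<close>

text \<open>
  The definition of Adler, Konheim and McAndrew. An infimum over no finite subcover is \<open>\<infinity>\<close>.
  For a continuous self-map of a compact space the \<open>limsup\<close> below is a limit, by subadditivity.
\<close>

definition open_cover :: "'a topology \<Rightarrow> 'a set set \<Rightarrow> bool" where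
  "open_cover X \<U> \<longleftrightarrow> (\<forall>U\<in>\<U>. openin X U) \<and> \<Union> \<U> = topspace X"

definition cover_entropy :: "'a topology \<Rightarrow> 'a set set \<Rightarrow> ereal" where
  "cover_entropy X \<U> =
     (INF \<V>\<in>{\<V>. \<V> \<subseteq> \<U> \<and> finite \<V> \<and> \<Union> \<V> = topspace X}. ereal (ln (real (card \<V>))))"

text \<open>The common refinement of \<open>\<U>, f\<^sup>-\<^sup>1 \<U>, \<dots>, f\<^sup>-\<^sup>(\<^sup>n\<^sup>-\<^sup>1\<^sup>) \<U>\<close>.\<close>

definition iterated_join :: "'a topology \<Rightarrow> ('a \<Rightarrow> 'a) \<Rightarrow> 'a set set \<Rightarrow> nat \<Rightarrow> 'a set set" where
  "iterated_join X f \<U> n =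
     {topspace X \<inter> (\<Inter>i<n. (f ^^ i) -` u i) | u. \<forall>i<n. u i \<in> \<U>}"

definition topological_entropy :: "'a topology \<Rightarrow> ('a \<Rightarrow> 'a) \<Rightarrow> ereal" where
  "topological_entropy X f =
     (SUP \<U>\<in>{\<U>. open_cover X \<U>}.
        limsup (\<lambda>n. cover_entropy X (iterated_join X f \<U> n) / ereal (real n)))"

end

theory Submission
  imports Defs "HOL-Real_Asymp.Real_Asymp"
begin

text \<open>
  Two optimal orbits cannot gain by exchanging their futures. On the projective line this is a sign
  condition on a cross ratio, and it leaves room for polynomially many words only.

  A nonempty product \<open>A\<^sub>w\<close> maps each cone of the forward multicone \<open>M\<close> into one such cone, and in
  frames of the two cones it is, up to sign, a positive matrix. Comparing the determinant, which is
  multiplicative, with the permanent, which is supermultiplicative on positive matrices, gives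
  \<open>\<bar>det A\<^sub>w\<bar> \<parallel>u\<parallel>\<^sup>2 \<le> D \<kappa>\<^sup>n \<parallel>A\<^sub>w u\<parallel>\<^sup>2\<close> with \<open>\<kappa> < 1\<close> for \<open>u \<in> M\<close>, and vectors of \<open>M\<close> witness the norm of
  \<open>A\<^sub>w\<close> up to a constant (\<open>word_estimates\<close>). Hence the past of a point \<open>\<omega>\<close> of the shift determines a
  direction \<open>E(\<omega>) \<in> M\<close>, continuously, and the future determines in the same way a direction
  \<open>F(\<omega>)\<close> in the multicone of the inverse matrices. The Lyapunov exponent of an invariant measure is
  the integral of \<open>f(\<omega>) = ln \<parallel>A(\<omega>) E(\<omega>)\<parallel>\<close> (\<open>lyap_measure_eq_integral\<close>, by the pointwise ergodic
  theorem).

  Let \<open>s = 1\<close> for the maximal and \<open>s = -1\<close> for the minimal exponent and let \<open>\<beta>\<close> be the supremum of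
  the integrals of \<open>s f\<close>. The function
  \<open>H(v) = sup\<^sub>w (s ln \<parallel>A\<^sub>w v\<parallel> - \<beta> |w|)\<close> on \<open>M\<close> satisfies \<open>H(A\<^sub>i v) \<le> H(v) + \<beta>\<close>, and equality holds along the
  orbits in the Mather set, because the defect is continuous, nonnegative and of integral zero for
  optimal measures (\<open>optimal_iff_AE_gap\<close>). Let now two orbits of the Mather set exchange their
  futures. The inequality for \<open>H\<close> says that the exchange does not increase the growth, multiplied
  by \<open>s\<close>, and the total change is the logarithm of the cross ratio of the four directions
  \<open>E(\<omega>), E(\<tau>), F(\<omega>), F(\<tau>)\<close>. So this cross ratio lies on one side of 1 (\<open>extremal_cross_ratio\<close>).

  Cut the projective line open at a boundary direction of \<open>M\<close>. By the two non-overlapping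
  conditions, the points \<open>E(\<omega>)\<close> with a given past word of length \<open>n\<close> and the points \<open>F(\<omega>)\<close> with a
  given future word of length \<open>n\<close> lie in boundedly many intervals, and all the intervals of level
  \<open>n\<close> are disjoint once \<open>n\<close> is large. The sign of the cross ratio makes the relation between the
  intervals of \<open>E(\<omega>)\<close> and of \<open>F(\<omega>)\<close>, for \<open>\<omega>\<close> in the Mather set, monotone on each side of the
  diagonal. A monotone relation between \<open>p\<close> and \<open>q\<close> intervals contains at most \<open>p + q\<close> pairs, while
  the pair of intervals determines the word of length \<open>2 n\<close> around the origin. Hence the number
  \<open>N(n)\<close> of words of length \<open>n\<close> in the Mather set satisfies \<open>N(2 n) \<le> c N(n)\<close>
  (\<open>card_words_double_le\<close>) and grows polynomially. As the Mather set is compact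
  (\<open>compact_mather\<close>), its entropy is at most the exponential growth rate of \<open>N\<close>, which is zero.
\<close>

section \<open>Linear algebra in the plane\<close>

definition cross2 :: "real^2 \<Rightarrow> real^2 \<Rightarrow> real" where
  "cross2 u v = u $ 1 * v $ 2 - u $ 2 * v $ 1"

lemma matrix_vector_mult_2:
  fixes B :: "real^2^2"
  shows "(B *v v) $ i = B $ i $ 1 * v $ 1 + B $ i $ 2 * v $ 2"
  by (simp add: matrix_vector_mult_def sum_2)

lemma matrix_matrix_mult_2:
  fixes B C :: "real^2^2"
  shows "(B ** C) $ i $ j = B $ i $ 1 * C $ 1 $ j + B $ i $ 2 * C $ 2 $ j"
  by (simp add: matrix_matrix_mult_def sum_2)

lemma norm_sq_2: "(norm (v::real^2))\<^sup>2 = (v $ 1)\<^sup>2 + (v $ 2)\<^sup>2"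
  by (simp add: norm_vec_def L2_set_def sum_2)

lemma cross2_matrix: "cross2 (B *v u) (B *v v) = det B * cross2 u v"
  by (simp add: cross2_def matrix_vector_mult_2 det_2 algebra_simps)

lemma cross2_scaleR [simp]:
  "cross2 (c *\<^sub>R u) v = c * cross2 u v" "cross2 u (c *\<^sub>R v) = c * cross2 u v"
  by (simp_all add: cross2_def algebra_simps)

lemma cross2_add_right: "cross2 w (u + v) = cross2 w u + cross2 w v"
  by (simp add: cross2_def algebra_simps)

lemma cross2_self [simp]: "cross2 v v = 0"
  by (simp add: cross2_def)

lemma cross2_skew: "cross2 u v = - cross2 v u"
  by (simp add: cross2_def)

lemma abs_cross2_commute: "\<bar>cross2 u v\<bar> = \<bar>cross2 v u\<bar>"
  by (subst cross2_skew) simp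

lemma cross2_le_norm: "\<bar>cross2 u v\<bar> \<le> norm u * norm v"
proof -
  have "(cross2 u v)\<^sup>2 + (u $ 1 * v $ 1 + u $ 2 * v $ 2)\<^sup>2 = (norm u * norm v)\<^sup>2"
    unfolding power_mult_distrib norm_sq_2 cross2_def by algebra
  then have "(cross2 u v)\<^sup>2 \<le> (norm u * norm v)\<^sup>2"
    by (smt (verit) zero_le_power2)
  then show ?thesis
    by (metis abs_le_square_iff abs_mult abs_norm_cancel)
qed

lemma cross2_eq_0_imp_parallel:
  assumes "cross2 u v = 0" "v \<noteq> 0"
  obtains c where "u = c *\<^sub>R v"
proof -
  define c where "c = (u $ 1 * v $ 1 + u $ 2 * v $ 2) / (norm v)\<^sup>2"
  have n: "(v $ 1)\<^sup>2 + (v $ 2)\<^sup>2 \<noteq> 0" using assms(2) by (simp add: vec_eq_iff forall_2 sum_power2_eq_zero_iff)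
  have "u $ 1 * ((v $ 1)\<^sup>2 + (v $ 2)\<^sup>2) = (u $ 1 * v $ 1 + u $ 2 * v $ 2) * v $ 1"
       "u $ 2 * ((v $ 1)\<^sup>2 + (v $ 2)\<^sup>2) = (u $ 1 * v $ 1 + u $ 2 * v $ 2) * v $ 2"
    using assms(1) unfolding cross2_def by algebra+
  then have "u = c *\<^sub>R v"
    using n unfolding c_def norm_sq_2 by (simp add: vec_eq_iff forall_2 field_simps)
  then show thesis by (rule that)
qed

lemma cross2_decompose:
  assumes "cross2 v w \<noteq> 0"
  shows "u = (cross2 u w / cross2 v w) *\<^sub>R v + (cross2 v u / cross2 v w) *\<^sub>R w"
proof -
  have "u $ i * cross2 v w = cross2 u w * v $ i + cross2 v u * w $ i" for i
    using exhaust_2[of i] by (auto simp: cross2_def algebra_simps)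
  then show ?thesis
    using assms by (simp add: vec_eq_iff field_simps)
qed

text \<open>
  The limit directions below are unit vectors that are determined up to sign only, so distances
  between them are distances between pairs of antipodal points.
\<close>

definition line_dist :: "real^2 \<Rightarrow> real^2 \<Rightarrow> real" where
  "line_dist u v = min (norm (u - v)) (norm (u + v))"

lemma line_dist_le_cross2:
  assumes "norm u = 1" "norm v = 1"
  shows "line_dist u v \<le> 2 * \<bar>cross2 u v\<bar>"
proof -
  define d where "d = u $ 1 * v $ 1 + u $ 2 * v $ 2"
  have uv: "(u $ 1)\<^sup>2 + (u $ 2)\<^sup>2 = 1" "(v $ 1)\<^sup>2 + (v $ 2)\<^sup>2 = 1"
    using assms norm_sq_2[of u] norm_sq_2[of v] by simp_all
  have m: "(norm (u - v))\<^sup>2 = 2 - 2 * d" "(norm (u + v))\<^sup>2 = 2 + 2 * d"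
    unfolding norm_sq_2 d_def using uv by (simp_all add: power2_eq_square algebra_simps)
  have c: "(cross2 u v)\<^sup>2 = (1 - d) * (1 + d)"
    using uv unfolding cross2_def d_def by algebra
  have d1: "\<bar>d\<bar> \<le> 1"
    using m zero_le_power2[of "norm (u - v)"] zero_le_power2[of "norm (u + v)"] by linarith
  show ?thesis
  proof (cases "d \<ge> 0")
    case True
    have "(norm (u - v))\<^sup>2 \<le> (2 * \<bar>cross2 u v\<bar>)\<^sup>2"
    proof -
      have "(1 - d) * 1 \<le> (1 - d) * (1 + d)" using True d1 by (intro mult_left_mono) auto
      then show ?thesis unfolding m power_mult_distrib power2_abs c using d1 by simp
    qed
    then have "norm (u - v) \<le> 2 * \<bar>cross2 u v\<bar>" by (rule power2_le_imp_le) simp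
    then show ?thesis by (simp add: line_dist_def)
  next
    case False
    have "(norm (u + v))\<^sup>2 \<le> (2 * \<bar>cross2 u v\<bar>)\<^sup>2"
    proof -
      have "(1 + d) * 1 \<le> (1 + d) * (1 - d)" using False d1 by (intro mult_left_mono) auto
      then show ?thesis unfolding m power_mult_distrib power2_abs c using d1
        by (simp add: algebra_simps)
    qed
    then have "norm (u + v) \<le> 2 * \<bar>cross2 u v\<bar>" by (rule power2_le_imp_le) simp
    then show ?thesis by (simp add: line_dist_def)
  qed
qed

definition permanent2 :: "real^2^2 \<Rightarrow> real" where
  "permanent2 B = B $ 1 $ 1 * B $ 2 $ 2 + B $ 1 $ 2 * B $ 2 $ 1"

definition positive_matrix :: "real^2^2 \<Rightarrow> bool" where
  "positive_matrix B \<longleftrightarrow> (\<forall>i j. B $ i $ j > 0)"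

text \<open>
  The determinant is multiplicative, so the quotient \<open>\<bar>det\<bar> / permanent\<close> is submultiplicative on
  positive matrices; this is the source of all contraction below.
\<close>

lemma permanent2_supermult:
  assumes "positive_matrix B" "positive_matrix C"
  shows "permanent2 B * permanent2 C \<le> permanent2 (B ** C)"
proof -
  have p: "B $ i $ j > 0" "C $ i $ j > 0" for i j
    using assms by (auto simp: positive_matrix_def)
  have "permanent2 (B ** C) - permanent2 B * permanent2 C
     = 2 * (B$1$1 * B$2$1 * C$1$1 * C$1$2) + 2 * (B$1$2 * B$2$2 * C$2$1 * C$2$2)"
    unfolding permanent2_def matrix_matrix_mult_2 by algebra
  moreover have "\<dots> \<ge> 0" using p by (simp add: less_imp_le)
  ultimately show ?thesis by linarith
qed

lemma positive_matrix_mult: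
  "positive_matrix B \<Longrightarrow> positive_matrix C \<Longrightarrow> positive_matrix (B ** C)"
  by (simp add: positive_matrix_def matrix_matrix_mult_2 add_pos_pos)

lemma permanent2_pos: "positive_matrix B \<Longrightarrow> permanent2 B > 0"
  by (simp add: positive_matrix_def permanent2_def add_pos_pos)

lemma abs_det_less_perm2: "positive_matrix B \<Longrightarrow> \<bar>det B\<bar> < permanent2 B"
  using mult_pos_pos[of "B $ 1 $ 1" "B $ 2 $ 2"] mult_pos_pos[of "B $ 1 $ 2" "B $ 2 $ 1"]
  unfolding positive_matrix_def permanent2_def det_2 by (simp add: abs_if)

definition columns_comparable :: "real \<Rightarrow> real^2^2 \<Rightarrow> bool" where
  "columns_comparable R B \<longleftrightarrow> (\<forall>i. B $ i $ 1 \<le> R * B $ i $ 2 \<and> B $ i $ 2 \<le> R * B $ i $ 1)"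

lemma columns_comparable_mult:
  assumes "positive_matrix B" "columns_comparable R C"
  shows "columns_comparable R (B ** C)"
proof -
  have p: "0 \<le> B $ i $ j" for i j
    using assms by (simp add: positive_matrix_def less_imp_le)
  have c: "C $ i $ 1 \<le> R * C $ i $ 2" "C $ i $ 2 \<le> R * C $ i $ 1" for i
    using assms by (auto simp: columns_comparable_def)
  have "(B ** C) $ i $ 1 \<le> R * (B ** C) $ i $ 2" "(B ** C) $ i $ 2 \<le> R * (B ** C) $ i $ 1" for i
    using mult_left_mono[OF c(1)[of 1] p[of i 1]] mult_left_mono[OF c(1)[of 2] p[of i 2]]
      mult_left_mono[OF c(2)[of 1] p[of i 1]] mult_left_mono[OF c(2)[of 2] p[of i 2]]
    by (simp_all add: matrix_matrix_mult_2 algebra_simps)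
  then show ?thesis by (auto simp: columns_comparable_def)
qed

lemma scaled_matrix_vector: "(c *\<^sub>R B) *v v = c *\<^sub>R ((B::real^2^2) *v v)"
  by (simp add: vec_eq_iff matrix_vector_mult_2 algebra_simps)

lemma matrix_scaled_vector: "(B::real^2^2) *v (c *\<^sub>R v) = c *\<^sub>R (B *v v)"
  by (simp add: vec_eq_iff matrix_vector_mult_2 algebra_simps)

lemma det_scaleR_2: "det (c *\<^sub>R (B::real^2^2)) = c\<^sup>2 * det B"
  by (simp add: det_2 power2_eq_square algebra_simps)

lemma norm_le_sum_2: "norm (v::real^2) \<le> \<bar>v $ 1\<bar> + \<bar>v $ 2\<bar>"
  using norm_le_l1_cart[of v] by (simp add: sum_2)

lemma sum_le_norm_2: "\<bar>v $ 1\<bar> + \<bar>v $ 2\<bar> \<le> 2 * norm (v::real^2)"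
  using component_le_norm_cart[of v 1] component_le_norm_cart[of v 2] by simp

lemma matrix_inv_mult:
  fixes L :: "real^2^2"
  assumes "invertible L"
  shows "matrix_inv L ** L = mat 1" "L ** matrix_inv L = mat 1"
proof -
  have "\<exists>L'. L ** L' = mat 1 \<and> L' ** L = mat 1" using assms by (simp add: invertible_def)
  from someI_ex[OF this] show "matrix_inv L ** L = mat 1" "L ** matrix_inv L = mat 1"
    by (simp_all add: matrix_inv_def)
qed

lemma invertible_norm_bounds:
  fixes L :: "real^2^2"
  assumes "invertible L"
  shows "\<exists>b\<ge>1. (\<forall>x. norm (L *v x) \<le> b * norm x) \<and> (\<forall>x. norm x \<le> b * norm (L *v x)) \<and>
               \<bar>det L\<bar> \<le> b \<and> 1 \<le> b * \<bar>det L\<bar>"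
proof -
  have inv: "matrix_inv L ** L = mat 1" using assms by (rule matrix_inv_mult)
  have d: "det L \<noteq> 0" using assms invertible_det_nz by blast
  define b1 where "b1 = onorm ((*v) L)"
  define b2 where "b2 = onorm ((*v) (matrix_inv L))"
  have b1: "norm (L *v x) \<le> b1 * norm x" for x
    unfolding b1_def by (rule onorm) (rule matrix_vector_mul_bounded_linear)
  have b2: "norm x \<le> b2 * norm (L *v x)" for x
  proof -
    have "norm (matrix_inv L *v (L *v x)) \<le> b2 * norm (L *v x)"
      unfolding b2_def by (rule onorm) (rule matrix_vector_mul_bounded_linear)
    then show ?thesis using inv by (simp add: matrix_vector_mul_assoc)
  qed
  define b where "b = 1 + \<bar>b1\<bar> + \<bar>b2\<bar> + \<bar>det L\<bar> + \<bar>1 / \<bar>det L\<bar>\<bar>"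
  have b: "1 \<le> b" "b1 \<le> b" "b2 \<le> b" "\<bar>det L\<bar> \<le> b" "1 / \<bar>det L\<bar> \<le> b"
    unfolding b_def by linarith+
  have "norm (L *v x) \<le> b * norm x" "norm x \<le> b * norm (L *v x)" for x
    using b1[of x] b2[of x] mult_right_mono[OF b(2), of "norm x"]
      mult_right_mono[OF b(3), of "norm (L *v x)"] by auto
  moreover have "1 \<le> b * \<bar>det L\<bar>" using b(5) d by (simp add: field_simps)
  ultimately show ?thesis using b by blast
qed

section \<open>Cones mapped strictly inside cones\<close>

definition nonneg_quadrant :: "(real^2) set" where
  "nonneg_quadrant = {x. x \<noteq> 0 \<and> x $ 1 \<ge> 0 \<and> x $ 2 \<ge> 0}"

lemma convex_nonneg_quadrant: "convex nonneg_quadrant"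
proof (rule convexI)
  fix x y :: "real^2" and a b :: real
  assume xy: "x \<in> nonneg_quadrant" "y \<in> nonneg_quadrant" and ab: "0 \<le> a" "0 \<le> b" "a + b = 1"
  have p: "0 \<le> x $ i" "0 \<le> y $ i" for i
    using xy exhaust_2[of i] by (auto simp: nonneg_quadrant_def)
  have nn: "0 \<le> a * x $ i" "0 \<le> b * y $ i" for i using p ab by auto
  have "a *\<^sub>R x + b *\<^sub>R y \<noteq> 0"
  proof
    assume "a *\<^sub>R x + b *\<^sub>R y = 0"
    then have "a * x $ i + b * y $ i = 0" for i by (auto simp: vec_eq_iff)
    then have "a * x $ i = 0 \<and> b * y $ i = 0" for i
      using nn by (meson add_nonneg_eq_0_iff)
    then have "a *\<^sub>R x = 0" "b *\<^sub>R y = 0" by (auto simp: vec_eq_iff)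
    then show False using xy ab by (auto simp: nonneg_quadrant_def)
  qed
  then show "a *\<^sub>R x + b *\<^sub>R y \<in> nonneg_quadrant"
    using nn by (simp add: nonneg_quadrant_def)
qed

lemma standard_cone_eq: "v \<in> standard_cone \<longleftrightarrow> v \<in> nonneg_quadrant \<or> - v \<in> nonneg_quadrant"
  by (auto simp: standard_cone_def nonneg_quadrant_def zero_le_mult_iff)

lemma standard_cone_scaleR: "c \<noteq> 0 \<Longrightarrow> c *\<^sub>R v \<in> standard_cone \<longleftrightarrow> v \<in> standard_cone"
proof -
  assume "c \<noteq> 0"
  have "(c * v $ 1) * (c * v $ 2) = c\<^sup>2 * (v $ 1 * v $ 2)" by (simp add: power2_eq_square)
  then show ?thesis using \<open>c \<noteq> 0\<close>
    by (simp only: standard_cone_def mem_Collect_eq vector_scaleR_component real_scaleR_def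
        zero_le_mult_iff[of "c\<^sup>2"] zero_le_power2 scaleR_eq_0_iff) auto
qed

lemma closed_insert_standard_cone: "closed (insert 0 standard_cone)"
proof -
  have "insert 0 standard_cone = {v::real^2. 0 \<le> v $ 1 * v $ 2}"
    by (auto simp: standard_cone_def)
  moreover have "closed {v::real^2. 0 \<le> v $ 1 * v $ 2}"
    by (intro closed_Collect_le continuous_intros)
  ultimately show ?thesis by simp
qed

text \<open>
  A point on the axes that bound the standard cone has neighbours with coordinates of opposite sign.
\<close>

lemma open_subset_standard_cone:
  assumes "open U" "U \<subseteq> standard_cone" "x \<in> U"
  shows "x $ 1 * x $ 2 > 0"
proof (rule ccontr)
  assume n: "\<not> x $ 1 * x $ 2 > 0"
  have x: "x \<in> standard_cone" using assms by auto
  then have x0: "x \<noteq> 0" "x $ 1 = 0 \<or> x $ 2 = 0"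
    using n by (auto simp: standard_cone_def)
  obtain e where e: "e > 0" "ball x e \<subseteq> U" using assms openE by blast
  obtain y :: "real^2" where y: "norm (y - x) \<le> e / 2" "y $ 1 * y $ 2 < 0"
  proof (cases "x $ 1 = 0")
    case True
    then have x2: "x $ 2 \<noteq> 0" using x0 by (auto simp: vec_eq_iff forall_2)
    define y :: "real^2" where "y = x - (e / 2 * sgn (x $ 2)) *\<^sub>R vector [1, 0]"
    have "norm (y - x) \<le> e / 2"
      using norm_le_sum_2[of "y - x"] e x2 by (simp add: y_def abs_mult)
    moreover have "y $ 1 * y $ 2 < 0" using x2 e True by (auto simp add: y_def sgn_if mult_less_0_iff zero_less_mult_iff)
    ultimately show thesis by (rule that)
  next
    case False
    then have x2: "x $ 2 = 0" using x0 by auto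
    define y :: "real^2" where "y = x - (e / 2 * sgn (x $ 1)) *\<^sub>R vector [0, 1]"
    have "norm (y - x) \<le> e / 2"
      using norm_le_sum_2[of "y - x"] e False by (simp add: y_def abs_mult)
    moreover have "y $ 1 * y $ 2 < 0"
      using False e x2 by (auto simp add: y_def sgn_if mult_less_0_iff)
    ultimately show thesis by (rule that)
  qed
  have "dist x y < e" using y(1) e(1) by (metis dist_norm dist_commute field_sum_of_halves le_less_trans less_add_same_cancel1 half_gt_zero)
  then have "y \<in> standard_cone" using e assms by auto
  then show False using y by (simp add: standard_cone_def)
qed

lemma matrix_inv_vector_cancel:
  fixes L :: "real^2^2"
  assumes "invertible L"
  shows "matrix_inv L *v (L *v x) = x" "L *v (matrix_inv L *v x) = x"
  using matrix_inv_mult[OF assms] by (simp_all add: matrix_vector_mul_assoc)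

lemma invertible_vector_eq_0:
  fixes L :: "real^2^2"
  assumes "invertible L"
  shows "L *v x = 0 \<longleftrightarrow> x = 0"
  using matrix_inv_vector_cancel(1)[OF assms, of x] by auto

lemma closed_invertible_image:
  fixes L :: "real^2^2"
  assumes "invertible L" "closed S"
  shows "closed ((*v) L ` S)"
proof -
  have "(*v) L ` S = (*v) (matrix_inv L) -` S"
    using matrix_inv_vector_cancel[OF assms(1)] by (auto simp: image_iff) (metis)
  moreover have "closed ((*v) (matrix_inv L) -` S)"
    by (intro continuous_closed_vimage assms(2)
        linear_continuous_at matrix_vector_mul_bounded_linear)
  ultimately show ?thesis by simp
qed

lemma matrix_preserving_quadrant_sign:
  fixes B :: "real^2^2"
  assumes "\<And>x. x \<in> nonneg_quadrant \<Longrightarrow> (B *v x) $ 1 * (B *v x) $ 2 > 0"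
  shows "\<exists>s\<in>{1, -1}. positive_matrix (s *\<^sub>R B)"
proof -
  have c1: "B $ 1 $ 1 * B $ 2 $ 1 > 0"
    using assms[of "vector [1, 0]"]
    by (simp add: matrix_vector_mult_2 nonneg_quadrant_def vec_eq_iff forall_2)
  have c2: "B $ 1 $ 2 * B $ 2 $ 2 > 0"
    using assms[of "vector [0, 1]"]
    by (simp add: matrix_vector_mult_2 nonneg_quadrant_def vec_eq_iff forall_2)
  \<comment> \<open>entries of opposite sign in the first row would send some vector of the quadrant to an axis\<close>
  have c3: "B $ 1 $ 1 * B $ 1 $ 2 > 0"
  proof (rule ccontr)
    assume "\<not> B $ 1 $ 1 * B $ 1 $ 2 > 0"
    then have "B $ 1 $ 1 * B $ 1 $ 2 < 0" using c1 c2 by (smt (verit) mult_eq_0_iff)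
    then consider "B $ 1 $ 1 > 0" "B $ 1 $ 2 < 0" | "B $ 1 $ 1 < 0" "B $ 1 $ 2 > 0"
      by (auto simp: mult_less_0_iff)
    then show False
    proof cases
      case 1
      then show False using assms[of "vector [- B $ 1 $ 2, B $ 1 $ 1]"]
        by (simp add: matrix_vector_mult_2 nonneg_quadrant_def vec_eq_iff forall_2)
    next
      case 2
      then show False using assms[of "vector [B $ 1 $ 2, - B $ 1 $ 1]"]
        by (simp add: matrix_vector_mult_2 nonneg_quadrant_def vec_eq_iff forall_2)
    qed
  qed
  show ?thesis
  proof (cases "B $ 1 $ 1 > 0")
    case True
    then have "positive_matrix (1 *\<^sub>R B)"
      using c1 c2 c3 by (auto simp: positive_matrix_def forall_2 zero_less_mult_iff)
    then show ?thesis by blast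
  next
    case False
    then have "positive_matrix (-1 *\<^sub>R B)"
      using c1 c2 c3 by (auto simp: positive_matrix_def forall_2 zero_less_mult_iff)
    then show ?thesis by blast
  qed
qed

definition frame :: "(real^2) set \<Rightarrow> real^2^2" where
  "frame C = (SOME L. invertible L \<and> C = (*v) L ` standard_cone)"

lemma frame:
  assumes "plane_cone C"
  shows "invertible (frame C)" "(*v) (frame C) ` standard_cone = C"
proof -
  have "\<exists>L. invertible L \<and> C = (*v) L ` standard_cone" using assms by (simp add: plane_cone_def)
  from someI_ex[OF this] show "invertible (frame C)" "(*v) (frame C) ` standard_cone = C"
    by (simp_all add: frame_def)
qed

lemma plane_cone_coordinates:
  assumes "plane_cone C" "u \<in> C"
  obtains x where "x \<in> standard_cone" "u = frame C *v x"
proof -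
  have "u \<in> (*v) (frame C) ` standard_cone" using assms frame(2) by simp
  then show thesis using that by (elim imageE)
qed

lemma frame_in_plane_cone:
  assumes "plane_cone C" "x \<in> standard_cone"
  shows "frame C *v x \<in> C"
  using imageI[OF assms(2), of "(*v) (frame C)"] frame(2)[OF assms(1)] by simp

lemma plane_cone_scaleR:
  assumes "plane_cone C" "c \<noteq> 0"
  shows "c *\<^sub>R v \<in> C \<longleftrightarrow> v \<in> C"
proof -
  have sc: "a *\<^sub>R u \<in> C" if u: "u \<in> C" and "a \<noteq> 0" for a u
  proof -
    obtain x where x: "x \<in> standard_cone" "u = frame C *v x"
      by (rule plane_cone_coordinates[OF assms(1) u])
    have "a *\<^sub>R u = frame C *v (a *\<^sub>R x)" by (simp add: x matrix_scaled_vector)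
    moreover have "a *\<^sub>R x \<in> standard_cone" using standard_cone_scaleR \<open>a \<noteq> 0\<close> x(1) by blast
    ultimately show ?thesis using frame_in_plane_cone[OF assms(1)] by simp
  qed
  show ?thesis using sc[of v c] sc[of "c *\<^sub>R v" "inverse c"] assms(2) by auto
qed

lemma zero_notin_plane_cone:
  assumes "plane_cone C"
  shows "0 \<notin> C"
proof
  assume "0 \<in> C"
  then obtain x where "x \<in> standard_cone" "0 = frame C *v x"
    by (rule plane_cone_coordinates[OF assms])
  then show False
    using invertible_vector_eq_0[OF frame(1)[OF assms], of x] by (simp add: standard_cone_def)
qed

lemma closed_insert_plane_cone: "plane_cone C \<Longrightarrow> closed (insert 0 C)"
  using closed_invertible_image[OF frame(1) closed_insert_standard_cone, of C] frame(2)[of C]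
  by simp

lemma interior_plane_cone_coordinates:
  assumes C: "plane_cone C" and x: "frame C *v x \<in> interior C"
  shows "x $ 1 * x $ 2 > 0"
proof -
  define U where "U = (*v) (frame C) -` interior C"
  have "open U" unfolding U_def
    by (intro open_vimage open_interior linear_continuous_on matrix_vector_mul_bounded_linear)
  moreover have "U \<subseteq> standard_cone"
  proof
    fix y assume "y \<in> U"
    then have "frame C *v y \<in> C" using interior_subset by (auto simp: U_def)
    then obtain z where "z \<in> standard_cone" "frame C *v y = frame C *v z"
      by (rule plane_cone_coordinates[OF C])
    then show "y \<in> standard_cone" by (metis matrix_inv_vector_cancel(1)[OF frame(1)[OF C]])
  qed
  moreover have "x \<in> U" using x by (simp add: U_def)
  ultimately show ?thesis by (rule open_subset_standard_cone)
qed

locale cone_system =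
  fixes k :: nat and A :: "nat \<Rightarrow> real^2^2" and Cs :: "(real^2) set set"
  assumes invertible_letter: "i \<in> {1..k} \<Longrightarrow> invertible (A i)"
    and finite_cones: "finite Cs"
    and cones_nonempty: "Cs \<noteq> {}"
    and plane_cones: "C \<in> Cs \<Longrightarrow> plane_cone C"
    and disjoint_cones: "disjoint Cs"
    and strictly_invariant: "i \<in> {1..k} \<Longrightarrow> (*v) (A i) ` \<Union>Cs \<subseteq> interior (\<Union>Cs)"
    and disjoint_images:
      "i \<in> {1..k} \<Longrightarrow> j \<in> {1..k} \<Longrightarrow> i \<noteq> j \<Longrightarrow> (*v) (A i) ` \<Union>Cs \<inter> (*v) (A j) ` \<Union>Cs = {}"
begin

abbreviation M :: "(real^2) set" where "M \<equiv> \<Union>Cs"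

lemma zero_notin_M: "0 \<notin> M"
  using plane_cones zero_notin_plane_cone by blast

lemma M_scaleR: "c \<noteq> 0 \<Longrightarrow> c *\<^sub>R v \<in> M \<longleftrightarrow> v \<in> M"
  using plane_cones plane_cone_scaleR by auto

lemma closed_insert_M: "closed (insert 0 M)"
proof -
  have "insert 0 M = (\<Union>C\<in>Cs. insert 0 C)" using cones_nonempty by auto
  then show ?thesis
    using closed_UN[OF finite_cones, of "insert 0"] closed_insert_plane_cone plane_cones by auto
qed

lemma cone_disjoint_from_others: "C \<in> Cs \<Longrightarrow> C \<inter> \<Union>(Cs - {C}) = {}"
  using disjointD[OF disjoint_cones, of C] by auto

text \<open>
  Together with the origin each cone is closed, so the cones separate the connected components of a
  set that avoids the origin.
\<close>

lemma connected_subset_single_cone: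
  assumes "connected S" "S \<subseteq> M" "S \<noteq> {}"
  obtains C where "C \<in> Cs" "S \<subseteq> C" "S \<inter> \<Union>(Cs - {C}) = {}"
proof -
  obtain z C where z: "z \<in> S" "z \<in> C" "C \<in> Cs" using assms by blast
  define P where "P = insert 0 C"
  define Q where "Q = insert 0 (\<Union>(Cs - {C}))"
  have "closed P" unfolding P_def using closed_insert_plane_cone plane_cones z by blast
  moreover have "closed Q"
  proof -
    have "Q = {0} \<union> (\<Union>D\<in>Cs - {C}. insert 0 D)" by (auto simp: Q_def)
    then show ?thesis
      using closed_UN[of "Cs - {C}" "insert 0"] finite_cones closed_insert_plane_cone plane_cones
      by auto
  qed
  moreover have "S \<subseteq> P \<union> Q" using assms(2) z by (auto simp: P_def Q_def)
  moreover have PQ: "P \<inter> Q \<inter> S = {}"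
    using cone_disjoint_from_others[OF z(3)] zero_notin_M assms(2) by (auto simp: P_def Q_def)
  moreover have "P \<inter> S \<noteq> {}" using z by (auto simp: P_def)
  ultimately have "Q \<inter> S = {}" using assms(1) unfolding connected_closed by blast
  then have Q: "S \<inter> \<Union>(Cs - {C}) = {}" by (auto simp: Q_def)
  have "S \<subseteq> C"
  proof
    fix x assume x: "x \<in> S"
    then obtain D where "x \<in> D" "D \<in> Cs" using assms(2) by auto
    then show "x \<in> C" using Q x by (cases "D = C") auto
  qed
  then show thesis using that z(3) Q by simp
qed

lemma interior_M_in_cone:
  assumes "z \<in> interior M" "z \<in> C" "C \<in> Cs"
  shows "z \<in> interior C"
proof -
  define Q where "Q = insert 0 (\<Union>(Cs - {C}))"
  have "Q = {0} \<union> (\<Union>D\<in>Cs - {C}. insert 0 D)" by (auto simp: Q_def)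
  then have "closed Q"
    using closed_UN[of "Cs - {C}" "insert 0"] finite_cones closed_insert_plane_cone plane_cones
    by auto
  then have "open (interior M - Q)" by (intro open_Diff open_interior)
  moreover have "interior M - Q \<subseteq> C" using interior_subset[of M] by (auto simp: Q_def)
  moreover have "z \<in> interior M - Q"
    using assms cone_disjoint_from_others[OF assms(3)] zero_notin_M interior_subset[of M]
    by (auto simp: Q_def)
  ultimately show ?thesis by (meson interior_maximal subsetD)
qed

text \<open>
  A letter sends the connected half of a cone into one cone of the multicone and, in the frames of
  the two cones, into an open quadrant: its matrix has entries of one sign.
\<close>

lemma letter_in_frames:
  assumes i: "i \<in> {1..k}" and C: "C \<in> Cs"
  shows "\<exists>C'\<in>Cs. \<exists>s\<in>{1,-1}. \<exists>B. positive_matrix B \<and> A i ** frame C = s *\<^sub>R (frame C' ** B)"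
proof -
  define S where "S = (*v) (A i ** frame C) ` nonneg_quadrant"
  have conn: "connected S" unfolding S_def
    by (intro connected_continuous_image convex_connected convex_nonneg_quadrant
        linear_continuous_on matrix_vector_mul_bounded_linear)
  have int: "S \<subseteq> interior M"
  proof
    fix z assume "z \<in> S"
    then obtain x where x: "x \<in> nonneg_quadrant" "z = A i *v (frame C *v x)"
      by (auto simp: S_def matrix_vector_mul_assoc)
    then have "frame C *v x \<in> M"
      using frame_in_plane_cone[OF plane_cones[OF C]] standard_cone_eq C by blast
    then show "z \<in> interior M" using x(2) strictly_invariant[OF i] by blast
  qed
  have "vector [1, 0] \<in> nonneg_quadrant" by (simp add: nonneg_quadrant_def vec_eq_iff forall_2)
  then have "S \<noteq> {}" by (auto simp: S_def)
  then obtain C' where C': "C' \<in> Cs" "S \<subseteq> C'"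
    using connected_subset_single_cone[OF conn] int interior_subset by (metis order_trans)
  have S_int: "S \<subseteq> interior C'" using interior_M_in_cone int C' by blast
  note inv' = frame(1)[OF plane_cones[OF C'(1)]]
  define B where "B = matrix_inv (frame C') ** (A i ** frame C)"
  have FB: "frame C' ** B = A i ** frame C"
    unfolding B_def by (simp add: matrix_mul_assoc matrix_inv_mult[OF inv'] matrix_mul_lid)
  have "(B *v x) $ 1 * (B *v x) $ 2 > 0" if "x \<in> nonneg_quadrant" for x
  proof (rule interior_plane_cone_coordinates[OF plane_cones[OF C'(1)]])
    have "frame C' *v (B *v x) = (A i ** frame C) *v x"
      by (simp add: FB matrix_vector_mul_assoc)
    then show "frame C' *v (B *v x) \<in> interior C'" using that S_int by (auto simp: S_def)
  qed
  then have "\<exists>s\<in>{1, -1}. positive_matrix (s *\<^sub>R B)" by (rule matrix_preserving_quadrant_sign)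
  then obtain s where s: "s \<in> {1, -1}" "positive_matrix (s *\<^sub>R B)" by blast
  have "A i ** frame C = s *\<^sub>R (frame C' ** (s *\<^sub>R B))"
    using s(1) by (auto simp: FB[symmetric] vec_eq_iff matrix_matrix_mult_2 algebra_simps)
  then show ?thesis using C' s by blast
qed

text \<open>
  There are finitely many letters and cones, so the quotient \<open>\<bar>det\<bar> / permanent\<close>, which is less than 1 for
  each of these positive matrices, and the quotients of the two columns have common bounds.
\<close>

lemma uniform_letter_in_frames:
  "\<exists>\<kappa> R. 0 < \<kappa> \<and> \<kappa> < 1 \<and> 1 \<le> R \<and> (\<forall>i\<in>{1..k}. \<forall>C\<in>Cs. \<exists>C'\<in>Cs. \<exists>s\<in>{1,-1}. \<exists>B.
     positive_matrix B \<and> columns_comparable R B \<and> \<bar>det B\<bar> \<le> \<kappa> * permanent2 B \<and>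
     A i ** frame C = s *\<^sub>R (frame C' ** B))"
proof -
  define P where "P = (\<lambda>i C \<kappa> R. \<exists>C'\<in>Cs. \<exists>s\<in>{1,-1}. \<exists>B.
     positive_matrix B \<and> columns_comparable R B \<and> \<bar>det B\<bar> \<le> \<kappa> * permanent2 B \<and>
     A i ** frame C = s *\<^sub>R (frame C' ** B))"
  have mono: "P i C \<kappa>' R'" if PiC: "P i C \<kappa> R" and "\<kappa> \<le> \<kappa>'" "R \<le> R'" for i C \<kappa> \<kappa>' R R'
  proof -
    obtain C' s B where B: "C' \<in> Cs" "s \<in> {1, -1}" "positive_matrix B" "columns_comparable R B"
      "\<bar>det B\<bar> \<le> \<kappa> * permanent2 B" "A i ** frame C = s *\<^sub>R (frame C' ** B)"
      using PiC unfolding P_def by blast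
    have "0 \<le> B $ a $ b" for a b using B(3) by (simp add: positive_matrix_def less_imp_le)
    then have "columns_comparable R' B"
      using B(4) \<open>R \<le> R'\<close> unfolding columns_comparable_def
      by (meson mult_right_mono order_trans)
    moreover have "\<bar>det B\<bar> \<le> \<kappa>' * permanent2 B"
      using B(5) permanent2_pos[OF B(3)] \<open>\<kappa> \<le> \<kappa>'\<close> by (meson less_imp_le mult_right_mono order_trans)
    ultimately show ?thesis unfolding P_def using B by blast
  qed
  have single: "\<exists>\<kappa> R. 0 < \<kappa> \<and> \<kappa> < 1 \<and> 1 \<le> R \<and> P i C \<kappa> R" if iC: "i \<in> {1..k}" "C \<in> Cs" for i C
  proof -
    obtain C' s B where B: "C' \<in> Cs" "s \<in> {1, -1}" "positive_matrix B"
      "A i ** frame C = s *\<^sub>R (frame C' ** B)"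
      using letter_in_frames[OF iC] by blast
    have p: "B $ a $ b > 0" for a b using B(3) by (simp add: positive_matrix_def)
    define \<kappa> where "\<kappa> = max (1/2) (\<bar>det B\<bar> / permanent2 B)"
    define R where "R = 1 + B $ 1 $ 1 / B $ 1 $ 2 + B $ 2 $ 1 / B $ 2 $ 2
                          + B $ 1 $ 2 / B $ 1 $ 1 + B $ 2 $ 2 / B $ 2 $ 1"
    have q: "B $ a $ b / B $ c $ d > 0" for a b c d using p by simp
    have "B $ 1 $ 1 / B $ 1 $ 2 \<le> R" "B $ 1 $ 2 / B $ 1 $ 1 \<le> R"
         "B $ 2 $ 1 / B $ 2 $ 2 \<le> R" "B $ 2 $ 2 / B $ 2 $ 1 \<le> R" and R_ge: "1 \<le> R"
      using q[of 1 1 1 2] q[of 2 1 2 2] q[of 1 2 1 1] q[of 2 2 2 1] unfolding R_def by linarith+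
    then have R1: "B $ a $ 1 / B $ a $ 2 \<le> R" "B $ a $ 2 / B $ a $ 1 \<le> R" for a
      using exhaust_2[of a] by (elim disjE; simp only:)+
    have "B $ a $ 1 \<le> R * B $ a $ 2 \<and> B $ a $ 2 \<le> R * B $ a $ 1" for a
      using R1[of a] p[of a 1] p[of a 2] by (simp only: pos_divide_le_eq)
    then have "columns_comparable R B" unfolding columns_comparable_def by blast
    moreover have "\<bar>det B\<bar> \<le> \<kappa> * permanent2 B"
      using permanent2_pos[OF B(3)] pos_divide_le_eq[of "permanent2 B" "\<bar>det B\<bar>" \<kappa>]
      unfolding \<kappa>_def by simp
    ultimately have "P i C \<kappa> R" unfolding P_def using B by blast
    moreover have "0 < \<kappa>" "\<kappa> < 1"
      using abs_det_less_perm2[OF B(3)] permanent2_pos[OF B(3)] by (auto simp: \<kappa>_def)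
    ultimately show ?thesis using R_ge by blast
  qed
  define I where "I = {1..k} \<times> Cs"
  have "finite I" using finite_cones by (simp add: I_def)
  then have "I \<subseteq> {1..k} \<times> Cs \<Longrightarrow> \<exists>\<kappa> R. 0 < \<kappa> \<and> \<kappa> < 1 \<and> 1 \<le> R \<and> (\<forall>x\<in>I. P (fst x) (snd x) \<kappa> R)"
  proof (induction I rule: finite_induct)
    case empty
    show ?case by (rule exI[of _ "1/2"], rule exI[of _ 1]) auto
  next
    case (insert x J)
    then obtain \<kappa> R where 1: "0 < \<kappa>" "\<kappa> < 1" "1 \<le> R" "\<forall>x\<in>J. P (fst x) (snd x) \<kappa> R" by auto
    obtain \<kappa>' R' where 2: "0 < \<kappa>'" "\<kappa>' < 1" "1 \<le> R'" "P (fst x) (snd x) \<kappa>' R'"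
      using single[of "fst x" "snd x"] insert.prems by auto
    have "\<forall>y\<in>insert x J. P (fst y) (snd y) (max \<kappa> \<kappa>') (max R R')"
      using 1 2 mono by (metis insertE max.cobounded1 max.cobounded2)
    moreover have "0 < max \<kappa> \<kappa>'" "max \<kappa> \<kappa>' < 1" "1 \<le> max R R'" using 1 2 by auto
    ultimately show ?case by blast
  qed
  then show ?thesis unfolding I_def P_def by fastforce
qed

lemma frames_bounded:
  "\<exists>b\<ge>1. \<forall>C\<in>Cs. (\<forall>x. norm (frame C *v x) \<le> b * norm x) \<and> (\<forall>x. norm x \<le> b * norm (frame C *v x)) \<and>
     \<bar>det (frame C)\<bar> \<le> b \<and> 1 \<le> b * \<bar>det (frame C)\<bar>"
proof -
  define P where "P = (\<lambda>C b. (\<forall>x. norm (frame C *v x) \<le> b * norm x) \<and>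
     (\<forall>x. norm x \<le> b * norm (frame C *v x)) \<and> \<bar>det (frame C)\<bar> \<le> b \<and> 1 \<le> b * \<bar>det (frame C)\<bar>)"
  have "\<forall>C\<in>Cs. \<exists>b\<ge>1. P C b"
    unfolding P_def using invertible_norm_bounds frame(1) plane_cones by blast
  then obtain f where f: "\<And>C. C \<in> Cs \<Longrightarrow> f C \<ge> 1 \<and> P C (f C)" by metis
  define b where "b = Max (f ` Cs)"
  have fb: "f C \<le> b" if "C \<in> Cs" for C using that finite_cones by (simp add: b_def)
  have b1: "b \<ge> 1" using fb f cones_nonempty by (meson ex_in_conv order_trans)
  have "P C b" if C: "C \<in> Cs" for C
  proof -
    have "norm (frame C *v x) \<le> b * norm x" "norm x \<le> b * norm (frame C *v x)" for x
      using f[OF C] mult_right_mono[OF fb[OF C], of "norm x"]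
        mult_right_mono[OF fb[OF C], of "norm (frame C *v x)"]
      unfolding P_def by (meson norm_ge_zero order_trans)+
    moreover have "\<bar>det (frame C)\<bar> \<le> b" "1 \<le> b * \<bar>det (frame C)\<bar>"
      using f[OF C] fb[OF C] mult_right_mono[OF fb[OF C], of "\<bar>det (frame C)\<bar>"]
      unfolding P_def by linarith+
    ultimately show ?thesis by (simp add: P_def)
  qed
  then show ?thesis using b1 unfolding P_def by blast
qed

end

section \<open>Products along words\<close>

primrec word_prod :: "(nat \<Rightarrow> real^2^2) \<Rightarrow> nat list \<Rightarrow> real^2^2" where
  "word_prod A [] = mat 1"
| "word_prod A (i # w) = A i ** word_prod A w"

lemma word_prod_append: "word_prod A (v @ w) = word_prod A v ** word_prod A w"
  by (induction v) (simp_all add: matrix_mul_lid matrix_mul_assoc)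

lemma matrix_mult_scaleR_right: "(B::real^2^2) ** (c *\<^sub>R (D::real^2^2)) = c *\<^sub>R (B ** D)"
  by (simp add: vec_eq_iff matrix_matrix_mult_2 algebra_simps)

lemma matrix_mult_scaleR_left: "(c *\<^sub>R (B::real^2^2)) ** (D::real^2^2) = c *\<^sub>R (B ** D)"
  by (simp add: vec_eq_iff matrix_matrix_mult_2 algebra_simps)

definition entry_sum :: "real^2^2 \<Rightarrow> real" where
  "entry_sum B = B $ 1 $ 1 + B $ 1 $ 2 + B $ 2 $ 1 + B $ 2 $ 2"

lemma norm_positive_matrix_le:
  assumes "positive_matrix B"
  shows "norm (B *v x) \<le> entry_sum B * norm x"
proof -
  have p: "0 \<le> B $ i $ j" for i j
    using assms by (simp add: positive_matrix_def less_imp_le)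
  have c: "\<bar>(B *v x) $ i\<bar> \<le> B $ i $ 1 * norm x + B $ i $ 2 * norm x" for i
  proof -
    have "\<bar>(B *v x) $ i\<bar> \<le> B $ i $ 1 * \<bar>x $ 1\<bar> + B $ i $ 2 * \<bar>x $ 2\<bar>"
      using p[of i 1] p[of i 2] abs_triangle_ineq[of "B $ i $ 1 * x $ 1" "B $ i $ 2 * x $ 2"]
      by (simp add: matrix_vector_mult_2 abs_mult)
    also have "\<dots> \<le> B $ i $ 1 * norm x + B $ i $ 2 * norm x"
      by (intro add_mono mult_left_mono component_le_norm_cart p)
    finally show ?thesis .
  qed
  show ?thesis
    using norm_le_sum_2[of "B *v x"] c[of 1] c[of 2] by (simp add: entry_sum_def algebra_simps)
qed

text \<open>
  Comparable columns prevent cancellation uniformly: on the standard cone the action of a positive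
  matrix is as large as the matrix.
\<close>

lemma norm_positive_matrix_ge:
  assumes B: "positive_matrix B" "columns_comparable R B" and R: "1 \<le> R" and x: "x \<in> standard_cone"
  shows "entry_sum B * norm x \<le> 4 * R * norm (B *v x)"
proof -
  have p: "0 \<le> B $ i $ j" for i j
    using B(1) by (simp add: positive_matrix_def less_imp_le)
  have main: "entry_sum B * norm y \<le> 4 * R * norm (B *v y)" if y: "y \<in> nonneg_quadrant" for y
  proof -
    have y0: "0 \<le> y $ 1" "0 \<le> y $ 2" using y by (auto simp: nonneg_quadrant_def)
    have row: "(B $ i $ 1 + B $ i $ 2) * (y $ 1 + y $ 2) \<le> 2 * R * (B *v y) $ i" for i
    proof -
      have "B $ i $ 1 \<le> R * B $ i $ 1" "B $ i $ 2 \<le> R * B $ i $ 2"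
        using mult_right_mono[OF R p[of i 1]] mult_right_mono[OF R p[of i 2]] by simp_all
      moreover have "B $ i $ 1 \<le> R * B $ i $ 2" "B $ i $ 2 \<le> R * B $ i $ 1"
        using B(2) by (auto simp: columns_comparable_def)
      ultimately have "(B $ i $ 1 + B $ i $ 2) \<le> 2 * R * B $ i $ 1"
                "(B $ i $ 1 + B $ i $ 2) \<le> 2 * R * B $ i $ 2"
        by (simp_all add: mult.assoc)
      from mult_right_mono[OF this(1) y0(1)] mult_right_mono[OF this(2) y0(2)]
      show ?thesis by (simp add: matrix_vector_mult_2 algebra_simps)
    qed
    have "entry_sum B * norm y \<le> entry_sum B * (y $ 1 + y $ 2)"
      using norm_le_sum_2[of y] y0 p by (intro mult_left_mono) (auto simp: entry_sum_def)
    also have "\<dots> \<le> 2 * R * ((B *v y) $ 1 + (B *v y) $ 2)"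
      using row[of 1] row[of 2] by (simp add: entry_sum_def algebra_simps)
    also have "\<dots> \<le> 2 * R * (2 * norm (B *v y))"
      using sum_le_norm_2[of "B *v y"] R by (intro mult_left_mono) auto
    finally show ?thesis by simp
  qed
  show ?thesis
  proof (cases "x \<in> nonneg_quadrant")
    case True
    then show ?thesis by (rule main)
  next
    case False
    then have "- x \<in> nonneg_quadrant" using x standard_cone_eq by blast
    from main[OF this] show ?thesis
      using matrix_scaled_vector[of B "-1" x] by simp
  qed
qed

lemma permanent2_le_entry_sum:
  assumes "positive_matrix B"
  shows "permanent2 B \<le> (entry_sum B)\<^sup>2"
proof -
  have p: "0 \<le> B $ i $ j" for i j
    using assms by (simp add: positive_matrix_def less_imp_le)
  have "(entry_sum B)\<^sup>2 - permanent2 B = (B$1$1)\<^sup>2 + (B$1$2)\<^sup>2 + (B$2$1)\<^sup>2 + (B$2$2)\<^sup>2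
    + 2*(B$1$1*B$1$2) + 2*(B$1$1*B$2$1) + B$1$1*B$2$2 + B$1$2*B$2$1 + 2*(B$1$2*B$2$2) + 2*(B$2$1*B$2$2)"
    unfolding entry_sum_def permanent2_def by algebra
  moreover have "\<dots> \<ge> 0" by (intro add_nonneg_nonneg mult_nonneg_nonneg p zero_le_power2 zero_le_numeral)
  ultimately show ?thesis by linarith
qed

context cone_system
begin

lemma invertible_word_prod: "set w \<subseteq> {1..k} \<Longrightarrow> invertible (word_prod A w)"
proof (induction w)
  case Nil
  show ?case by (simp add: invertible_def)
next
  case (Cons i w)
  then show ?case by (simp add: invertible_mult invertible_letter)
qed

lemma letter_M: "i \<in> {1..k} \<Longrightarrow> v \<in> M \<Longrightarrow> A i *v v \<in> M"
  using strictly_invariant interior_subset by blast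

lemma word_prod_M: "set w \<subseteq> {1..k} \<Longrightarrow> v \<in> M \<Longrightarrow> word_prod A w *v v \<in> M"
proof (induction w)
  case (Cons i w)
  then have "A i *v (word_prod A w *v v) \<in> M" by (intro letter_M) auto
  then show ?case by (simp add: matrix_vector_mul_assoc)
qed simp

text \<open>
  The one-letter statement is iterated. The determinants multiply while the permanents multiply at
  least, which gives the power of \<open>\<kappa>\<close>; the comparison of the columns is inherited from the letter
  that acts first.
\<close>

lemma word_in_frames:
  "\<exists>\<kappa> R. 0 < \<kappa> \<and> \<kappa> < 1 \<and> 1 \<le> R \<and> (\<forall>w. w \<noteq> [] \<longrightarrow> set w \<subseteq> {1..k} \<longrightarrow> (\<forall>C\<in>Cs.
     \<exists>C'\<in>Cs. \<exists>s\<in>{1,-1}. \<exists>B. positive_matrix B \<and> columns_comparable R B \<and>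
       \<bar>det B\<bar> \<le> \<kappa> ^ length w * permanent2 B \<and> word_prod A w ** frame C = s *\<^sub>R (frame C' ** B)))"
proof -
  obtain \<kappa> R where kR: "0 < \<kappa>" "\<kappa> < 1" "1 \<le> R" and letter:
    "\<And>i C. i\<in>{1..k} \<Longrightarrow> C\<in>Cs \<Longrightarrow> \<exists>C'\<in>Cs. \<exists>s\<in>{1,-1}. \<exists>B.
     positive_matrix B \<and> columns_comparable R B \<and> \<bar>det B\<bar> \<le> \<kappa> * permanent2 B \<and>
     A i ** frame C = s *\<^sub>R (frame C' ** B)"
    using uniform_letter_in_frames by blast
  have "\<exists>C'\<in>Cs. \<exists>s\<in>{1,-1}. \<exists>B. positive_matrix B \<and> columns_comparable R B \<and>
      \<bar>det B\<bar> \<le> \<kappa> ^ length w * permanent2 B \<and> word_prod A w ** frame C = s *\<^sub>R (frame C' ** B)"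
    if "w \<noteq> []" "set w \<subseteq> {1..k}" "C \<in> Cs" for w C
    using that
  proof (induction w)
    case (Cons i w)
    have i: "i \<in> {1..k}" and sub: "set w \<subseteq> {1..k}" using Cons.prems by auto
    show ?case
    proof (cases "w = []")
      case True
      then show ?thesis using letter[OF i Cons.prems(3)] by (simp add: matrix_mul_rid)
    next
      case False
      then obtain C1 s B where B: "C1 \<in> Cs" "s \<in> {1, -1}" "positive_matrix B" "columns_comparable R B"
        "\<bar>det B\<bar> \<le> \<kappa> ^ length w * permanent2 B" "word_prod A w ** frame C = s *\<^sub>R (frame C1 ** B)"
        using Cons.IH[OF False sub Cons.prems(3)] by blast
      obtain C' s' D where D: "C' \<in> Cs" "s' \<in> {1, -1}" "positive_matrix D" "columns_comparable R D"
        "\<bar>det D\<bar> \<le> \<kappa> * permanent2 D" "A i ** frame C1 = s' *\<^sub>R (frame C' ** D)"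
        using letter[OF i B(1)] by blast
      have "word_prod A (i # w) ** frame C = A i ** (word_prod A w ** frame C)"
        by (simp add: matrix_mul_assoc)
      also have "\<dots> = (s' * s) *\<^sub>R (frame C' ** (D ** B))"
        by (simp add: B(6) D(6) matrix_mult_scaleR_right matrix_mult_scaleR_left matrix_mul_assoc
            mult.commute)
      finally have eq: "word_prod A (i # w) ** frame C = (s' * s) *\<^sub>R (frame C' ** (D ** B))" .
      have "\<bar>det (D ** B)\<bar> \<le> (\<kappa> * permanent2 D) * (\<kappa> ^ length w * permanent2 B)"
        unfolding det_mul abs_mult using B(5) D(5) kR(1) permanent2_pos[OF D(3)] by (intro mult_mono) auto
      also have "\<dots> = \<kappa> ^ length (i # w) * (permanent2 D * permanent2 B)" by simp
      also have "\<dots> \<le> \<kappa> ^ length (i # w) * permanent2 (D ** B)"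
        using permanent2_supermult[OF D(3) B(3)] kR(1) by (intro mult_left_mono) auto
      finally have "\<bar>det (D ** B)\<bar> \<le> \<kappa> ^ length (i # w) * permanent2 (D ** B)" .
      moreover have "s' * s \<in> {1, -1}" using B(2) D(2) by auto
      ultimately show ?thesis
        using eq D(1) positive_matrix_mult[OF D(3) B(3)] columns_comparable_mult[OF D(3) B(4)] by blast
    qed
  qed simp
  then show ?thesis using kR by blast
qed

text \<open>
  Both estimates are read off in frames: the product is a positive matrix with comparable columns
  there. The first says that vectors of the multicone witness the norm of every product; the second
  that products contract the multicone projectively, at a uniform exponential rate.
\<close>

lemma word_estimates:
  "\<exists>D\<ge>1. \<exists>\<kappa>. 0 < \<kappa> \<and> \<kappa> < 1 \<and> (\<forall>w u. set w \<subseteq> {1..k} \<longrightarrow> u \<in> M \<longrightarrow>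
     (\<forall>z. norm (word_prod A w *v z) * norm u \<le> D * norm (word_prod A w *v u) * norm z) \<and>
     \<bar>det (word_prod A w)\<bar> * (norm u)\<^sup>2 \<le> D * \<kappa> ^ length w * (norm (word_prod A w *v u))\<^sup>2)"
proof -
  obtain \<kappa> R where kR: "0 < \<kappa>" "\<kappa> < 1" "1 \<le> R" and word:
    "\<And>w C. w \<noteq> [] \<Longrightarrow> set w \<subseteq> {1..k} \<Longrightarrow> C\<in>Cs \<Longrightarrow>
     \<exists>C'\<in>Cs. \<exists>s\<in>{1,-1}. \<exists>B. positive_matrix B \<and> columns_comparable R B \<and>
       \<bar>det B\<bar> \<le> \<kappa> ^ length w * permanent2 B \<and> word_prod A w ** frame C = s *\<^sub>R (frame C' ** B)"
    using word_in_frames by metis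
  obtain b where b: "1 \<le> b" and
    bnd: "\<And>C x. C \<in> Cs \<Longrightarrow> norm (frame C *v x) \<le> b * norm x"
      "\<And>C x. C \<in> Cs \<Longrightarrow> norm x \<le> b * norm (frame C *v x)"
      "\<And>C. C \<in> Cs \<Longrightarrow> \<bar>det (frame C)\<bar> \<le> b" "\<And>C. C \<in> Cs \<Longrightarrow> 1 \<le> b * \<bar>det (frame C)\<bar>"
    using frames_bounded by metis
  define D where "D = (4 * R)\<^sup>2 * b ^ 6"
  have b0: "0 \<le> b" using b by simp
  have b6: "b ^ n \<le> b ^ 6" if "n \<le> 6" for n using b that by (rule power_increasing[rotated])
  have R16: "1 \<le> (4 * R)\<^sup>2" "4 * R \<le> (4 * R)\<^sup>2"
    using kR(3) mult_mono[OF kR(3) kR(3)] mult_right_mono[OF kR(3), of R]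
    unfolding power2_eq_square by linarith+
  have D1: "1 \<le> D" using mult_mono[OF R16(1) b6[of 0]] by (simp add: D_def)
  have "(\<forall>z. norm (word_prod A w *v z) * norm u \<le> D * norm (word_prod A w *v u) * norm z) \<and>
     \<bar>det (word_prod A w)\<bar> * (norm u)\<^sup>2 \<le> D * \<kappa> ^ length w * (norm (word_prod A w *v u))\<^sup>2"
    if w: "set w \<subseteq> {1..k}" and u: "u \<in> M" for w u
  proof (cases "w = []")
    case True
    have "norm z * norm u \<le> D * (norm u * norm z)" for z :: "real^2"
      using mult_right_mono[OF D1, of "norm u * norm z"] by (simp add: mult.commute)
    moreover have "(norm u)\<^sup>2 \<le> D * (norm u)\<^sup>2"
      using mult_right_mono[OF D1, of "(norm u)\<^sup>2"] by simp
    ultimately show ?thesis using True by (simp add: mult.assoc)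
  next
    case False
    obtain C where C: "C \<in> Cs" "u \<in> C" using u by auto
    obtain x where x: "x \<in> standard_cone" "u = frame C *v x"
      by (rule plane_cone_coordinates[OF plane_cones[OF C(1)] C(2)])
    obtain C' s B where B: "C' \<in> Cs" "s \<in> {1, -1}" "positive_matrix B" "columns_comparable R B"
      "\<bar>det B\<bar> \<le> \<kappa> ^ length w * permanent2 B" "word_prod A w ** frame C = s *\<^sub>R (frame C' ** B)"
      using word[OF False w C(1)] by blast
    have s: "\<bar>s\<bar> = 1" "s\<^sup>2 = 1" using B(2) by auto
    have img: "norm (word_prod A w *v (frame C *v y)) = norm (frame C' *v (B *v y))" for y
      using s by (simp add: matrix_vector_mul_assoc B(6) scaled_matrix_vector)
    define N where "N = norm (word_prod A w *v u)"
    define S where "S = entry_sum B"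
    have S0: "0 \<le> S" using B(3) by (simp add: S_def entry_sum_def positive_matrix_def less_imp_le)
    have N: "S * norm u \<le> 4 * R * b\<^sup>2 * N"
    proof -
      have "S * norm u \<le> S * (b * norm x)"
        using bnd(1)[OF C(1), of x] S0 x(2) by (intro mult_left_mono) auto
      also have "\<dots> = b * (S * norm x)" by simp
      also have "\<dots> \<le> b * (4 * R * norm (B *v x))"
        using norm_positive_matrix_ge[OF B(3,4) kR(3) x(1)] b0 by (intro mult_left_mono) (auto simp: S_def)
      also have "\<dots> \<le> b * (4 * R * (b * N))"
        using bnd(2)[OF B(1), of "B *v x"] b0 kR(3) img[of x] x(2)
        by (intro mult_left_mono) (auto simp: N_def)
      finally show ?thesis by (simp add: power2_eq_square mult_ac)
    qed
    have "norm (word_prod A w *v z) * norm u \<le> D * N * norm z" for z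
    proof -
      define y where "y = matrix_inv (frame C) *v z"
      have z: "z = frame C *v y"
        using matrix_inv_vector_cancel(2)[OF frame(1)[OF plane_cones[OF C(1)]]] by (simp add: y_def)
      have "norm (word_prod A w *v z) \<le> b * norm (B *v y)"
        using bnd(1)[OF B(1)] img z by simp
      also have "\<dots> \<le> b * (S * norm y)"
        using norm_positive_matrix_le[OF B(3)] b0 by (intro mult_left_mono) (auto simp: S_def)
      also have "\<dots> \<le> b * (S * (b * norm z))"
        using bnd(2)[OF C(1), of y] b0 S0 z by (intro mult_left_mono) auto
      finally have "norm (word_prod A w *v z) * norm u \<le> b * (S * (b * norm z)) * norm u"
        by (rule mult_right_mono) simp
      also have "\<dots> = b\<^sup>2 * norm z * (S * norm u)" by (simp add: power2_eq_square mult_ac)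
      also have "\<dots> \<le> b\<^sup>2 * norm z * (4 * R * b\<^sup>2 * N)" using N by (intro mult_left_mono) auto
      also have "\<dots> = (4 * R) * b ^ 4 * (N * norm z)" by (simp add: power2_eq_square power4_eq_xxxx mult_ac)
      also have "\<dots> \<le> D * (N * norm z)"
        unfolding D_def using R16 b6[of 4] b0 kR(3)
        by (intro mult_right_mono mult_mono) (auto simp: N_def)
      finally show ?thesis by (simp add: mult_ac)
    qed
    moreover have "\<bar>det (word_prod A w)\<bar> * (norm u)\<^sup>2 \<le> D * \<kappa> ^ length w * N\<^sup>2"
    proof -
      have "det (word_prod A w) * det (frame C) = s\<^sup>2 * (det (frame C') * det B)"
        by (metis B(6) det_mul det_scaleR_2)
      then have "\<bar>det (word_prod A w)\<bar> * \<bar>det (frame C)\<bar> = \<bar>det (frame C')\<bar> * \<bar>det B\<bar>"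
        using s(2) by (metis abs_mult mult_1)
      also have "\<dots> \<le> b * (\<kappa> ^ length w * S\<^sup>2)"
      proof (rule mult_mono[OF bnd(3)[OF B(1)]])
        have "\<kappa> ^ length w * permanent2 B \<le> \<kappa> ^ length w * S\<^sup>2"
          unfolding S_def using permanent2_le_entry_sum[OF B(3)] kR(1) by (intro mult_left_mono) auto
        then show "\<bar>det B\<bar> \<le> \<kappa> ^ length w * S\<^sup>2" using B(5) by linarith
      qed (use b0 in auto)
      finally have d: "\<bar>det (word_prod A w)\<bar> * \<bar>det (frame C)\<bar> \<le> b * (\<kappa> ^ length w * S\<^sup>2)" .
      have "\<bar>det (word_prod A w)\<bar> \<le> \<bar>det (word_prod A w)\<bar> * (b * \<bar>det (frame C)\<bar>)"
        using mult_left_mono[OF bnd(4)[OF C(1)], of "\<bar>det (word_prod A w)\<bar>"] by simp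
      also have "\<dots> = b * (\<bar>det (word_prod A w)\<bar> * \<bar>det (frame C)\<bar>)" by simp
      also have "\<dots> \<le> b * (b * (\<kappa> ^ length w * S\<^sup>2))" using d b0 by (intro mult_left_mono) auto
      finally have "\<bar>det (word_prod A w)\<bar> * (norm u)\<^sup>2 \<le> b * (b * (\<kappa> ^ length w * S\<^sup>2)) * (norm u)\<^sup>2"
        by (rule mult_right_mono) simp
      also have "\<dots> = b\<^sup>2 * \<kappa> ^ length w * (S * norm u)\<^sup>2" by (simp add: power2_eq_square mult_ac)
      also have "\<dots> \<le> b\<^sup>2 * \<kappa> ^ length w * (4 * R * b\<^sup>2 * N)\<^sup>2"
        using N S0 kR(1) by (intro mult_left_mono power_mono) auto
      also have "\<dots> = (4 * R)\<^sup>2 * b ^ 6 * (\<kappa> ^ length w * N\<^sup>2)"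
        by (simp add: power_mult_distrib power2_eq_square eval_nat_numeral mult_ac)
      finally show ?thesis by (simp add: D_def mult_ac)
    qed
    ultimately show ?thesis by (simp add: N_def)
  qed
  then show ?thesis using D1 kR by blast
qed

text \<open>
  The constants of \<open>word_estimates\<close>, fixed for the rest of the development; \<open>contraction\<close> is
  chosen for the value of \<open>distortion\<close>, so that both serve the same estimates.
\<close>

definition distortion :: real where
  "distortion = (SOME D. D \<ge> 1 \<and> (\<exists>\<kappa>. 0 < \<kappa> \<and> \<kappa> < 1 \<and> (\<forall>w u. set w \<subseteq> {1..k} \<longrightarrow> u \<in> M \<longrightarrow>
     (\<forall>z. norm (word_prod A w *v z) * norm u \<le> D * norm (word_prod A w *v u) * norm z) \<and>
     \<bar>det (word_prod A w)\<bar> * (norm u)\<^sup>2 \<le> D * \<kappa> ^ length w * (norm (word_prod A w *v u))\<^sup>2)))"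

definition contraction :: real where
  "contraction = (SOME \<kappa>. 0 < \<kappa> \<and> \<kappa> < 1 \<and> (\<forall>w u. set w \<subseteq> {1..k} \<longrightarrow> u \<in> M \<longrightarrow>
     (\<forall>z. norm (word_prod A w *v z) * norm u \<le> distortion * norm (word_prod A w *v u) * norm z) \<and>
     \<bar>det (word_prod A w)\<bar> * (norm u)\<^sup>2
       \<le> distortion * \<kappa> ^ length w * (norm (word_prod A w *v u))\<^sup>2))"

lemma distortion_contraction:
  shows distortion_ge_1: "1 \<le> distortion"
    and contraction_pos: "0 < contraction" and contraction_less_1: "contraction < 1"
    and norm_word_prod_le: "\<And>w u z. set w \<subseteq> {1..k} \<Longrightarrow> u \<in> M \<Longrightarrow>
      norm (word_prod A w *v z) * norm u \<le> distortion * norm (word_prod A w *v u) * norm z"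
    and det_word_prod_le: "\<And>w u. set w \<subseteq> {1..k} \<Longrightarrow> u \<in> M \<Longrightarrow>
      \<bar>det (word_prod A w)\<bar> * (norm u)\<^sup>2
        \<le> distortion * contraction ^ length w * (norm (word_prod A w *v u))\<^sup>2"
proof -
  note D = someI_ex[OF word_estimates, folded distortion_def]
  show "1 \<le> distortion" using D by blast
  note \<kappa> = someI_ex[OF conjunct2[OF D], folded contraction_def]
  show "0 < contraction" "contraction < 1" using \<kappa> by blast+
  show "norm (word_prod A w *v z) * norm u \<le> distortion * norm (word_prod A w *v u) * norm z"
    if "set w \<subseteq> {1..k}" "u \<in> M" for w u z
    using \<kappa> that by blast
  show "\<bar>det (word_prod A w)\<bar> * (norm u)\<^sup>2
        \<le> distortion * contraction ^ length w * (norm (word_prod A w *v u))\<^sup>2"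
    if "set w \<subseteq> {1..k}" "u \<in> M" for w u
    using \<kappa> that by blast
qed

lemma M_nonzero: "u \<in> M \<Longrightarrow> u \<noteq> 0"
  using zero_notin_M by auto

lemma norm_word_prod_pos: "set w \<subseteq> {1..k} \<Longrightarrow> u \<in> M \<Longrightarrow> 0 < norm (word_prod A w *v u)"
  using word_prod_M M_nonzero by simp

lemma norm_word_prod_le_unit:
  assumes "set w \<subseteq> {1..k}" "u \<in> M" "norm u = 1"
  shows "norm (word_prod A w *v z) \<le> distortion * norm (word_prod A w *v u) * norm z"
  using norm_word_prod_le[OF assms(1,2), of z] assms(3) by simp

text \<open>
  Bounded distortion: the Lipschitz constant does not depend on the word, so it survives the
  supremum over all words in the definition of the extremal function.
\<close>

lemma ln_norm_word_prod_lipschitz: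
  assumes w: "set w \<subseteq> {1..k}" and u: "u \<in> M" "norm u = 1" and v: "v \<in> M" "norm v = 1"
  shows "ln (norm (word_prod A w *v u)) \<le> ln (norm (word_prod A w *v v)) + distortion * line_dist u v"
proof -
  let ?W = "word_prod A w"
  have le: "norm (?W *v u) \<le> norm (?W *v v) * (1 + distortion * t)"
    if "t = norm (u - v) \<or> t = norm (u + v)" for t
  proof -
    have "norm (?W *v u) \<le> norm (?W *v v) + norm (?W *v (u - v))"
      using norm_triangle_ineq[of "?W *v v" "?W *v (u - v)"] by (simp add: matrix_vector_mult_diff_distrib)
    moreover have "norm (?W *v u) \<le> norm (?W *v v) + norm (?W *v (u + v))"
      using norm_triangle_ineq4[of "?W *v (u + v)" "?W *v v"] by (simp add: matrix_vector_right_distrib)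
    moreover note norm_word_prod_le_unit[OF w v, of "u - v"] norm_word_prod_le_unit[OF w v, of "u + v"]
    ultimately show ?thesis using that by (auto simp: algebra_simps)
  qed
  define t where "t = line_dist u v"
  have t: "t = norm (u - v) \<or> t = norm (u + v)" "0 \<le> t" by (auto simp: t_def line_dist_def min_def)
  have dt: "0 \<le> distortion * t" using t distortion_ge_1 by simp
  have "ln (norm (?W *v u)) \<le> ln (norm (?W *v v) * (1 + distortion * t))"
    using le[OF t(1)] norm_word_prod_pos[OF w u(1)] order_less_le_trans by (subst ln_le_cancel_iff) blast+
  also have "\<dots> = ln (norm (?W *v v)) + ln (1 + distortion * t)"
    using norm_word_prod_pos[OF w v(1)] dt by (intro ln_mult_pos) auto
  also have "\<dots> \<le> ln (norm (?W *v v)) + distortion * t"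
    using ln_add_one_self_le_self[OF dt] by simp
  finally show ?thesis by (simp add: t_def)
qed

text \<open>
  The two vectors may belong to different cones of the multicone: the determinant estimate is used
  for each of them separately, and the geometric mean of the two bounds is taken. This makes limit
  directions unique although the multicone is not connected.
\<close>

lemma cross2_word_prod_le:
  assumes w: "set w \<subseteq> {1..k}" and u: "u \<in> M" and v: "v \<in> M"
  shows "\<bar>cross2 (word_prod A w *v u) (word_prod A w *v v)\<bar>
    \<le> distortion * contraction ^ length w * (norm (word_prod A w *v u) * norm (word_prod A w *v v))"
    (is "_ \<le> ?c * (?a * ?b)")
proof -
  let ?d = "\<bar>det (word_prod A w)\<bar>"
  have c0: "0 \<le> ?c" using distortion_ge_1 contraction_pos by simp
  have "(?d * (norm u)\<^sup>2) * (?d * (norm v)\<^sup>2) \<le> (?c * ?a\<^sup>2) * (?c * ?b\<^sup>2)"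
    by (intro mult_mono det_word_prod_le[OF w u] det_word_prod_le[OF w v]) (use c0 in auto)
  also have "\<dots> = (?c * (?a * ?b))\<^sup>2" by (simp add: power2_eq_square mult_ac)
  also have "(?d * (norm u)\<^sup>2) * (?d * (norm v)\<^sup>2) = (?d * (norm u * norm v))\<^sup>2"
    by (simp add: power2_eq_square mult_ac)
  finally have "?d * (norm u * norm v) \<le> ?c * (?a * ?b)"
    by (rule power2_le_imp_le) (intro mult_nonneg_nonneg[OF c0] mult_nonneg_nonneg norm_ge_zero)
  moreover have "?d * \<bar>cross2 u v\<bar> \<le> ?d * (norm u * norm v)"
    by (intro mult_left_mono cross2_le_norm) auto
  ultimately show ?thesis by (simp add: cross2_matrix abs_mult)
qed

end

section \<open>Limit directions and cells\<close>

lemma plane_cone_image: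
  assumes "invertible L" "plane_cone C"
  shows "plane_cone ((*v) L ` C)"
proof -
  have "(*v) L ` C = (*v) (L ** frame C) ` standard_cone"
    by (subst frame(2)[OF assms(2), symmetric]) (simp add: image_image matrix_vector_mul_assoc)
  moreover have "invertible (L ** frame C)"
    using assms frame(1) invertible_mult by blast
  ultimately show ?thesis unfolding plane_cone_def by blast
qed

text \<open>
  The affine chart of the projective line in which the direction of \<open>p\<close> is the point at infinity.
  A cone that does not contain \<open>p\<close> is an interval there.
\<close>

definition slope :: "real^2 \<Rightarrow> real^2 \<Rightarrow> real" where
  "slope p v = (p \<bullet> v) / cross2 p v"

lemma inner_2: "(p::real^2) \<bullet> v = p $ 1 * v $ 1 + p $ 2 * v $ 2"
  by (simp add: inner_vec_def sum_2)

lemma slope_diff: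
  assumes "cross2 p u \<noteq> 0" "cross2 p v \<noteq> 0"
  shows "slope p u - slope p v = ((norm p)\<^sup>2 * cross2 u v) / (cross2 p u * cross2 p v)"
proof -
  have "(p \<bullet> u) * cross2 p v - (p \<bullet> v) * cross2 p u = (norm p)\<^sup>2 * cross2 u v"
    unfolding norm_sq_2 inner_2 cross2_def by (simp add: power2_eq_square algebra_simps)
  then show ?thesis using assms by (simp add: slope_def divide_simps)
qed

lemma cross2_nonzero_outside_cone:
  assumes C: "plane_cone C" "p \<noteq> 0" "p \<notin> C" and t: "t \<in> C"
  shows "cross2 p t \<noteq> 0"
proof
  assume "cross2 p t = 0"
  moreover have "t \<noteq> 0" using t C zero_notin_plane_cone by blast
  ultimately obtain c where "p = c *\<^sub>R t" by (rule cross2_eq_0_imp_parallel)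
  then show False using C t plane_cone_scaleR by (cases "c = 0") auto
qed

lemma slope_neq_in_disjoint_cones:
  assumes C: "plane_cone C" "p \<notin> C" and D: "plane_cone D" "p \<notin> D" and p: "p \<noteq> 0" and disj: "C \<inter> D = {}"
    and a: "a \<in> C" and b: "b \<in> D"
  shows "slope p a \<noteq> slope p b"
proof
  note nz = cross2_nonzero_outside_cone[OF C(1) p C(2) a] cross2_nonzero_outside_cone[OF D(1) p D(2) b]
  assume "slope p a = slope p b"
  then have "cross2 a b = 0" using slope_diff[OF nz] nz p by simp
  moreover have "b \<noteq> 0" using D(1) b zero_notin_plane_cone by blast
  ultimately obtain c where "a = c *\<^sub>R b" by (rule cross2_eq_0_imp_parallel)
  then show False
    using a b disj plane_cone_scaleR[OF D(1), of c b] zero_notin_plane_cone[OF C(1)]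
    by (cases "c = 0") auto
qed

lemma slope_between_in_cone:
  assumes C: "plane_cone C" "p \<noteq> 0" "p \<notin> C"
    and u: "u \<in> C" and v: "v \<in> C" and z: "cross2 p z \<noteq> 0"
    and between: "slope p u < slope p z" "slope p z < slope p v"
  shows "z \<in> C"
proof -
  note nz = cross2_nonzero_outside_cone[OF C]
  \<comment> \<open>normalised to height 1 above the line of \<open>p\<close>, vectors are determined by their slope\<close>
  define N where "N = (\<lambda>t. inverse (cross2 p t) *\<^sub>R t)"
  have cN: "cross2 p (N t) = 1" if "cross2 p t \<noteq> 0" for t using that by (simp add: N_def)
  have sN: "p \<bullet> N t = slope p t" for t by (simp add: N_def slope_def field_simps)
  have NC: "N t \<in> C" if "t \<in> C" for t
    using plane_cone_scaleR[OF C(1)] nz[OF that] that by (simp add: N_def)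
  define \<mu> where "\<mu> = (slope p z - slope p u) / (slope p v - slope p u)"
  have "\<mu> * (slope p v - slope p u) = slope p z - slope p u" using between by (simp add: \<mu>_def)
  then have \<mu>3: "slope p z = (1 - \<mu>) * slope p u + \<mu> * slope p v" by (simp add: algebra_simps)
  have \<mu>: "0 < \<mu>" "\<mu> < 1" using between by (simp_all add: \<mu>_def)
  define y where "y = (1 - \<mu>) *\<^sub>R N u + \<mu> *\<^sub>R N v"
  have "cross2 p y = 1" by (simp add: y_def cross2_add_right cN nz u v)
  moreover have "p \<bullet> y = slope p z"
    by (simp add: y_def inner_add_right sN \<mu>3)
  ultimately have "cross2 p (N z - y) = 0" "p \<bullet> (N z - y) = 0"
    using cN[OF z] sN[of z] by (simp_all add: cross2_def inner_2 algebra_simps)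
  moreover have "(norm p)\<^sup>2 * (norm t)\<^sup>2 = (cross2 p t)\<^sup>2 + (p \<bullet> t)\<^sup>2" for t
    unfolding norm_sq_2 cross2_def inner_2 by algebra
  ultimately have "(norm p)\<^sup>2 * (norm (N z - y))\<^sup>2 = 0" by simp
  then have zy: "N z = y" using C(2) by simp
  obtain a where a: "a \<in> standard_cone" "N u = frame C *v a"
    by (rule plane_cone_coordinates[OF C(1) NC[OF u]])
  obtain b where b: "b \<in> standard_cone" "N v = frame C *v b"
    by (rule plane_cone_coordinates[OF C(1) NC[OF v]])
  have conv: "(1 - \<mu>) *\<^sub>R a' + \<mu> *\<^sub>R b' \<in> nonneg_quadrant"
    if "a' \<in> nonneg_quadrant" "b' \<in> nonneg_quadrant" for a' b'
    using convexD[OF convex_nonneg_quadrant that] \<mu> by simp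
  have opposite: "False" if q: "a' \<in> nonneg_quadrant" "b' \<in> nonneg_quadrant"
    "frame C *v a' = c *\<^sub>R N u" "frame C *v b' = - c *\<^sub>R N v" "c \<noteq> 0" for a' b' c
  proof -
    have "(1/2) *\<^sub>R a' + (1/2) *\<^sub>R b' \<in> nonneg_quadrant"
      using convexD[OF convex_nonneg_quadrant q(1,2), of "1/2" "1/2"] by simp
    then have "frame C *v ((1/2) *\<^sub>R a' + (1/2) *\<^sub>R b') \<in> C"
      using frame_in_plane_cone[OF C(1)] standard_cone_eq by blast
    moreover have "frame C *v ((1/2) *\<^sub>R a' + (1/2) *\<^sub>R b') = (c / 2) *\<^sub>R (N u - N v)"
      using q(3,4) by (simp add: matrix_vector_right_distrib matrix_scaled_vector algebra_simps)
    ultimately have "(c / 2) *\<^sub>R (N u - N v) \<in> C" by simp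
    moreover have "cross2 p (N u - N v) = 0" using cN[OF nz[OF u]] cN[OF nz[OF v]]
      by (simp add: cross2_def algebra_simps)
    ultimately show False using nz[of "(c / 2) *\<^sub>R (N u - N v)"] by simp
  qed
  have zfr: "N z = frame C *v ((1 - \<mu>) *\<^sub>R a + \<mu> *\<^sub>R b)"
    by (simp add: zy y_def a b matrix_vector_right_distrib matrix_scaled_vector)
  consider "a \<in> nonneg_quadrant" "b \<in> nonneg_quadrant" | "- a \<in> nonneg_quadrant" "- b \<in> nonneg_quadrant"
    | "a \<in> nonneg_quadrant" "- b \<in> nonneg_quadrant" | "- a \<in> nonneg_quadrant" "b \<in> nonneg_quadrant"
    using a b standard_cone_eq by blast
  then have "N z \<in> C"
  proof cases
    case 1
    then show ?thesis using zfr frame_in_plane_cone[OF C(1)] standard_cone_eq conv by simp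
  next
    case 2
    then have "- ((1 - \<mu>) *\<^sub>R a + \<mu> *\<^sub>R b) \<in> nonneg_quadrant" using conv[OF 2] by (simp add: algebra_simps)
    then show ?thesis using zfr frame_in_plane_cone[OF C(1)] standard_cone_eq by simp
  next
    case 3
    then show ?thesis using opposite[OF 3, of 1] a b matrix_scaled_vector[of "frame C" "-1" b] by simp
  next
    case 4
    then show ?thesis using opposite[OF 4, of "-1"] a b matrix_scaled_vector[of "frame C" "-1" a] by simp
  qed
  then show ?thesis using plane_cone_scaleR[OF C(1)] z by (simp add: N_def)
qed

text \<open>
  The slopes of the vectors of a cone form an interval, and of two disjoint intervals one lies
  entirely to the left of the other.
\<close>

lemma disjoint_cones_ordered:
  assumes C: "plane_cone C" "p \<notin> C" and D: "plane_cone D" "p \<notin> D" and p: "p \<noteq> 0" and disj: "C \<inter> D = {}"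
    and u: "u \<in> C" "u' \<in> C" and v: "v \<in> D" "v' \<in> D" and less: "slope p u < slope p v"
  shows "slope p u' < slope p v'"
proof (rule ccontr)
  note nz_C = cross2_nonzero_outside_cone[OF C(1) p C(2)]
  note nz_D = cross2_nonzero_outside_cone[OF D(1) p D(2)]
  note neq = slope_neq_in_disjoint_cones[OF C D p disj]
  assume "\<not> slope p u' < slope p v'"
  then have g: "slope p v' < slope p u'" using neq[OF u(2) v(2)] by simp
  have in_C: "b \<notin> D" if "slope p u < slope p b" "slope p b < slope p u'" for b
    using slope_between_in_cone[OF C(1) p C(2) u(1) u(2) nz_D that] disj by blast
  have in_C': "b \<notin> D" if "slope p u' < slope p b" "slope p b < slope p u" for b
    using slope_between_in_cone[OF C(1) p C(2) u(2) u(1) nz_D that] disj by blast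
  have in_D: "a \<notin> C" if "slope p v' < slope p a" "slope p a < slope p v" for a
    using slope_between_in_cone[OF D(1) p D(2) v(2) v(1) nz_C that] disj by blast
  have "slope p v < slope p u'" if "\<not> slope p u' < slope p v" using that neq[OF u(2) v(1)] by simp
  \<comment> \<open>the four points in increasing order always put a point of one cone between two of the other\<close>
  then show False
    using g less in_C[of v] in_C[of v'] in_D[of u] in_D[of u'] neq[OF u(1) v(2)] u v
    by (meson linorder_neqE_linordered_idom less_trans)
qed

context cone_system
begin

definition is_limit_direction :: "(nat \<Rightarrow> nat) \<Rightarrow> real^2 \<Rightarrow> bool" where
  "is_limit_direction x v \<longleftrightarrow>
     norm v = 1 \<and> (\<forall>n. v \<in> (*v) (word_prod A (map x [0..<n])) ` M)"

lemma set_prefix: "range x \<subseteq> {1..k} \<Longrightarrow> set (map x [0..<n]) \<subseteq> {1..k}"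
  by auto

lemma limit_directions_close:
  assumes x: "range x \<subseteq> {1..k}" and agree: "\<And>i. i < n \<Longrightarrow> x i = y i"
    and v: "is_limit_direction x v" and u: "is_limit_direction y u"
  shows "\<bar>cross2 u v\<bar> \<le> distortion * contraction ^ n"
proof -
  have eq: "map y [0..<n] = map x [0..<n]" using agree by auto
  have "u \<in> (*v) (word_prod A (map y [0..<n])) ` M" "v \<in> (*v) (word_prod A (map x [0..<n])) ` M"
    using u v by (simp_all add: is_limit_direction_def)
  then obtain u' v' where uv: "u' \<in> M" "v' \<in> M" "u = word_prod A (map x [0..<n]) *v u'"
    "v = word_prod A (map x [0..<n]) *v v'"
    unfolding eq by (elim imageE)
  show ?thesis
    using cross2_word_prod_le[OF set_prefix[OF x, of n] uv(1,2)] u v uv(3,4)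
    by (simp add: is_limit_direction_def)
qed

text \<open>On the unit circle the images of the multicone form a decreasing sequence of compact sets.\<close>

lemma limit_direction_exists:
  assumes x: "range x \<subseteq> {1..k}"
  shows "\<exists>v. is_limit_direction x v"
proof -
  define W where "W = (\<lambda>n. word_prod A (map x [0..<n]))"
  have inv: "invertible (W n)" for n
    using invertible_word_prod[OF set_prefix[OF x]] by (simp add: W_def)
  define F where "F = (\<lambda>n. sphere 0 1 \<inter> (*v) (W n) ` insert 0 M)"
  have "compact (F n)" for n
    unfolding F_def by (intro compact_Int_closed compact_sphere closed_invertible_image inv closed_insert_M)
  moreover have "F n \<noteq> {}" for n
  proof -
    obtain u where u: "u \<in> M"
      using cones_nonempty plane_cones frame_in_plane_cone[of _ "vector [1, 0]"]
      by (auto simp: standard_cone_def vec_eq_iff forall_2)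
    define c where "c = inverse (norm (W n *v u))"
    have "W n *v u \<noteq> 0" using M_nonzero[OF u] invertible_vector_eq_0[OF inv] by simp
    then have c: "c \<noteq> 0" "norm (c *\<^sub>R (W n *v u)) = 1" by (auto simp: c_def)
    have "c *\<^sub>R (W n *v u) = W n *v (c *\<^sub>R u)" by (simp add: matrix_scaled_vector)
    moreover have "c *\<^sub>R u \<in> M" using M_scaleR[OF c(1)] u by simp
    ultimately have "c *\<^sub>R (W n *v u) \<in> F n" using c(2) unfolding F_def by auto
    then show ?thesis by blast
  qed
  moreover have "F n \<subseteq> F m" if mn: "m \<le> n" for m n
  proof
    fix v assume "v \<in> F n"
    then obtain u where u: "u \<in> insert 0 M" "v = W n *v u" "norm v = 1" by (auto simp: F_def)
    have split: "[0..<n] = [0..<m] @ [m..<n]" using mn upt_add_eq_append[of 0 m "n - m"] by simp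
    have "W n = W m ** word_prod A (map x [m..<n])"
      by (simp add: W_def split word_prod_append)
    then have "v = W m *v (word_prod A (map x [m..<n]) *v u)"
      using u by (simp add: matrix_vector_mul_assoc)
    moreover have "word_prod A (map x [m..<n]) *v u \<in> insert 0 M"
      using u(1) word_prod_M[of "map x [m..<n]" u] x by auto
    ultimately show "v \<in> F m" using u(3) unfolding F_def by auto
  qed
  ultimately have "\<Inter>(range F) \<noteq> {}" by (rule compact_nest)
  then obtain v where v: "\<And>n. v \<in> F n" by auto
  have "v \<in> (*v) (W n) ` M" for n
  proof -
    have "v \<noteq> 0" using v[of 0] by (auto simp: F_def)
    then show ?thesis using v[of n] by (auto simp: F_def)
  qed
  then have "is_limit_direction x v" using v[of 0] by (simp add: is_limit_direction_def W_def F_def)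
  then show ?thesis by blast
qed

definition limit_direction :: "(nat \<Rightarrow> nat) \<Rightarrow> real^2" where
  "limit_direction x = (SOME v. is_limit_direction x v)"

lemma is_limit_direction_limit_direction:
  "range x \<subseteq> {1..k} \<Longrightarrow> is_limit_direction x (limit_direction x)"
  unfolding limit_direction_def by (rule someI_ex) (rule limit_direction_exists)

lemma norm_limit_direction: "range x \<subseteq> {1..k} \<Longrightarrow> norm (limit_direction x) = 1"
  using is_limit_direction_limit_direction by (simp add: is_limit_direction_def)

lemma limit_direction_in_image:
  "range x \<subseteq> {1..k} \<Longrightarrow> limit_direction x \<in> (*v) (word_prod A (map x [0..<n])) ` M"
  using is_limit_direction_limit_direction by (simp add: is_limit_direction_def)

lemma limit_direction_M: "range x \<subseteq> {1..k} \<Longrightarrow> limit_direction x \<in> M"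
  using limit_direction_in_image[of x 0] by simp

lemma limit_direction_line_dist:
  assumes "range x \<subseteq> {1..k}" "range y \<subseteq> {1..k}" "\<And>i. i < n \<Longrightarrow> x i = y i"
  shows "line_dist (limit_direction x) (limit_direction y) \<le> 2 * distortion * contraction ^ n"
  using limit_directions_close[where n = n, OF assms(1,3) is_limit_direction_limit_direction[OF assms(1)]
      is_limit_direction_limit_direction[OF assms(2)]]
    line_dist_le_cross2[of "limit_direction x" "limit_direction y"]
    norm_limit_direction[OF assms(1)] norm_limit_direction[OF assms(2)]
    abs_cross2_commute[of "limit_direction x" "limit_direction y"] by simp

text \<open>
  Both sides are limit directions of the sequence \<open>i, x 0, x 1, \<dots>\<close>, and the contraction makes limit
  directions unique up to sign.
\<close>

lemma limit_direction_Cons: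
  assumes i: "i \<in> {1..k}" and x: "range x \<subseteq> {1..k}"
  obtains c where "A i *v limit_direction x = c *\<^sub>R limit_direction (case_nat i x)" "c \<noteq> 0"
proof -
  define y where "y = case_nat i x"
  have "x m \<in> {1..k}" for m using x by blast
  then have "y m \<in> {1..k}" for m using i by (cases m) (simp_all add: y_def)
  then have y: "range y \<subseteq> {1..k}" by blast
  define u where "u = A i *v limit_direction x"
  have u0: "u \<noteq> 0" using letter_M[OF i limit_direction_M[OF x]] M_nonzero by (simp add: u_def)
  define v where "v = inverse (norm u) *\<^sub>R u"
  have "v \<in> (*v) (word_prod A (map y [0..<n])) ` M" for n
  proof (cases n)
    case 0
    have "v \<in> M"
      using M_scaleR letter_M[OF i limit_direction_M[OF x]] u0 by (simp add: v_def u_def)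
    then show ?thesis using 0 by simp
  next
    case (Suc m)
    have "map y [0..<n] = i # map x [0..<m]"
      unfolding Suc upt_conv_Cons[OF zero_less_Suc] map_Suc_upt[symmetric]
      by (simp add: y_def o_def del: upt_Suc)
    moreover obtain z where z: "z \<in> M" "limit_direction x = word_prod A (map x [0..<m]) *v z"
      using limit_direction_in_image[OF x, of m] by auto
    ultimately have "v = word_prod A (map y [0..<n]) *v (inverse (norm u) *\<^sub>R z)"
      by (simp add: v_def u_def matrix_scaled_vector matrix_vector_mul_assoc)
    moreover have "inverse (norm u) *\<^sub>R z \<in> M" using M_scaleR z(1) u0 by simp
    ultimately show ?thesis by blast
  qed
  then have "is_limit_direction y v" using u0 by (simp add: is_limit_direction_def v_def)
  then have bound: "\<bar>cross2 v (limit_direction y)\<bar> \<le> distortion * contraction ^ n" for n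
    using limit_directions_close[OF y _ is_limit_direction_limit_direction[OF y], of n y v] by simp
  have "(\<lambda>n. distortion * contraction ^ n) \<longlonglongrightarrow> distortion * 0"
    using contraction_pos contraction_less_1 by (intro tendsto_mult tendsto_const LIMSEQ_realpow_zero) auto
  then have "\<bar>cross2 v (limit_direction y)\<bar> \<le> distortion * 0"
    by (rule LIMSEQ_le_const) (use bound in blast)
  then have "cross2 v (limit_direction y) = 0" by simp
  moreover have "limit_direction y \<noteq> 0" using norm_limit_direction[OF y] by auto
  ultimately obtain c where c: "v = c *\<^sub>R limit_direction y" by (rule cross2_eq_0_imp_parallel)
  have "u = norm u *\<^sub>R v" using u0 by (simp add: v_def)
  then have "u = (norm u * c) *\<^sub>R limit_direction y" using c by simp
  moreover have "norm u * c \<noteq> 0" using c u0 by (auto simp: v_def)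
  ultimately show thesis using that unfolding u_def y_def by blast
qed

text \<open>
  The non-overlapping condition recovers the letters of the word one after the other, starting with
  the letter applied last; the disjointness of the cones then recovers the cone.
\<close>

lemma cell_unique:
  assumes "length w = length w'" "set w \<subseteq> {1..k}" "set w' \<subseteq> {1..k}" "C \<in> Cs" "C' \<in> Cs"
    and "v \<in> (*v) (word_prod A w) ` C" "v \<in> (*v) (word_prod A w') ` C'"
  shows "w = w' \<and> C = C'"
  using assms
proof (induction w w' arbitrary: v rule: list_induct2)
  case Nil
  then show ?case using cone_disjoint_from_others[of C] by auto
next
  case (Cons i w j w')
  obtain c where c: "c \<in> C" "v = A i *v (word_prod A w *v c)"
    using Cons.prems(5) by (auto simp: matrix_vector_mul_assoc)
  obtain c' where c': "c' \<in> C'" "v = A j *v (word_prod A w' *v c')"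
    using Cons.prems(6) by (auto simp: matrix_vector_mul_assoc)
  have ij: "i \<in> {1..k}" "j \<in> {1..k}" "set w \<subseteq> {1..k}" "set w' \<subseteq> {1..k}" using Cons.prems by auto
  have m: "word_prod A w *v c \<in> M" "word_prod A w' *v c' \<in> M"
    using word_prod_M[OF ij(3)] word_prod_M[OF ij(4)] c c' Cons.prems by blast+
  have "i = j"
  proof (rule ccontr)
    assume "i \<noteq> j"
    then have "(*v) (A i) ` M \<inter> (*v) (A j) ` M = {}" by (rule disjoint_images[OF ij(1,2)])
    moreover have "v \<in> (*v) (A i) ` M" "v \<in> (*v) (A j) ` M" using m c(2) c'(2) by blast+
    ultimately show False by blast
  qed
  then have "word_prod A w *v c = word_prod A w' *v c'"
    using c(2) c'(2) matrix_inv_vector_cancel(1)[OF invertible_letter[OF ij(1)]] by metis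
  then have "word_prod A w *v c \<in> (*v) (word_prod A w) ` C"
            "word_prod A w *v c \<in> (*v) (word_prod A w') ` C'" using c(1) c'(1) by (metis imageI)+
  then show ?case using Cons.IH[OF ij(3,4) Cons.prems(3,4)] \<open>i = j\<close> by blast
qed

lemma plane_cone_cell:
  "set w \<subseteq> {1..k} \<Longrightarrow> C \<in> Cs \<Longrightarrow> plane_cone ((*v) (word_prod A w) ` C)"
  using plane_cone_image[OF invertible_word_prod plane_cones] .

lemma cell_subset_M: "set w \<subseteq> {1..k} \<Longrightarrow> C \<in> Cs \<Longrightarrow> (*v) (word_prod A w) ` C \<subseteq> M"
  using word_prod_M by blast

end

section \<open>Extremal functions and cross ratios\<close>

lemma line_dist_commute: "line_dist u v = line_dist v u"
  by (simp add: line_dist_def norm_minus_commute add.commute)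

context cone_system
begin

text \<open>
  The sign \<open>s\<close> is 1 for maximising and -1 for minimising orbits; \<open>\<beta>\<close> will be the optimal average
  of \<open>s\<close> times the growth exponent.
\<close>

definition growth_bounded :: "real \<Rightarrow> real \<Rightarrow> bool" where
  "growth_bounded s \<beta> \<longleftrightarrow> (\<exists>c. \<forall>w u. set w \<subseteq> {1..k} \<longrightarrow> u \<in> M \<longrightarrow> norm u = 1 \<longrightarrow>
     s * ln (norm (word_prod A w *v u)) - \<beta> * real (length w) \<le> c)"

text \<open>
  For \<open>s = 1\<close> this is the logarithm of an extremal norm, restricted to the multicone, for the
  matrices divided by \<open>exp \<beta>\<close>.
\<close>

definition barabanov :: "real \<Rightarrow> real \<Rightarrow> real^2 \<Rightarrow> real" where
  "barabanov s \<beta> v =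
     (SUP w\<in>{w. set w \<subseteq> {1..k}}. s * ln (norm (word_prod A w *v v)) - \<beta> * real (length w))"

lemma normalize_M:
  assumes "v \<in> M"
  shows "inverse (norm v) *\<^sub>R v \<in> M" "norm (inverse (norm v) *\<^sub>R v) = 1"
  using assms M_scaleR[of "inverse (norm v)" v] M_nonzero[OF assms] by simp_all

lemma ln_norm_word_prod_scaleR:
  assumes "set w \<subseteq> {1..k}" "v \<in> M" "c \<noteq> 0"
  shows "ln (norm (word_prod A w *v (c *\<^sub>R v))) = ln \<bar>c\<bar> + ln (norm (word_prod A w *v v))"
  using assms norm_word_prod_pos[OF assms(1,2)] by (simp add: matrix_scaled_vector ln_mult_pos)

lemma barabanov_bdd:
  assumes "growth_bounded s \<beta>" "v \<in> M"
  shows "bdd_above ((\<lambda>w. s * ln (norm (word_prod A w *v v)) - \<beta> * real (length w)) ` {w. set w \<subseteq> {1..k}})"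
proof -
  obtain c where c: "\<And>w u. set w \<subseteq> {1..k} \<Longrightarrow> u \<in> M \<Longrightarrow> norm u = 1 \<Longrightarrow>
     s * ln (norm (word_prod A w *v u)) - \<beta> * real (length w) \<le> c"
    using assms(1) unfolding growth_bounded_def by blast
  have "s * ln (norm (word_prod A w *v v)) - \<beta> * real (length w) \<le> c + s * ln (norm v)"
    if w: "set w \<subseteq> {1..k}" for w
  proof -
    have "ln (norm (word_prod A w *v v))
        = ln (norm (word_prod A w *v (inverse (norm v) *\<^sub>R v))) + ln (norm v)"
      using ln_norm_word_prod_scaleR[OF w assms(2), of "inverse (norm v)"] M_nonzero[OF assms(2)]
      by (simp only: ln_inverse abs_inverse abs_norm_cancel) (simp add: ln_inverse)
    then show ?thesis
      using c[OF w normalize_M[OF assms(2)]] by (simp only: distrib_left)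
  qed
  then show ?thesis by (intro bdd_aboveI[where M = "c + s * ln (norm v)"]) auto
qed

lemma barabanov_upper:
  assumes "growth_bounded s \<beta>" "v \<in> M" "set w \<subseteq> {1..k}"
  shows "s * ln (norm (word_prod A w *v v)) - \<beta> * real (length w) \<le> barabanov s \<beta> v"
  unfolding barabanov_def by (rule cSUP_upper[OF _ barabanov_bdd]) (use assms in auto)

lemma barabanov_least:
  assumes "\<And>w. set w \<subseteq> {1..k} \<Longrightarrow> s * ln (norm (word_prod A w *v v)) - \<beta> * real (length w) \<le> c"
  shows "barabanov s \<beta> v \<le> c"
  unfolding barabanov_def
proof (rule cSUP_least)
  show "{w. set w \<subseteq> {1..k}} \<noteq> {}" using empty_subsetI[of "{1..k}"] by (metis empty_iff empty_set mem_Collect_eq)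
qed (use assms in auto)

lemma barabanov_scaleR:
  assumes g: "growth_bounded s \<beta>" and v: "v \<in> M" and c: "c \<noteq> 0"
  shows "barabanov s \<beta> (c *\<^sub>R v) = barabanov s \<beta> v + s * ln \<bar>c\<bar>"
proof (rule antisym)
  show "barabanov s \<beta> (c *\<^sub>R v) \<le> barabanov s \<beta> v + s * ln \<bar>c\<bar>"
  proof (rule barabanov_least)
    fix w :: "nat list" assume w: "set w \<subseteq> {1..k}"
    show "s * ln (norm (word_prod A w *v (c *\<^sub>R v))) - \<beta> * real (length w) \<le> barabanov s \<beta> v + s * ln \<bar>c\<bar>"
      using barabanov_upper[OF g v w] by (simp add: ln_norm_word_prod_scaleR[OF w v c] distrib_left)
  qed
  have cv: "c *\<^sub>R v \<in> M" using M_scaleR[OF c] v by simp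
  have "barabanov s \<beta> v \<le> barabanov s \<beta> (c *\<^sub>R v) - s * ln \<bar>c\<bar>"
  proof (rule barabanov_least)
    fix w :: "nat list" assume w: "set w \<subseteq> {1..k}"
    show "s * ln (norm (word_prod A w *v v)) - \<beta> * real (length w) \<le> barabanov s \<beta> (c *\<^sub>R v) - s * ln \<bar>c\<bar>"
      using barabanov_upper[OF g cv w] by (simp add: ln_norm_word_prod_scaleR[OF w v c] distrib_left)
  qed
  then show "barabanov s \<beta> v + s * ln \<bar>c\<bar> \<le> barabanov s \<beta> (c *\<^sub>R v)" by simp
qed

lemma barabanov_word:
  assumes g: "growth_bounded s \<beta>" and v: "v \<in> M" and w: "set w \<subseteq> {1..k}"
  shows "barabanov s \<beta> (word_prod A w *v v) \<le> barabanov s \<beta> v + \<beta> * real (length w)"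
proof (rule barabanov_least)
  fix w' :: "nat list" assume "set w' \<subseteq> {1..k}"
  then have "s * ln (norm (word_prod A (w' @ w) *v v)) - \<beta> * real (length (w' @ w)) \<le> barabanov s \<beta> v"
    using w by (intro barabanov_upper[OF g v]) auto
  then show "s * ln (norm (word_prod A w' *v (word_prod A w *v v))) - \<beta> * real (length w')
    \<le> barabanov s \<beta> v + \<beta> * real (length w)"
    by (simp add: word_prod_append matrix_vector_mul_assoc algebra_simps)
qed

lemma barabanov_lipschitz:
  assumes g: "growth_bounded s \<beta>" and s: "s \<in> {1, -1}"
    and u: "u \<in> M" "norm u = 1" and v: "v \<in> M" "norm v = 1"
  shows "barabanov s \<beta> u \<le> barabanov s \<beta> v + distortion * line_dist u v"
proof (rule barabanov_least)
  fix w :: "nat list" assume w: "set w \<subseteq> {1..k}"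
  have "s * ln (norm (word_prod A w *v u)) \<le> s * ln (norm (word_prod A w *v v)) + distortion * line_dist u v"
    using s ln_norm_word_prod_lipschitz[OF w u v] ln_norm_word_prod_lipschitz[OF w v u]
    by (auto simp: line_dist_commute)
  then show "s * ln (norm (word_prod A w *v u)) - \<beta> * real (length w)
    \<le> barabanov s \<beta> v + distortion * line_dist u v"
    using barabanov_upper[OF g v(1) w] by linarith
qed

text \<open>
  Up to the logarithm of the norm the extremal function depends on the direction only, and long
  products bring all directions of the multicone together.
\<close>

lemma barabanov_projective_contraction:
  assumes g: "growth_bounded s \<beta>" and s: "s \<in> {1, -1}"
    and u: "u \<in> M" and v: "v \<in> M" and w: "set w \<subseteq> {1..k}"
  shows "barabanov s \<beta> (word_prod A w *v u) - s * ln (norm (word_prod A w *v u))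
    \<le> barabanov s \<beta> (word_prod A w *v v) - s * ln (norm (word_prod A w *v v))
      + 2 * distortion\<^sup>2 * contraction ^ length w"
proof -
  define a where "a = word_prod A w *v u"
  define b where "b = word_prod A w *v v"
  have ab: "a \<in> M" "b \<in> M" using word_prod_M[OF w] u v by (auto simp: a_def b_def)
  have nz: "norm a > 0" "norm b > 0" using ab M_nonzero by simp_all
  define a' where "a' = inverse (norm a) *\<^sub>R a"
  define b' where "b' = inverse (norm b) *\<^sub>R b"
  have a': "a' \<in> M" "norm a' = 1" and b': "b' \<in> M" "norm b' = 1"
    unfolding a'_def b'_def using normalize_M ab by auto
  have h: "barabanov s \<beta> a' = barabanov s \<beta> a - s * ln (norm a)"
          "barabanov s \<beta> b' = barabanov s \<beta> b - s * ln (norm b)"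
    unfolding a'_def b'_def using nz barabanov_scaleR[OF g ab(1), of "inverse (norm a)"]
      barabanov_scaleR[OF g ab(2), of "inverse (norm b)"] by (simp_all add: ln_inverse)
  have "\<bar>cross2 a b\<bar> \<le> distortion * contraction ^ length w * (norm a * norm b)"
    unfolding a_def b_def by (rule cross2_word_prod_le[OF w u v])
  then have "\<bar>cross2 a' b'\<bar> \<le> distortion * contraction ^ length w"
    using nz by (simp add: a'_def b'_def abs_mult field_simps)
  then have "line_dist a' b' \<le> 2 * (distortion * contraction ^ length w)"
    using line_dist_le_cross2[OF a'(2) b'(2)] by linarith
  then have "distortion * line_dist a' b' \<le> distortion * (2 * (distortion * contraction ^ length w))"
    using distortion_ge_1 by (intro mult_left_mono) auto
  then show ?thesis
    using barabanov_lipschitz[OF g s a' b'] unfolding h a_def b_def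
    by (simp add: power2_eq_square mult_ac)
qed

end

locale opposite_cone_systems =
  fwd: cone_system k A Cs + bwd: cone_system k "\<lambda>i. matrix_inv (A i)" Ds
  for k :: nat and A :: "nat \<Rightarrow> real^2^2" and Cs Ds :: "(real^2) set set"
begin

lemma word_prod_inverse:
  assumes "set w \<subseteq> {1..k}"
  shows "word_prod A (rev w) ** word_prod (\<lambda>i. matrix_inv (A i)) w = mat 1"
  using assms
proof (induction w)
  case Nil
  then show ?case by (simp add: matrix_mul_lid)
next
  case (Cons i w)
  let ?V = "word_prod A (rev w)" and ?W = "word_prod (\<lambda>i. matrix_inv (A i)) w"
  have "word_prod A (rev (i # w)) ** word_prod (\<lambda>i. matrix_inv (A i)) (i # w)
      = ?V ** (A i ** matrix_inv (A i)) ** ?W"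
    by (simp add: word_prod_append matrix_mul_assoc matrix_mul_rid)
  also have "A i ** matrix_inv (A i) = mat 1"
    using matrix_inv_mult(2)[OF fwd.invertible_letter] Cons.prems by simp
  finally show ?case using Cons by (simp add: matrix_mul_rid)
qed

text \<open>
  Directions that come from the backward multicone lose against those of the forward one. Both
  determinant estimates enter, and the two determinants cancel.
\<close>

lemma backward_vector_dominated:
  assumes w: "set w \<subseteq> {1..k}" and u: "u \<in> fwd.M" and z: "z \<in> (*v) (word_prod (\<lambda>i. matrix_inv (A i)) w) ` bwd.M"
  shows "(norm (word_prod A (rev w) *v z))\<^sup>2 * (norm u)\<^sup>2
    \<le> fwd.distortion * bwd.distortion * (fwd.contraction * bwd.contraction) ^ length w
       * ((norm z)\<^sup>2 * (norm (word_prod A (rev w) *v u))\<^sup>2)"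
proof -
  let ?V = "word_prod A (rev w)" and ?W = "word_prod (\<lambda>i. matrix_inv (A i)) w"
  obtain y where y: "y \<in> bwd.M" "z = ?W *v y" using z by auto
  have yz: "?V *v z = y" using word_prod_inverse[OF w] y(2) by (simp add: matrix_vector_mul_assoc)
  have "det ?V * det ?W = 1" using word_prod_inverse[OF w] by (metis det_I det_mul)
  then have d: "\<bar>det ?V\<bar> * \<bar>det ?W\<bar> = 1" by (metis abs_mult abs_one)
  have 1: "\<bar>det ?V\<bar> * (norm u)\<^sup>2 \<le> fwd.distortion * fwd.contraction ^ length w * (norm (?V *v u))\<^sup>2"
    using fwd.det_word_prod_le[of "rev w" u] w u by simp
  have 2: "\<bar>det ?W\<bar> * (norm y)\<^sup>2 \<le> bwd.distortion * bwd.contraction ^ length w * (norm z)\<^sup>2"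
    using bwd.det_word_prod_le[OF w y(1)] y(2) by simp
  have "(norm y)\<^sup>2 * (norm u)\<^sup>2 = (\<bar>det ?V\<bar> * (norm u)\<^sup>2) * (\<bar>det ?W\<bar> * (norm y)\<^sup>2)"
    using d by (simp add: mult_ac)
  also have "\<dots> \<le> (fwd.distortion * fwd.contraction ^ length w * (norm (?V *v u))\<^sup>2)
                * (bwd.distortion * bwd.contraction ^ length w * (norm z)\<^sup>2)"
    using fwd.distortion_ge_1 fwd.contraction_pos by (intro mult_mono 1 2) auto
  finally show ?thesis by (simp add: yz power_mult_distrib mult_ac)
qed

definition dominance :: "nat \<Rightarrow> real" where
  "dominance n = fwd.distortion * bwd.distortion * (fwd.contraction * bwd.contraction) ^ n"

lemma dominance_tendsto_0: "dominance \<longlonglongrightarrow> 0"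
proof -
  have "fwd.contraction * bwd.contraction < 1"
    using mult_strict_mono[of fwd.contraction 1 bwd.contraction 1]
      fwd.contraction_less_1 bwd.contraction_less_1 fwd.contraction_pos bwd.contraction_pos by simp
  then have "(\<lambda>n. (fwd.contraction * bwd.contraction) ^ n) \<longlonglongrightarrow> 0"
    using fwd.contraction_pos bwd.contraction_pos by (intro LIMSEQ_realpow_zero) auto
  from tendsto_mult_right_zero[OF this] show ?thesis unfolding dominance_def .
qed

lemma dominance_nonneg: "0 \<le> dominance n"
  unfolding dominance_def
  using fwd.contraction_pos bwd.contraction_pos fwd.distortion_ge_1 bwd.distortion_ge_1 by simp

text \<open>
  On a common direction the two growth factors agree, so neither can dominate the other.
\<close>

lemma transverse:
  assumes w: "set w \<subseteq> {1..k}" and dom: "dominance (length w) < 1"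
    and u: "u \<in> fwd.M" and z: "z \<in> (*v) (word_prod (\<lambda>i. matrix_inv (A i)) w) ` bwd.M"
  shows "cross2 u z \<noteq> 0"
proof
  assume "cross2 u z = 0"
  moreover have z0: "z \<noteq> 0" using z bwd.word_prod_M[OF w] bwd.zero_notin_M by (metis (no_types, lifting) imageE)
  ultimately obtain c where c: "u = c *\<^sub>R z" by (rule cross2_eq_0_imp_parallel)
  have c0: "c \<noteq> 0" using c u fwd.zero_notin_M by auto
  let ?V = "word_prod A (rev w)"
  have Vu: "?V *v u = c *\<^sub>R (?V *v z)" by (simp add: c matrix_scaled_vector)
  have "?V *v u \<noteq> 0" using fwd.word_prod_M[of "rev w" u] w u fwd.M_nonzero by auto
  then have Vz: "?V *v z \<noteq> 0" using Vu by auto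
  define P where "P = (norm z)\<^sup>2 * (norm (?V *v u))\<^sup>2"
  have P: "0 < P" using z0 \<open>?V *v u \<noteq> 0\<close> by (simp add: P_def)
  have "(norm (?V *v z))\<^sup>2 * (norm u)\<^sup>2 = P"
    unfolding P_def Vu by (simp add: c power_mult_distrib)
  then have "P \<le> dominance (length w) * P"
    using backward_vector_dominated[OF w u z] by (simp add: dominance_def P_def)
  then show False using dom P by (simp add: mult_less_cancel_right2 not_less[symmetric])
qed

lemma transverse_limit_direction:
  assumes y: "range y \<subseteq> {1..k}" and u: "u \<in> fwd.M"
  shows "cross2 u (bwd.limit_direction y) \<noteq> 0"
proof -
  have "eventually (\<lambda>n. dominance n < 1) sequentially"
    using order_tendstoD(2)[OF dominance_tendsto_0, of 1] by simp
  then obtain n where "dominance n < 1" by (auto simp: eventually_sequentially)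
  then show ?thesis
    using transverse[OF bwd.set_prefix[OF y, of n] _ u bwd.limit_direction_in_image[OF y]] by simp
qed

text \<open>
  In the expansion of \<open>u\<close> along \<open>v\<close> and the backward limit direction the second component is
  negligible under long products, so the ratio of growth is the coefficient of \<open>v\<close>, a quotient of
  two determinants.
\<close>

lemma growth_ratio_tendsto:
  assumes y: "range y \<subseteq> {1..k}" and u: "u \<in> fwd.M" and v: "v \<in> fwd.M"
  defines "W \<equiv> \<lambda>n. word_prod A (rev (map y [0..<n]))" and "F \<equiv> bwd.limit_direction y"
  shows "(\<lambda>n. ln (norm (W n *v u)) - ln (norm (W n *v v)))
    \<longlonglongrightarrow> ln \<bar>cross2 u F\<bar> - ln \<bar>cross2 v F\<bar>"
proof -
  have cu: "cross2 u F \<noteq> 0" and cv: "cross2 v F \<noteq> 0"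
    using transverse_limit_direction[OF y] u v by (auto simp: F_def)
  define \<alpha> where "\<alpha> = cross2 u F / cross2 v F"
  define \<gamma> where "\<gamma> = cross2 v u / cross2 v F"
  have dec: "u = \<alpha> *\<^sub>R v + \<gamma> *\<^sub>R F" unfolding \<alpha>_def \<gamma>_def by (rule cross2_decompose[OF cv])
  have pos: "norm (W n *v t) > 0" if "t \<in> fwd.M" for n t
    unfolding W_def using fwd.norm_word_prod_pos[of "rev (map y [0..<n])" t] that y by auto
  have v0: "norm v > 0" using v fwd.M_nonzero by auto
  have bound: "\<bar>norm (W n *v u) / norm (W n *v v) - \<bar>\<alpha>\<bar>\<bar> \<le> \<bar>\<gamma>\<bar> * (sqrt (dominance n) / norm v)" for n
  proof -
    have "(norm (W n *v F))\<^sup>2 * (norm v)\<^sup>2 \<le> dominance n * ((norm F)\<^sup>2 * (norm (W n *v v))\<^sup>2)"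
      using backward_vector_dominated[OF bwd.set_prefix[OF y, of n] v bwd.limit_direction_in_image[OF y]]
      by (simp add: dominance_def W_def F_def)
    then have "(norm (W n *v F) * norm v)\<^sup>2 \<le> (sqrt (dominance n) * norm (W n *v v))\<^sup>2"
      using bwd.norm_limit_direction[OF y] dominance_nonneg[of n] by (simp add: F_def power_mult_distrib)
    then have "norm (W n *v F) * norm v \<le> sqrt (dominance n) * norm (W n *v v)"
      by (rule power2_le_imp_le) (use dominance_nonneg[of n] in simp)
    then have F: "norm (W n *v F) / norm (W n *v v) \<le> sqrt (dominance n) / norm v"
      using v0 pos[OF v, of n] by (simp add: field_simps)
    have "W n *v u - \<alpha> *\<^sub>R (W n *v v) = \<gamma> *\<^sub>R (W n *v F)"
      by (subst dec) (simp add: matrix_vector_right_distrib matrix_scaled_vector)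
    then have "\<bar>norm (W n *v u) - \<bar>\<alpha>\<bar> * norm (W n *v v)\<bar> \<le> \<bar>\<gamma>\<bar> * norm (W n *v F)"
      using norm_triangle_ineq3[of "W n *v u" "\<alpha> *\<^sub>R (W n *v v)"] by simp
    then have "\<bar>norm (W n *v u) - \<bar>\<alpha>\<bar> * norm (W n *v v)\<bar> / norm (W n *v v)
        \<le> \<bar>\<gamma>\<bar> * (norm (W n *v F) / norm (W n *v v))"
      using pos[OF v, of n] by (simp add: divide_right_mono)
    moreover have "\<bar>norm (W n *v u) - \<bar>\<alpha>\<bar> * norm (W n *v v)\<bar> / norm (W n *v v)
        = \<bar>norm (W n *v u) / norm (W n *v v) - \<bar>\<alpha>\<bar>\<bar>"
    proof -
      have "(norm (W n *v u) - \<bar>\<alpha>\<bar> * norm (W n *v v)) / norm (W n *v v) = norm (W n *v u) / norm (W n *v v) - \<bar>\<alpha>\<bar>"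
        using pos[OF v, of n] by (simp add: diff_divide_distrib)
      then show ?thesis using pos[OF v, of n] by (metis abs_divide abs_norm_cancel)
    qed
    ultimately show ?thesis using mult_left_mono[OF F, of "\<bar>\<gamma>\<bar>"] by linarith
  qed
  have "(\<lambda>n. sqrt (dominance n)) \<longlonglongrightarrow> 0"
    using tendsto_real_sqrt[OF dominance_tendsto_0] by simp
  then have "(\<lambda>n. \<bar>\<gamma>\<bar> * (sqrt (dominance n) / norm v)) \<longlonglongrightarrow> 0"
    by (intro tendsto_mult_right_zero tendsto_divide_zero)
  then have "(\<lambda>n. norm (W n *v u) / norm (W n *v v) - \<bar>\<alpha>\<bar>) \<longlonglongrightarrow> 0"
    by (rule Lim_null_comparison[rotated]) (use bound in auto)
  then have "(\<lambda>n. norm (W n *v u) / norm (W n *v v)) \<longlonglongrightarrow> \<bar>\<alpha>\<bar>"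
    by (simp add: LIM_zero_iff)
  moreover have "\<bar>\<alpha>\<bar> > 0" using cu cv by (simp add: \<alpha>_def)
  ultimately have "(\<lambda>n. ln (norm (W n *v u) / norm (W n *v v))) \<longlonglongrightarrow> ln \<bar>\<alpha>\<bar>"
    by (intro tendsto_ln) auto
  moreover have "ln (norm (W n *v u) / norm (W n *v v)) = ln (norm (W n *v u)) - ln (norm (W n *v v))" for n
    using pos u v by (simp add: ln_div)
  moreover have "ln \<bar>\<alpha>\<bar> = ln \<bar>cross2 u F\<bar> - ln \<bar>cross2 v F\<bar>" using cu cv by (simp add: \<alpha>_def ln_div)
  ultimately show ?thesis by simp
qed

text \<open>
  Exchange argument: two extremal orbits are compared with the pair of orbits obtained by
  exchanging their futures. The extremal function bounds the growth of the exchanged orbits, and in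
  the limit the total gain is the logarithm of a cross ratio, which therefore has a definite sign.
\<close>

lemma extremal_cross_ratio:
  assumes g: "fwd.growth_bounded s \<beta>" and s: "s \<in> {1, -1}"
    and y: "range y \<subseteq> {1..k}" and y': "range y' \<subseteq> {1..k}" and u: "u \<in> fwd.M" and v: "v \<in> fwd.M"
    and ext_u: "\<And>n. fwd.barabanov s \<beta> (word_prod A (rev (map y [0..<n])) *v u) = fwd.barabanov s \<beta> u + \<beta> * real n"
    and ext_v: "\<And>n. fwd.barabanov s \<beta> (word_prod A (rev (map y' [0..<n])) *v v) = fwd.barabanov s \<beta> v + \<beta> * real n"
  defines "F \<equiv> bwd.limit_direction y" and "F' \<equiv> bwd.limit_direction y'"
  shows "s * ((ln \<bar>cross2 u F\<bar> - ln \<bar>cross2 v F\<bar>) + (ln \<bar>cross2 v F'\<bar> - ln \<bar>cross2 u F'\<bar>)) \<ge> 0"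
proof -
  let ?H = "fwd.barabanov s \<beta>"
  define w where "w = (\<lambda>n. rev (map y [0..<n]))"
  define w' where "w' = (\<lambda>n. rev (map y' [0..<n]))"
  have w: "set (w n) \<subseteq> {1..k}" "set (w' n) \<subseteq> {1..k}" "length (w n) = n" "length (w' n) = n" for n
    using y y' by (auto simp: w_def w'_def)
  define a where "a = (\<lambda>n. s * ((ln (norm (word_prod A (w n) *v u)) - ln (norm (word_prod A (w n) *v v)))
     + (ln (norm (word_prod A (w' n) *v v)) - ln (norm (word_prod A (w' n) *v u)))))"
  have "a \<longlonglongrightarrow> s * ((ln \<bar>cross2 u F\<bar> - ln \<bar>cross2 v F\<bar>) + (ln \<bar>cross2 v F'\<bar> - ln \<bar>cross2 u F'\<bar>))"
    unfolding a_def w_def w'_def F_def F'_def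
    by (intro tendsto_mult tendsto_const tendsto_add growth_ratio_tendsto y y' u v)
  moreover have "(\<lambda>n. - 4 * fwd.distortion\<^sup>2 * fwd.contraction ^ n) \<longlonglongrightarrow> - 4 * fwd.distortion\<^sup>2 * 0"
    using fwd.contraction_pos fwd.contraction_less_1
    by (intro tendsto_mult tendsto_const LIMSEQ_realpow_zero) auto
  moreover have "- 4 * fwd.distortion\<^sup>2 * fwd.contraction ^ n \<le> a n" for n
  proof -
    have "?H (word_prod A (w n) *v u) \<ge> ?H u + \<beta> * real n" "?H (word_prod A (w' n) *v v) \<ge> ?H v + \<beta> * real n"
      using ext_u[of n] ext_v[of n] by (auto simp: w_def w'_def)
    moreover have "?H (word_prod A (w n) *v v) \<le> ?H v + \<beta> * real n" "?H (word_prod A (w' n) *v u) \<le> ?H u + \<beta> * real n"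
      using fwd.barabanov_word[OF g v w(1)[of n]] fwd.barabanov_word[OF g u w(2)[of n]] w by simp_all
    moreover note fwd.barabanov_projective_contraction[OF g s u v w(1)[of n]]
      fwd.barabanov_projective_contraction[OF g s v u w(2)[of n]]
    ultimately show ?thesis unfolding a_def w(3,4) by (simp add: algebra_simps)
  qed
  ultimately show ?thesis by (intro LIMSEQ_le[of "\<lambda>n. - 4 * fwd.distortion\<^sup>2 * fwd.contraction ^ n" 0 a]) auto
qed

end

section \<open>The pointwise ergodic theorem for bounded functions\<close>

definition orbit_sum :: "('a \<Rightarrow> 'a) \<Rightarrow> ('a \<Rightarrow> real) \<Rightarrow> nat \<Rightarrow> 'a \<Rightarrow> real" where
  "orbit_sum T f n x = (\<Sum>i<n. f ((T ^^ i) x))"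

lemma orbit_sum_Suc_shift: "orbit_sum T f (Suc n) x = f x + orbit_sum T f n (T x)"
  unfolding orbit_sum_def by (subst sum.lessThan_Suc_shift) (simp add: funpow_Suc_right del: funpow.simps)

lemma orbit_sum_add: "orbit_sum T f (m + n) x = orbit_sum T f m x + orbit_sum T f n ((T ^^ m) x)"
  by (induction m arbitrary: x)
    (simp_all add: orbit_sum_Suc_shift orbit_sum_def[of T f 0] funpow_Suc_right del: funpow.simps)

locale bounded_observable = prob_space \<mu> for \<mu> :: "'a measure" +
  fixes T :: "'a \<Rightarrow> 'a" and f :: "'a \<Rightarrow> real" and B :: real
  assumes T_measurable [measurable]: "T \<in> measurable \<mu> \<mu>"
    and T_preserves: "distr \<mu> \<mu> T = \<mu>"
    and f_measurable [measurable]: "f \<in> borel_measurable \<mu>"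
    and f_bounded: "x \<in> space \<mu> \<Longrightarrow> \<bar>f x\<bar> \<le> B"
begin

lemma T_space: "x \<in> space \<mu> \<Longrightarrow> T x \<in> space \<mu>"
  using T_measurable by (rule measurable_space)

lemma funpow_measurable [measurable]: "(T ^^ i) \<in> measurable \<mu> \<mu>"
  by (rule measurable_compose_n) (rule T_measurable)

lemma funpow_space: "x \<in> space \<mu> \<Longrightarrow> (T ^^ i) x \<in> space \<mu>"
  using funpow_measurable by (rule measurable_space)

lemma distr_funpow: "distr \<mu> \<mu> (T ^^ i) = \<mu>"
proof (induction i)
  case 0
  show ?case by (simp add: id_def distr_id2)
next
  case (Suc i)
  have "distr (distr \<mu> \<mu> (T ^^ i)) \<mu> T = distr \<mu> \<mu> (T \<circ> (T ^^ i))"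
    by (rule distr_distr) measurable
  then show ?case by (simp add: Suc T_preserves o_def)
qed

lemma f_integrable: "integrable \<mu> f"
  by (rule integrable_const_bound[of _ B]) (use f_bounded in auto)

lemma orbit_sum_measurable [measurable]: "orbit_sum T f n \<in> borel_measurable \<mu>"
  unfolding orbit_sum_def by measurable

lemma orbit_sum_bounded: "x \<in> space \<mu> \<Longrightarrow> \<bar>orbit_sum T f n x\<bar> \<le> real n * B"
  unfolding orbit_sum_def
  using sum_bounded_above[of "{..<n}" "\<lambda>i. \<bar>f ((T ^^ i) x)\<bar>" B] f_bounded[OF funpow_space, of x]
  by (intro order_trans[OF sum_abs]) simp

lemma integral_orbit_sum: "(LINT x|\<mu>. orbit_sum T f n x) = real n * (LINT x|\<mu>. f x)"
proof -
  have int: "integrable \<mu> (\<lambda>x. f ((T ^^ i) x))" for i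
    by (rule integrable_const_bound[of _ B]) (use f_bounded funpow_space in auto)
  have "(LINT x|\<mu>. f ((T ^^ i) x)) = (LINT x|\<mu>. f x)" for i
    using integral_distr[of "T ^^ i" \<mu> \<mu> f] distr_funpow[of i] by simp
  then show ?thesis unfolding orbit_sum_def using int by simp
qed

text \<open>
  A greedy decomposition of an orbit segment into pieces with nonnegative sum leaves a remainder of
  bounded length, so the average of \<open>f\<close> cannot be negative.
\<close>

lemma integral_nonneg_if_recurrently_nonneg:
  assumes L: "\<And>x. x \<in> space \<mu> \<Longrightarrow> \<exists>n\<in>{1..L}. orbit_sum T f n x \<ge> 0"
  shows "(LINT x|\<mu>. f x) \<ge> 0"
proof -
  obtain x0 where "x0 \<in> space \<mu>" using not_empty by blast
  then have B0: "0 \<le> B" using f_bounded[of x0] by linarith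
  have lower: "orbit_sum T f m x \<ge> - (real L * B)" if "x \<in> space \<mu>" for m x
    using that
  proof (induction m arbitrary: x rule: less_induct)
    case (less m)
    obtain n where n: "n \<in> {1..L}" "orbit_sum T f n x \<ge> 0" using L less.prems by blast
    show ?case
    proof (cases "n \<le> m")
      case True
      then have "orbit_sum T f m x = orbit_sum T f n x + orbit_sum T f (m - n) ((T ^^ n) x)"
        using orbit_sum_add[of T f n "m - n" x] by simp
      moreover have "orbit_sum T f (m - n) ((T ^^ n) x) \<ge> - (real L * B)"
        using n True by (intro less.IH funpow_space less.prems) auto
      ultimately show ?thesis using n by linarith
    next
      case False
      then have "real m * B \<le> real L * B" using n B0 by (intro mult_right_mono) auto
      then show ?thesis using orbit_sum_bounded[OF less.prems, of m] by linarith
    qed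
  qed
  have lower_m: "- (real L * B) \<le> real m * (LINT x|\<mu>. f x)" for m
  proof -
    have "integrable \<mu> (orbit_sum T f m)"
      by (rule integrable_const_bound[of _ "real m * B"]) (use orbit_sum_bounded in auto)
    then have "(LINT x|\<mu>. - (real L * B)) \<le> (LINT x|\<mu>. orbit_sum T f m x)"
      by (intro integral_mono) (use lower in auto)
    then show ?thesis by (simp add: integral_orbit_sum prob_space)
  qed
  then have le: "- (real L * B) / real m \<le> (LINT x|\<mu>. f x)" if "m > 0" for m
    using that lower_m[of m] by (subst pos_divide_le_eq) (simp_all add: mult.commute)
  have "(\<lambda>m. - (real L * B) / real m) \<longlonglongrightarrow> 0" by (rule lim_const_over_n)
  then show ?thesis
    by (rule LIMSEQ_le_const2) (use le in \<open>auto intro!: exI[of _ 1]\<close>)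
qed

definition upper_average :: "'a \<Rightarrow> ereal" where
  "upper_average x = limsup (\<lambda>n. ereal (orbit_sum T f n x / real n))"

lemma average_bounded: "x \<in> space \<mu> \<Longrightarrow> \<bar>orbit_sum T f n x / real n\<bar> \<le> B"
proof (cases "n = 0")
  case True
  assume "x \<in> space \<mu>"
  then show ?thesis using f_bounded[of x] True by simp
next
  case False
  assume "x \<in> space \<mu>"
  then show ?thesis using orbit_sum_bounded[of x n] False by (simp add: abs_divide pos_divide_le_eq mult.commute)
qed

lemma upper_average_bounds:
  assumes "x \<in> space \<mu>"
  shows "ereal (- B) \<le> upper_average x" "upper_average x \<le> ereal B"
proof -
  have b: "- B \<le> orbit_sum T f n x / real n" "orbit_sum T f n x / real n \<le> B" for n
    using average_bounded[OF assms, of n] unfolding abs_le_iff by linarith+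
  have "ereal (- B) \<le> liminf (\<lambda>n. ereal (orbit_sum T f n x / real n))"
    by (rule Liminf_bounded) (use b in \<open>auto intro!: always_eventually\<close>)
  also have "\<dots> \<le> upper_average x" unfolding upper_average_def by (rule Liminf_le_Limsup) simp
  finally show "ereal (- B) \<le> upper_average x" .
  show "upper_average x \<le> ereal B" unfolding upper_average_def
    by (rule Limsup_bounded) (use b in \<open>auto intro!: always_eventually\<close>)
qed

lemma upper_average_real: "x \<in> space \<mu> \<Longrightarrow> ereal (real_of_ereal (upper_average x)) = upper_average x"
  using upper_average_bounds[of x] by (cases "upper_average x") auto

lemma upper_average_invariant:
  assumes x: "x \<in> space \<mu>"
  shows "upper_average (T x) = upper_average x"
proof -
  define u where "u = (\<lambda>n. orbit_sum T f n x / real n)"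
  define v where "v = (\<lambda>n. orbit_sum T f n (T x) / real n)"
  have eq: "v n = (v n / real (Suc n) - f x / real (Suc n)) + u (n + 1)" for n
  proof (cases "n = 0")
    case True
    then show ?thesis by (simp add: u_def v_def orbit_sum_Suc_shift orbit_sum_def)
  next
    case False
    then have "u (n + 1) = (f x + real n * v n) / real (Suc n)"
      by (simp add: u_def v_def orbit_sum_Suc_shift)
    then have "(v n / real (Suc n) - f x / real (Suc n)) + u (n + 1) = (real (Suc n) * v n) / real (Suc n)"
      by (simp only: diff_divide_distrib[symmetric] add_divide_distrib[symmetric] of_nat_Suc)
        (simp add: algebra_simps)
    then show ?thesis by simp
  qed
  have "(\<lambda>n. v n / real (Suc n) - f x / real (Suc n)) \<longlonglongrightarrow> 0"
  proof (rule Lim_null_comparison)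
    show "\<forall>\<^sub>F n in sequentially. norm (v n / real (Suc n) - f x / real (Suc n)) \<le> 2 * B / real (Suc n)"
    proof (rule always_eventually, rule allI)
      fix n
      have "\<bar>v n - f x\<bar> \<le> 2 * B"
        using average_bounded[OF T_space[OF x], of n] f_bounded[OF x] unfolding v_def by linarith
      then show "norm (v n / real (Suc n) - f x / real (Suc n)) \<le> 2 * B / real (Suc n)"
        by (simp add: diff_divide_distrib[symmetric] divide_right_mono)
    qed
    show "(\<lambda>n. 2 * B / real (Suc n)) \<longlonglongrightarrow> 0"
      by (rule LIMSEQ_Suc[OF lim_const_over_n])
  qed
  then have lim: "(\<lambda>n. ereal (v n / real (Suc n) - f x / real (Suc n))) \<longlonglongrightarrow> ereal 0" by simp
  have eq': "ereal (v n) = ereal (v n / real (Suc n) - f x / real (Suc n)) + ereal (u (n + 1))" for n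
    by (metis eq plus_ereal.simps(1))
  have "upper_average (T x) = limsup (\<lambda>n. ereal (v n))" by (simp add: upper_average_def v_def)
  also have "\<dots> = limsup (\<lambda>n. ereal (v n / real (Suc n) - f x / real (Suc n)) + ereal (u (n + 1)))"
    by (rule arg_cong[where f = limsup]) (rule ext, rule eq')
  also have "\<dots> = ereal 0 + limsup (\<lambda>n. ereal (u (n + 1)))"
    by (rule ereal_limsup_lim_add[OF lim]) simp
  also have "\<dots> = upper_average x"
    unfolding upper_average_def using limsup_shift[of "\<lambda>n. ereal (u n)"] by (simp add: u_def)
  finally show ?thesis .
qed

lemma upper_average_measurable [measurable]: "upper_average \<in> borel_measurable \<mu>"
  unfolding upper_average_def by measurable

lemma upper_average_funpow: "x \<in> space \<mu> \<Longrightarrow> upper_average ((T ^^ i) x) = upper_average x"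
proof (induction i)
  case (Suc i)
  then show ?case using upper_average_invariant[OF funpow_space[of x i]] by simp
qed simp

lemma upper_average_abs: "x \<in> space \<mu> \<Longrightarrow> \<bar>real_of_ereal (upper_average x)\<bar> \<le> B"
  using upper_average_bounds[of x] by (cases "upper_average x") (auto simp: abs_le_iff)

lemma upper_average_integrable: "integrable \<mu> (\<lambda>x. real_of_ereal (upper_average x))"
  by (rule integrable_const_bound[of _ B]) (use upper_average_abs in auto)

text \<open>
  Where the upper average is nearly reached within time \<open>L\<close>, the function
  \<open>f - upper_average + \<epsilon>\<close> is recurrently nonnegative; raising it by \<open>2 B\<close> on the remaining set, of
  small measure, makes it so everywhere.
\<close>

lemma integral_upper_average_le: "(LINT x|\<mu>. real_of_ereal (upper_average x)) \<le> (LINT x|\<mu>. f x)"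
proof (rule field_le_epsilon)
  fix e :: real assume e: "0 < e"
  define m where "m = (\<lambda>x. real_of_ereal (upper_average x))"
  have [measurable]: "m \<in> borel_measurable \<mu>" unfolding m_def by measurable
  have m_inv: "m ((T ^^ i) x) = m x" if "x \<in> space \<mu>" for x i
    using upper_average_funpow[OF that] by (simp add: m_def)
  define E where "E = (\<lambda>L. {x \<in> space \<mu>. \<exists>n\<in>{1..L}. orbit_sum T f n x \<ge> real n * (m x - e)})"
  have [measurable]: "E L \<in> sets \<mu>" for L unfolding E_def by measurable
  have "(\<Union>L. E L) = space \<mu>"
  proof
    show "space \<mu> \<subseteq> (\<Union>L. E L)"
    proof
      fix x assume x: "x \<in> space \<mu>"
      have "\<exists>n\<ge>1. ereal (m x - e) < ereal (orbit_sum T f n x / real n)"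
      proof (rule ccontr)
        assume "\<not> ?thesis"
        then have "eventually (\<lambda>n. ereal (orbit_sum T f n x / real n) \<le> ereal (m x - e)) sequentially"
          unfolding eventually_sequentially by (metis not_le)
        then have "upper_average x \<le> ereal (m x - e)"
          unfolding upper_average_def by (rule Limsup_bounded)
        then have "ereal (m x) \<le> ereal (m x - e)" using upper_average_real[OF x] by (simp add: m_def)
        then show False using e by simp
      qed
      then obtain n where n: "n \<ge> 1" "m x - e < orbit_sum T f n x / real n" by auto
      then have "real n * (m x - e) \<le> orbit_sum T f n x"
        by (simp add: pos_less_divide_eq mult.commute)
      then have "x \<in> E n" using x n by (auto simp: E_def)
      then show "x \<in> (\<Union>L. E L)" by blast
    qed
  qed (auto simp: E_def)
  moreover have "incseq E" unfolding E_def by (force simp: incseq_def)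
  ultimately have lim: "(\<lambda>L. prob (E L)) \<longlonglongrightarrow> 1"
    using finite_Lim_measure_incseq[of E] by (simp add: prob_space image_subset_iff)
  obtain x0 where "x0 \<in> space \<mu>" using not_empty by blast
  then have B0: "0 \<le> B" using f_bounded[of x0] by linarith
  have main: "(LINT x|\<mu>. m x) \<le> (LINT x|\<mu>. f x) + e + 2 * B * (1 - prob (E L))" if L: "1 \<le> L" for L
  proof -
    define g where "g = (\<lambda>x. f x - m x + e + 2 * B * indicator (space \<mu> - E L) x)"
    have mB: "\<bar>m x\<bar> \<le> B" if "x \<in> space \<mu>" for x using upper_average_abs[OF that] by (simp add: m_def)
    interpret g: bounded_observable \<mu> T g "4 * B + e"
    proof
      show "g \<in> borel_measurable \<mu>" unfolding g_def by measurable
      show "\<bar>g x\<bar> \<le> 4 * B + e" if x: "x \<in> space \<mu>" for x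
        using f_bounded[OF x] mB[OF x] e B0 by (auto simp: g_def indicator_def)
    qed (rule T_measurable, rule T_preserves)
    have "0 \<le> (LINT x|\<mu>. g x)"
    proof (rule g.integral_nonneg_if_recurrently_nonneg)
      fix x assume x: "x \<in> space \<mu>"
      show "\<exists>n\<in>{1..L}. 0 \<le> orbit_sum T g n x"
      proof (cases "x \<in> E L")
        case True
        then obtain n where n: "n \<in> {1..L}" "orbit_sum T f n x \<ge> real n * (m x - e)" by (auto simp: E_def)
        have "orbit_sum T g n x = orbit_sum T f n x - real n * (m x - e)
            + 2 * B * (\<Sum>i<n. indicator (space \<mu> - E L) ((T ^^ i) x))"
          unfolding orbit_sum_def g_def
          by (simp add: m_inv[OF x] sum.distrib sum_subtractf sum_distrib_left algebra_simps)
        moreover have "0 \<le> 2 * B * (\<Sum>i<n. indicator (space \<mu> - E L) ((T ^^ i) x))"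
          using B0 by (intro mult_nonneg_nonneg sum_nonneg) auto
        ultimately show ?thesis using n by (intro bexI[of _ n]) linarith+
      next
        case False
        then have "orbit_sum T g 1 x \<ge> 0"
          using x f_bounded[OF x] mB[OF x] e by (simp add: orbit_sum_def g_def)
        then show ?thesis using L by (intro bexI[of _ 1]) auto
      qed
    qed
    also have "(LINT x|\<mu>. g x) = (LINT x|\<mu>. f x) - (LINT x|\<mu>. m x) + e + 2 * B * prob (space \<mu> - E L)"
    proof -
      have I: "integrable \<mu> f" "integrable \<mu> m" "integrable \<mu> (\<lambda>x. e)"
        using f_integrable upper_average_integrable by (auto simp: m_def)
      have J: "integrable \<mu> (\<lambda>x. 2 * B * indicator (space \<mu> - E L) x)"
        by (intro integrable_mult_right integrable_real_indicator) (auto simp: emeasure_eq_measure)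
      have "(LINT x|\<mu>. g x) = (LINT x|\<mu>. f x - m x + e) + (LINT x|\<mu>. 2 * B * indicator (space \<mu> - E L) x)"
        unfolding g_def by (intro Bochner_Integration.integral_add J)
          (intro Bochner_Integration.integrable_add Bochner_Integration.integrable_diff I)
      also have "(LINT x|\<mu>. f x - m x + e) = (LINT x|\<mu>. f x) - (LINT x|\<mu>. m x) + e"
        using I by (simp add: prob_space)
      also have "(LINT x|\<mu>. 2 * B * indicator (space \<mu> - E L) x) = 2 * B * prob (space \<mu> - E L)"
        by simp
      finally show ?thesis .
    qed
    also have "prob (space \<mu> - E L) = 1 - prob (E L)" by (rule prob_compl) measurable
    finally show ?thesis by simp
  qed
  have "(\<lambda>L. (LINT x|\<mu>. f x) + e + 2 * B * (1 - prob (E L))) \<longlonglongrightarrow> (LINT x|\<mu>. f x) + e + 2 * B * (1 - 1)"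
    by (intro tendsto_intros lim)
  then have "(LINT x|\<mu>. m x) \<le> (LINT x|\<mu>. f x) + e + 2 * B * (1 - 1)"
    by (rule LIMSEQ_le_const) (use main in blast)
  then show "(LINT x|\<mu>. real_of_ereal (upper_average x)) \<le> (LINT x|\<mu>. f x) + e" by (simp add: m_def)
qed

text \<open>
  The inequality for the upper averages of \<open>f\<close> and of \<open>- f\<close> leaves no room between the lower and
  the upper average.
\<close>

theorem averages_converge: "AE x in \<mu>. convergent (\<lambda>n. orbit_sum T f n x / real n)"
proof -
  interpret neg: bounded_observable \<mu> T "\<lambda>x. - f x" B
    by unfold_locales (use f_bounded T_preserves in auto)
  have neg_sum: "orbit_sum T (\<lambda>x. - f x) n x = - orbit_sum T f n x" for n x
    by (simp add: orbit_sum_def sum_negf)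
  have lower: "neg.upper_average x = - liminf (\<lambda>n. ereal (orbit_sum T f n x / real n))" for x
    unfolding neg.upper_average_def neg_sum using ereal_Limsup_uminus[of sequentially] by (simp add: ereal_Limsup_uminus[symmetric] flip: uminus_ereal.simps)
  define d where "d = (\<lambda>x. real_of_ereal (upper_average x) + real_of_ereal (neg.upper_average x))"
  have d_nonneg: "d x \<ge> 0" if x: "x \<in> space \<mu>" for x
  proof -
    have "liminf (\<lambda>n. ereal (orbit_sum T f n x / real n)) \<le> upper_average x"
      unfolding upper_average_def by (rule Liminf_le_Limsup) simp
    then have "- neg.upper_average x \<le> upper_average x" by (simp add: lower)
    then have "ereal (- real_of_ereal (neg.upper_average x)) \<le> ereal (real_of_ereal (upper_average x))"
      by (metis neg.upper_average_real[OF x] upper_average_real[OF x] uminus_ereal.simps(1))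
    then show ?thesis by (simp add: d_def)
  qed
  have int: "integrable \<mu> d" unfolding d_def
    using upper_average_integrable neg.upper_average_integrable by (rule Bochner_Integration.integrable_add)
  have "(LINT x|\<mu>. d x) \<le> 0"
    using integral_upper_average_le neg.integral_upper_average_le
      upper_average_integrable neg.upper_average_integrable by (simp add: d_def)
  moreover have "(LINT x|\<mu>. d x) \<ge> 0" using d_nonneg by (intro integral_nonneg_AE) auto
  ultimately have "(LINT x|\<mu>. d x) = 0" by simp
  then have "AE x in \<mu>. d x = 0"
    using integral_nonneg_eq_0_iff_AE[OF int] d_nonneg by auto
  then show ?thesis
  proof (rule AE_mp, intro AE_I2 impI)
    fix x assume x: "x \<in> space \<mu>" and d: "d x = 0"
    have "liminf (\<lambda>n. ereal (orbit_sum T f n x / real n)) = upper_average x"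
    proof -
      have "- neg.upper_average x = upper_average x"
        using d by (metis add.commute add_eq_0_iff d_def neg.upper_average_real[OF x] upper_average_real[OF x] uminus_ereal.simps(1))
      then show ?thesis by (simp add: lower)
    qed
    then have "(\<lambda>n. ereal (orbit_sum T f n x / real n)) \<longlonglongrightarrow> ereal (real_of_ereal (upper_average x))"
      unfolding upper_average_real[OF x] unfolding upper_average_def by (intro Liminf_eq_Limsup) auto
    then show "convergent (\<lambda>n. orbit_sum T f n x / real n)" by (auto simp: convergent_def)
  qed
qed

end

section \<open>The full shift and its invariant measures\<close>

definition right_shift :: "(int \<Rightarrow> nat) \<Rightarrow> int \<Rightarrow> nat" where
  "right_shift \<omega> = (\<lambda>n. \<omega> (n - 1))"

lemma left_right_shift [simp]: "left_shift (right_shift \<omega>) = \<omega>" "right_shift (left_shift \<omega>) = \<omega>"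
  by (simp_all add: left_shift_def right_shift_def)

lemma left_shift_funpow: "(left_shift ^^ n) \<omega> i = \<omega> (i + int n)"
  by (induction n arbitrary: i) (simp_all add: left_shift_def algebra_simps)

lemma right_shift_funpow: "(right_shift ^^ n) \<omega> i = \<omega> (i - int n)"
  by (induction n arbitrary: i) (simp_all add: right_shift_def algebra_simps)

lemma shift_full_shift:
  "\<omega> \<in> full_shift k \<Longrightarrow> left_shift \<omega> \<in> full_shift k"
  "\<omega> \<in> full_shift k \<Longrightarrow> right_shift \<omega> \<in> full_shift k"
  by (auto simp: full_shift_def left_shift_def right_shift_def)

lemma funpow_full_shift: "\<omega> \<in> full_shift k \<Longrightarrow> (left_shift ^^ n) \<omega> \<in> full_shift k"
  by (induction n) (auto intro: shift_full_shift)

lemma continuous_on_left_shift: "continuous_on UNIV left_shift"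
  unfolding left_shift_def by (intro continuous_on_coordinatewise_then_product) simp

lemma continuous_on_right_shift: "continuous_on UNIV right_shift"
  unfolding right_shift_def by (intro continuous_on_coordinatewise_then_product) simp

lemma compact_full_shift: "compact (full_shift k)"
proof -
  have "full_shift k = PiE UNIV (\<lambda>_. {1..k})" by (auto simp: full_shift_def)
  moreover have "compactin (product_topology (\<lambda>_. euclidean) UNIV) (PiE UNIV (\<lambda>_::int. {1..k}))"
    unfolding compactin_PiE by (intro disjI2 ballI) (simp add: finite_imp_compact)
  ultimately show ?thesis by (simp add: euclidean_product_topology)
qed

definition cylinder :: "(int \<Rightarrow> nat) \<Rightarrow> nat \<Rightarrow> (int \<Rightarrow> nat) set" where
  "cylinder \<omega> N = {\<tau>. \<forall>i\<in>{- int N..int N}. \<tau> i = \<omega> i}"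

lemma open_cylinder: "open (cylinder \<omega> N)"
proof -
  have "cylinder \<omega> N = (\<Inter>i\<in>{- int N..int N}. (\<lambda>\<tau>. \<tau> i) -` {\<omega> i})" by (auto simp: cylinder_def)
  moreover have "open ((\<lambda>\<tau>::int \<Rightarrow> nat. \<tau> i) -` {\<omega> i})" for i
    by (intro open_vimage continuous_on_product_coordinates) (rule Topological_Spaces.open_discrete)
  ultimately show ?thesis by (simp add: open_INT)
qed

lemma in_cylinder_self: "\<omega> \<in> cylinder \<omega> N"
  by (simp add: cylinder_def)

text \<open>Only finitely many coordinates are restricted by a basic open set of the product topology.\<close>

lemma cylinder_basis:
  assumes "open U" "\<omega> \<in> U"
  obtains N where "cylinder \<omega> N \<subseteq> U"
proof -
  have "openin (product_topology (\<lambda>_. euclidean) UNIV) U"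
    using assms(1) by (simp add: euclidean_product_topology)
  then obtain X where X: "\<omega> \<in> Pi\<^sub>E UNIV X" "finite {i. X i \<noteq> UNIV}" "Pi\<^sub>E UNIV X \<subseteq> U"
    using product_topology_open_contains_basis[OF _ assms(2)] by force
  define N where "N = Max (insert 0 ((\<lambda>i. nat \<bar>i\<bar>) ` {i. X i \<noteq> UNIV}))"
  have N: "i \<in> {- int N..int N}" if "X i \<noteq> UNIV" for i
  proof -
    have "nat \<bar>i\<bar> \<le> N" unfolding N_def by (rule Max_ge) (use X(2) that in auto)
    then show ?thesis by auto
  qed
  have "cylinder \<omega> N \<subseteq> Pi\<^sub>E UNIV X"
  proof
    fix \<tau> assume t: "\<tau> \<in> cylinder \<omega> N"
    have "\<tau> i \<in> X i" for i
    proof (cases "X i = UNIV")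
      case False
      then have "\<tau> i = \<omega> i" using t N by (simp add: cylinder_def)
      then show ?thesis using X(1) by auto
    qed simp
    then show "\<tau> \<in> Pi\<^sub>E UNIV X" by auto
  qed
  with X(3) have "cylinder \<omega> N \<subseteq> U" by simp
  then show thesis by (rule that)
qed

lemma continuous_on_full_shift:
  fixes g :: "(int \<Rightarrow> nat) \<Rightarrow> real"
  assumes "\<And>\<omega> e. \<omega> \<in> full_shift k \<Longrightarrow> 0 < e \<Longrightarrow>
    \<exists>N. \<forall>\<tau>\<in>full_shift k \<inter> cylinder \<omega> N. \<bar>g \<tau> - g \<omega>\<bar> < e"
  shows "continuous_on (full_shift k) g"
  unfolding continuous_on_def
proof (intro ballI tendstoI)
  fix \<omega> and e :: real assume \<omega>: "\<omega> \<in> full_shift k" and e: "0 < e"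
  obtain N where N: "\<forall>\<tau>\<in>full_shift k \<inter> cylinder \<omega> N. \<bar>g \<tau> - g \<omega>\<bar> < e"
    using assms[OF \<omega> e] by blast
  show "\<forall>\<^sub>F \<tau> in at \<omega> within full_shift k. dist (g \<tau>) (g \<omega>) < e"
    unfolding eventually_at_topological
    by (rule exI[of _ "cylinder \<omega> N"]) (use N in \<open>auto simp: open_cylinder in_cylinder_self dist_real_def\<close>)
qed

lemma invariant_measuresD:
  assumes "\<mu> \<in> invariant_measures k"
  shows "prob_space \<mu>" "sets \<mu> = sets (restrict_space borel (full_shift k))"
    "distr \<mu> \<mu> left_shift = \<mu>" "space \<mu> = full_shift k"
  using assms sets_eq_imp_space_eq[of \<mu> "restrict_space borel (full_shift k)"]
  by (auto simp: invariant_measures_def space_restrict_space)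

lemma left_shift_measurable_restrict:
  "left_shift \<in> measurable (restrict_space borel (full_shift k)) (restrict_space borel (full_shift k))"
  by (intro measurable_restrict_space3 borel_measurable_continuous_onI continuous_on_left_shift)
    (auto intro: shift_full_shift)

lemma left_shift_measurable:
  assumes "\<mu> \<in> invariant_measures k"
  shows "left_shift \<in> measurable \<mu> \<mu>"
  using left_shift_measurable_restrict[of k] invariant_measuresD(2)[OF assms]
  by (simp cong: measurable_cong_sets)

lemma continuous_on_full_shift_measurable:
  assumes "\<mu> \<in> invariant_measures k" "continuous_on (full_shift k) (g :: _ \<Rightarrow> real)"
  shows "g \<in> borel_measurable \<mu>"
  using borel_measurable_continuous_on_restrict[OF assms(2)] invariant_measuresD(2)[OF assms(1)]
  by (simp cong: measurable_cong_sets)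

lemma continuous_on_full_shift_bounded:
  assumes "continuous_on (full_shift k) (g :: _ \<Rightarrow> real)"
  shows "\<exists>B. \<forall>\<omega>\<in>full_shift k. \<bar>g \<omega>\<bar> \<le> B"
proof -
  have "bounded (g ` full_shift k)"
    using compact_continuous_image[OF assms compact_full_shift] compact_imp_bounded by blast
  then show ?thesis by (auto simp: bounded_iff)
qed

lemma open_Int_full_shift_sets:
  assumes "\<mu> \<in> invariant_measures k" "open U"
  shows "U \<inter> full_shift k \<in> sets \<mu>"
  using assms by (auto simp: invariant_measuresD(2)[OF assms(1)] sets_restrict_space)

lemma invariant_emeasure_vimage:
  assumes m: "\<mu> \<in> invariant_measures k" and U: "open U"
  shows "emeasure \<mu> (left_shift -` U \<inter> full_shift k) = emeasure \<mu> (U \<inter> full_shift k)"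
proof -
  have "emeasure (distr \<mu> \<mu> left_shift) (U \<inter> full_shift k)
      = emeasure \<mu> (left_shift -` (U \<inter> full_shift k) \<inter> space \<mu>)"
    by (rule emeasure_distr[OF left_shift_measurable[OF m] open_Int_full_shift_sets[OF m U]])
  also have "left_shift -` (U \<inter> full_shift k) \<inter> space \<mu> = left_shift -` U \<inter> full_shift k"
    by (auto simp: invariant_measuresD(4)[OF m] intro: shift_full_shift)
  finally show ?thesis by (simp add: invariant_measuresD(3)[OF m])
qed

lemma support_iff:
  assumes "\<mu> \<in> invariant_measures k"
  shows "\<omega> \<in> measure_support \<mu> \<longleftrightarrow>
    \<omega> \<in> full_shift k \<and> (\<forall>U. open U \<longrightarrow> \<omega> \<in> U \<longrightarrow> emeasure \<mu> (U \<inter> full_shift k) > 0)"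
  by (auto simp: measure_support_def invariant_measuresD(4)[OF assms])

lemma left_shift_support:
  assumes m: "\<mu> \<in> invariant_measures k" and \<omega>: "\<omega> \<in> measure_support \<mu>"
  shows "left_shift \<omega> \<in> measure_support \<mu>"
  unfolding support_iff[OF m]
proof (intro conjI allI impI)
  fix U :: "(int \<Rightarrow> nat) set" assume U: "open U" "left_shift \<omega> \<in> U"
  have "open (left_shift -` U)" using open_vimage[OF U(1) continuous_on_left_shift] .
  then have "emeasure \<mu> (left_shift -` U \<inter> full_shift k) > 0"
    using \<omega> U(2) by (simp add: support_iff[OF m])
  then show "emeasure \<mu> (U \<inter> full_shift k) > 0" by (simp add: invariant_emeasure_vimage[OF m U(1)])
qed (use \<omega> in \<open>simp add: support_iff[OF m] shift_full_shift\<close>)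

lemma right_shift_support:
  assumes m: "\<mu> \<in> invariant_measures k" and \<omega>: "\<omega> \<in> measure_support \<mu>"
  shows "right_shift \<omega> \<in> measure_support \<mu>"
  unfolding support_iff[OF m]
proof (intro conjI allI impI)
  fix U :: "(int \<Rightarrow> nat) set" assume U: "open U" "right_shift \<omega> \<in> U"
  have o: "open (right_shift -` U)" using open_vimage[OF U(1) continuous_on_right_shift] .
  then have "emeasure \<mu> (right_shift -` U \<inter> full_shift k) > 0"
    using \<omega> U(2) by (simp add: support_iff[OF m])
  then show "emeasure \<mu> (U \<inter> full_shift k) > 0"
    using invariant_emeasure_vimage[OF m o] by (simp add: vimage_def)
qed (use \<omega> in \<open>simp add: support_iff[OF m] shift_full_shift\<close>)

lemma AE_eq_0_on_support:
  assumes m: "\<mu> \<in> invariant_measures k" and g: "continuous_on (full_shift k) (g :: _ \<Rightarrow> real)"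
    and ae: "AE \<omega> in \<mu>. g \<omega> = 0" and \<omega>: "\<omega> \<in> measure_support \<mu>"
  shows "g \<omega> = 0"
proof (rule ccontr)
  assume "g \<omega> \<noteq> 0"
  have "\<omega> \<in> full_shift k" using \<omega> by (simp add: support_iff[OF m])
  obtain U where U: "open U" "U \<inter> full_shift k = g -` (- {0}) \<inter> full_shift k"
    using continuous_on_open_invariant[THEN iffD1, OF g, rule_format, of "- {0}"] by auto
  have "\<omega> \<in> U" using U(2) \<open>\<omega> \<in> full_shift k\<close> \<open>g \<omega> \<noteq> 0\<close> by auto
  then have "emeasure \<mu> (U \<inter> full_shift k) > 0"
    using \<omega> U(1) unfolding support_iff[OF m] by blast
  moreover have "emeasure \<mu> (U \<inter> full_shift k) = 0"
  proof -
    have "AE \<omega> in \<mu>. \<omega> \<notin> U \<inter> full_shift k" using ae by eventually_elim (use U in auto)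
    then show ?thesis
      using AE_iff_measurable[OF open_Int_full_shift_sets[OF m U(1)], of "\<lambda>\<omega>. \<omega> \<notin> U \<inter> full_shift k"]
      by (auto simp: invariant_measuresD(4)[OF m])
  qed
  ultimately show False by simp
qed

text \<open>
  These measures test the optimal exponent on a given word: the word is repeated periodically and
  the orbit is given equal weights.
\<close>

lemma periodic_invariant_measure:
  assumes \<omega>: "\<omega> \<in> full_shift k" and n: "0 < n" and per: "(left_shift ^^ n) \<omega> = \<omega>"
  obtains \<mu> where "\<mu> \<in> invariant_measures k"
    "\<And>g. continuous_on (full_shift k) (g :: _ \<Rightarrow> real) \<Longrightarrow> (LINT \<tau>|\<mu>. g \<tau>) = orbit_sum left_shift g n \<omega> / real n"
proof -
  define N where "N = restrict_space borel (full_shift k)"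
  define p where "p = pmf_of_set {..<n}"
  define orb where "orb = (\<lambda>i. (left_shift ^^ i) \<omega>)"
  define \<mu> where "\<mu> = distr (measure_pmf p) N orb"
  have ne: "{..<n} \<noteq> {}" using n by auto
  have orb [measurable]: "orb \<in> measurable (measure_pmf p) N"
    using funpow_full_shift[OF \<omega>] by (simp add: N_def orb_def space_restrict_space)
  have orb_space: "orb \<in> UNIV \<rightarrow> space N"
    using funpow_full_shift[OF \<omega>] by (auto simp: N_def orb_def space_restrict_space)
  have T [measurable]: "left_shift \<in> measurable N N"
    unfolding N_def by (rule left_shift_measurable_restrict)
  define c where "c = (\<lambda>i. if Suc i = n then 0 else Suc i)"
  have "bij_betw c {..<n} {..<n}"
    by (rule bij_betw_byWitness[where f' = "\<lambda>i. if i = 0 then n - 1 else i - 1"])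
      (use n in \<open>auto simp: c_def\<close>)
  then have c: "map_pmf c p = p"
    unfolding p_def using map_pmf_of_set_bij_betw[of c "{..<n}" "{..<n}"] ne by auto
  have orb_c: "left_shift \<circ> orb = orb \<circ> c"
  proof
    fix i
    have "left_shift (orb i) = (left_shift ^^ Suc i) \<omega>" by (simp add: orb_def)
    also have "\<dots> = orb (c i)"
    proof (cases "Suc i = n")
      case True
      then have "orb (c i) = \<omega>" by (simp add: c_def orb_def)
      then show ?thesis unfolding True using per by simp
    next
      case False
      then show ?thesis by (simp add: c_def orb_def)
    qed
    finally show "(left_shift \<circ> orb) i = (orb \<circ> c) i" by simp
  qed
  have "distr \<mu> \<mu> left_shift = distr \<mu> N left_shift" by (rule distr_cong) (simp_all add: \<mu>_def)
  also have "\<dots> = distr (measure_pmf p) N (orb \<circ> c)"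
    unfolding \<mu>_def by (subst distr_distr) (simp_all add: orb_c orb_space)
  also have "\<dots> = distr (measure_pmf (map_pmf c p)) N orb"
    unfolding map_pmf_rep_eq
    by (rule distr_distr[symmetric]) (simp_all only: measurable_count_space_eq1 orb_space, simp)
  also have "\<dots> = \<mu>" by (simp add: c \<mu>_def)
  finally have "distr \<mu> \<mu> left_shift = \<mu>" .
  moreover have "prob_space \<mu>" unfolding \<mu>_def by (rule measure_pmf.prob_space_distr) (rule orb)
  ultimately have inv: "\<mu> \<in> invariant_measures k" by (simp add: invariant_measures_def \<mu>_def N_def)
  have int: "(LINT \<tau>|\<mu>. g \<tau>) = orbit_sum left_shift g n \<omega> / real n"
    if "continuous_on (full_shift k) (g :: _ \<Rightarrow> real)" for g
  proof -
    have "g \<in> borel_measurable N" unfolding N_def by (rule borel_measurable_continuous_on_restrict[OF that])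
    then have "(LINT \<tau>|\<mu>. g \<tau>) = (LINT i|measure_pmf p. g (orb i))"
      unfolding \<mu>_def by (rule integral_distr[OF orb])
    also have "\<dots> = (\<Sum>i<n. g (orb i)) / real n"
      unfolding p_def using integral_pmf_of_set[OF ne] by simp
    finally show ?thesis by (simp add: orbit_sum_def orb_def)
  qed
  show thesis by (rule that[OF inv]) (rule int)
qed

text \<open>
  A mixture with positive weights: null sets are the sets null for all components, so its support
  contains theirs.
\<close>

lemma invariant_measure_mixture:
  assumes m: "\<And>n::nat. \<mu> n \<in> invariant_measures k"
  shows "\<exists>\<nu>\<in>invariant_measures k.
    (\<forall>g. continuous_on (full_shift k) (g :: _ \<Rightarrow> real) \<longrightarrow> (\<forall>n. AE \<omega> in \<mu> n. g \<omega> = 0) \<longrightarrow> (AE \<omega> in \<nu>. g \<omega> = 0)) \<and>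
    (\<forall>U n. open U \<longrightarrow> emeasure (\<mu> n) (U \<inter> full_shift k) > 0 \<longrightarrow> emeasure \<nu> (U \<inter> full_shift k) > 0)"
proof -
  define N where "N = restrict_space borel (full_shift k)"
  define p :: "nat pmf" where "p = geometric_pmf (1/2)"
  define \<nu> where "\<nu> = measure_pmf p \<bind> \<mu>"
  have p: "set_pmf p = UNIV" unfolding p_def by (rule set_pmf_geometric) auto
  have sets: "sets (\<mu> n) = sets N" for n using invariant_measuresD(2)[OF m] by (simp add: N_def)
  have meas: "\<mu> \<in> measurable (measure_pmf p) (subprob_algebra N)"
    using sets invariant_measuresD(1)[OF m] by (simp add: space_subprob_algebra prob_space_imp_subprob_space)
  have sets_\<nu>: "sets \<nu> = sets N" unfolding \<nu>_def by (rule sets_bind) (simp_all add: sets)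
  have em: "emeasure \<nu> X = (\<integral>\<^sup>+n. emeasure (\<mu> n) X \<partial>measure_pmf p)" if "X \<in> sets N" for X
    unfolding \<nu>_def by (rule emeasure_bind[OF _ meas that]) simp
  have T: "left_shift \<in> measurable N N" unfolding N_def by (rule left_shift_measurable_restrict)
  have T': "left_shift \<in> measurable \<nu> \<nu>" using T by (simp cong: measurable_cong_sets add: sets_\<nu>)
  have spaces: "space \<nu> = space N" "space (\<mu> n) = space N" for n
    using sets_eq_imp_space_eq sets_\<nu> sets by blast+
  have "distr \<nu> \<nu> left_shift = \<nu>"
  proof (rule measure_eqI)
    fix X assume "X \<in> sets (distr \<nu> \<nu> left_shift)"
    then have X: "X \<in> sets N" by (simp add: sets_\<nu>)
    have pre: "left_shift -` X \<inter> space N \<in> sets N" using measurable_sets[OF T X] .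
    have "emeasure (distr \<nu> \<nu> left_shift) X = emeasure \<nu> (left_shift -` X \<inter> space N)"
      using emeasure_distr[OF T', of X] X by (simp add: sets_\<nu> spaces)
    also have "\<dots> = (\<integral>\<^sup>+n. emeasure (\<mu> n) (left_shift -` X \<inter> space N) \<partial>measure_pmf p)"
      by (rule em[OF pre])
    also have "\<dots> = (\<integral>\<^sup>+n. emeasure (\<mu> n) X \<partial>measure_pmf p)"
    proof (rule nn_integral_cong)
      fix n
      have "emeasure (distr (\<mu> n) (\<mu> n) left_shift) X = emeasure (\<mu> n) (left_shift -` X \<inter> space N)"
        using emeasure_distr[OF left_shift_measurable[OF m], of X n] X by (simp add: sets spaces)
      then show "emeasure (\<mu> n) (left_shift -` X \<inter> space N) = emeasure (\<mu> n) X"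
        by (simp add: invariant_measuresD(3)[OF m])
    qed
    also have "\<dots> = emeasure \<nu> X" by (rule em[OF X, symmetric])
    finally show "emeasure (distr \<nu> \<nu> left_shift) X = emeasure \<nu> X" .
  qed simp
  moreover have "prob_space \<nu>" unfolding \<nu>_def
    by (rule measure_pmf.prob_space_bind[OF _ meas]) (simp add: invariant_measuresD(1)[OF m])
  ultimately have inv: "\<nu> \<in> invariant_measures k"
    using sets_\<nu> by (simp add: invariant_measures_def N_def)
  have ae_\<nu>: "AE \<omega> in \<nu>. g \<omega> = 0"
    if g: "continuous_on (full_shift k) (g :: _ \<Rightarrow> real)" and ae: "\<And>n. AE \<omega> in \<mu> n. g \<omega> = 0" for g
  proof -
    have [measurable]: "g \<in> borel_measurable N"
      unfolding N_def by (rule borel_measurable_continuous_on_restrict[OF g])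
    have "Measurable.pred N (\<lambda>\<omega>. g \<omega> = 0)" by measurable
    then show ?thesis unfolding \<nu>_def using AE_bind[OF meas] ae by simp
  qed
  have pos_\<nu>: "emeasure \<nu> (U \<inter> full_shift k) > 0"
    if "open U" and pos: "emeasure (\<mu> n) (U \<inter> full_shift k) > 0" for U n
  proof (rule ccontr)
    have U: "U \<inter> full_shift k \<in> sets N"
      using open_Int_full_shift_sets[OF m \<open>open U\<close>] by (simp add: sets)
    assume "\<not> emeasure \<nu> (U \<inter> full_shift k) > 0"
    then have "(\<integral>\<^sup>+n. emeasure (\<mu> n) (U \<inter> full_shift k) \<partial>measure_pmf p) = 0" using em[OF U] by simp
    then have "AE n in measure_pmf p. emeasure (\<mu> n) (U \<inter> full_shift k) = 0"
      by (subst (asm) nn_integral_0_iff_AE) auto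
    then show False using pos p by (auto simp: AE_measure_pmf_iff)
  qed
  show ?thesis
  proof (intro bexI[of _ \<nu>] conjI allI impI inv)
    show "AE \<omega> in \<nu>. g \<omega> = 0"
      if "continuous_on (full_shift k) (g :: _ \<Rightarrow> real)" "\<forall>n. AE \<omega> in \<mu> n. g \<omega> = 0" for g
      using that(2) by (intro ae_\<nu>[OF that(1)]) blast
    show "emeasure \<nu> (U \<inter> full_shift k) > 0"
      if "open U" "emeasure (\<mu> n) (U \<inter> full_shift k) > 0" for U n
      using that by (rule pos_\<nu>)
  qed
qed

section \<open>Lyapunov exponents and optimal measures\<close>

lemma closed_full_shift: "closed (full_shift k)"
  unfolding closed_def
proof (subst open_subopen, intro ballI)
  fix \<omega> assume "\<omega> \<in> - full_shift k"
  then obtain i where i: "\<omega> i \<notin> {1..k}" by (auto simp: full_shift_def)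
  have "\<tau> \<notin> full_shift k" if "\<tau> \<in> cylinder \<omega> (nat \<bar>i\<bar>)" for \<tau>
  proof -
    have "i \<in> {- int (nat \<bar>i\<bar>)..int (nat \<bar>i\<bar>)}" by auto
    then have "\<tau> i = \<omega> i" using that unfolding cylinder_def by blast
    then have "\<tau> i \<notin> {1..k}" using i by simp
    then show ?thesis unfolding full_shift_def by blast
  qed
  then show "\<exists>T. open T \<and> \<omega> \<in> T \<and> T \<subseteq> - full_shift k"
    using open_cylinder in_cylinder_self by (intro exI[of _ "cylinder \<omega> (nat \<bar>i\<bar>)"]) blast
qed

definition past :: "(int \<Rightarrow> nat) \<Rightarrow> nat \<Rightarrow> nat" where
  "past \<omega> = (\<lambda>n. \<omega> (- 1 - int n))"

definition future :: "(int \<Rightarrow> nat) \<Rightarrow> nat \<Rightarrow> nat" where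
  "future \<omega> = (\<lambda>n. \<omega> (int n))"

lemma past_left_shift: "past (left_shift \<omega>) = case_nat (\<omega> 0) (past \<omega>)"
  by (rule ext) (simp add: past_def left_shift_def split: nat.split)

lemma range_past: "\<omega> \<in> full_shift k \<Longrightarrow> range (past \<omega>) \<subseteq> {1..k}"
  by (auto simp: past_def full_shift_def)

lemma range_future: "\<omega> \<in> full_shift k \<Longrightarrow> range (future \<omega>) \<subseteq> {1..k}"
  by (auto simp: future_def full_shift_def)

lemma cocycle_prod_word_prod: "cocycle_prod A n \<omega> = word_prod A (rev (map (future \<omega>) [0..<n]))"
  by (induction n) (simp_all add: future_def)

lemma (in prob_space) abs_integral_le_const:
  fixes f :: "'a \<Rightarrow> real"
  assumes "integrable M f" "\<And>x. x \<in> space M \<Longrightarrow> \<bar>f x\<bar> \<le> c"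
  shows "\<bar>LINT x|M. f x\<bar> \<le> c"
proof -
  have "f x \<le> c" "- c \<le> f x" if "x \<in> space M" for x using assms(2)[OF that] by (simp_all add: abs_le_iff)
  then have "(LINT x|M. f x) \<le> c" "- c \<le> (LINT x|M. f x)"
    using assms(1) by (auto intro!: integral_le_const integral_ge_const)
  then show ?thesis by (simp add: abs_le_iff)
qed

context cone_system
begin

definition unstable :: "(int \<Rightarrow> nat) \<Rightarrow> real^2" where
  "unstable \<omega> = limit_direction (past \<omega>)"

definition log_growth :: "(int \<Rightarrow> nat) \<Rightarrow> real" where
  "log_growth \<omega> = ln (norm (A (\<omega> 0) *v unstable \<omega>))"

lemma unstable: "\<omega> \<in> full_shift k \<Longrightarrow> unstable \<omega> \<in> M" "\<omega> \<in> full_shift k \<Longrightarrow> norm (unstable \<omega>) = 1"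
  unfolding unstable_def by (rule limit_direction_M norm_limit_direction, erule range_past)+

lemma letters: "\<omega> \<in> full_shift k \<Longrightarrow> \<omega> i \<in> {1..k}"
  by (simp add: full_shift_def)

lemma letters_word: "\<omega> \<in> full_shift k \<Longrightarrow> set (rev (map (future \<omega>) [0..<n])) \<subseteq> {1..k}"
  using range_future by fastforce

lemma unstable_step:
  assumes "\<omega> \<in> full_shift k"
  obtains c where "A (\<omega> 0) *v unstable \<omega> = c *\<^sub>R unstable (left_shift \<omega>)" "c \<noteq> 0" "ln \<bar>c\<bar> = log_growth \<omega>"
proof -
  obtain c where c: "A (\<omega> 0) *v unstable \<omega> = c *\<^sub>R unstable (left_shift \<omega>)" "c \<noteq> 0"
    unfolding unstable_def past_left_shift
    by (rule limit_direction_Cons[OF letters[OF assms, of 0] range_past[OF assms]])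
  have "ln \<bar>c\<bar> = log_growth \<omega>"
    unfolding log_growth_def c(1) using unstable(2)[OF shift_full_shift(1)[OF assms]] by simp
  with c show thesis by (rule that)
qed

lemma cocycle_unstable:
  assumes "\<omega> \<in> full_shift k"
  shows "\<exists>c. cocycle_prod A n \<omega> *v unstable \<omega> = c *\<^sub>R unstable ((left_shift ^^ n) \<omega>) \<and> c \<noteq> 0 \<and>
    ln \<bar>c\<bar> = orbit_sum left_shift log_growth n \<omega>"
proof (induction n)
  case 0
  show ?case by (rule exI[of _ 1]) (simp add: orbit_sum_def)
next
  case (Suc n)
  then obtain c where c: "cocycle_prod A n \<omega> *v unstable \<omega> = c *\<^sub>R unstable ((left_shift ^^ n) \<omega>)"
    "c \<noteq> 0" "ln \<bar>c\<bar> = orbit_sum left_shift log_growth n \<omega>" by blast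
  have T: "(left_shift ^^ n) \<omega> \<in> full_shift k" by (rule funpow_full_shift[OF assms])
  obtain d where d: "A (((left_shift ^^ n) \<omega>) 0) *v unstable ((left_shift ^^ n) \<omega>)
      = d *\<^sub>R unstable (left_shift ((left_shift ^^ n) \<omega>))" "d \<noteq> 0" "ln \<bar>d\<bar> = log_growth ((left_shift ^^ n) \<omega>)"
    by (rule unstable_step[OF T])
  have "cocycle_prod A (Suc n) \<omega> *v unstable \<omega> = A (\<omega> (int n)) *v (cocycle_prod A n \<omega> *v unstable \<omega>)"
    by (simp add: matrix_vector_mul_assoc)
  also have "\<dots> = (c * d) *\<^sub>R unstable ((left_shift ^^ Suc n) \<omega>)"
    using d(1) by (simp add: c(1) matrix_scaled_vector left_shift_funpow)
  finally have "cocycle_prod A (Suc n) \<omega> *v unstable \<omega> = (c * d) *\<^sub>R unstable ((left_shift ^^ Suc n) \<omega>)" .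
  moreover have "ln \<bar>c * d\<bar> = orbit_sum left_shift log_growth (Suc n) \<omega>"
    using c d by (simp add: abs_mult ln_mult orbit_sum_def)
  ultimately show ?case using c(2) d(2) by (intro exI[of _ "c * d"]) simp
qed

lemma ln_norm_cocycle:
  assumes "\<omega> \<in> full_shift k"
  shows "ln (norm (cocycle_prod A n \<omega> *v unstable \<omega>)) = orbit_sum left_shift log_growth n \<omega>"
  using cocycle_unstable[OF assms, of n] unstable(2)[OF funpow_full_shift[OF assms, of n]] by auto

lemma ln_onorm_cocycle:
  assumes \<omega>: "\<omega> \<in> full_shift k"
  shows "\<bar>ln (onorm ((*v) (cocycle_prod A n \<omega>))) - orbit_sum left_shift log_growth n \<omega>\<bar> \<le> ln distortion"
proof -
  let ?W = "cocycle_prod A n \<omega>" and ?u = "unstable \<omega>"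
  note w = letters_word[OF \<omega>, of n]
  have pos: "0 < norm (?W *v ?u)"
    unfolding cocycle_prod_word_prod by (rule norm_word_prod_pos[OF w unstable(1)[OF \<omega>]])
  have "onorm ((*v) ?W) \<le> distortion * norm (?W *v ?u)"
  proof (rule onorm_bound)
    show "norm (?W *v z) \<le> distortion * norm (?W *v ?u) * norm z" for z
      unfolding cocycle_prod_word_prod by (rule norm_word_prod_le_unit[OF w unstable[OF \<omega>]])
  qed (use distortion_ge_1 in simp)
  moreover have "norm (?W *v ?u) \<le> onorm ((*v) ?W) * norm ?u"
    by (rule onorm) (rule matrix_vector_mul_bounded_linear)
  ultimately have b: "norm (?W *v ?u) \<le> onorm ((*v) ?W)" "onorm ((*v) ?W) \<le> distortion * norm (?W *v ?u)"
    using unstable(2)[OF \<omega>] by simp_all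
  have "ln (norm (?W *v ?u)) \<le> ln (onorm ((*v) ?W))" by (rule ln_mono[OF b(1) pos])
  moreover have "ln (onorm ((*v) ?W)) \<le> ln (distortion * norm (?W *v ?u))"
    by (rule ln_mono[OF b(2) order_less_le_trans[OF pos b(1)]])
  moreover have "ln (distortion * norm (?W *v ?u)) = ln distortion + ln (norm (?W *v ?u))"
    using pos distortion_ge_1 by (intro ln_mult_pos) auto
  ultimately show ?thesis unfolding ln_norm_cocycle[OF \<omega>] by (simp add: abs_le_iff)
qed

text \<open>
  The limit directions of two points that share \<open>N\<close> past letters are exponentially close in \<open>N\<close>.
  The hypothesis forces \<open>\<phi> i\<close> to ignore the sign of the unit vector, which is chosen arbitrarily.
\<close>

lemma continuous_on_unstable:
  assumes lip: "\<And>i u v. i \<in> {1..k} \<Longrightarrow> u \<in> M \<Longrightarrow> norm u = 1 \<Longrightarrow> v \<in> M \<Longrightarrow> norm v = 1 \<Longrightarrow>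
    \<phi> i u \<le> \<phi> i v + distortion * line_dist u v"
  shows "continuous_on (full_shift k) (\<lambda>\<omega>. \<phi> (\<omega> 0) (unstable \<omega>))"
proof (rule continuous_on_full_shift)
  fix \<omega> and e :: real assume \<omega>: "\<omega> \<in> full_shift k" and e: "0 < e"
  have "(\<lambda>n. 2 * distortion\<^sup>2 * contraction ^ n) \<longlonglongrightarrow> 2 * distortion\<^sup>2 * 0"
    using contraction_pos contraction_less_1 by (intro tendsto_mult tendsto_const LIMSEQ_realpow_zero) auto
  then have "eventually (\<lambda>n. 2 * distortion\<^sup>2 * contraction ^ n < e) sequentially"
    using e by (intro order_tendstoD) auto
  then obtain N where N: "2 * distortion\<^sup>2 * contraction ^ N < e" by (auto simp: eventually_sequentially)
  have "\<bar>\<phi> (\<tau> 0) (unstable \<tau>) - \<phi> (\<omega> 0) (unstable \<omega>)\<bar> < e" if \<tau>: "\<tau> \<in> full_shift k" "\<tau> \<in> cylinder \<omega> N" for \<tau>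
  proof -
    have agree: "past \<tau> i = past \<omega> i" if "i < N" for i
      using \<tau>(2) that by (auto simp: cylinder_def past_def)
    have 0: "\<tau> 0 = \<omega> 0" using \<tau>(2) by (simp add: cylinder_def)
    have "line_dist (unstable \<tau>) (unstable \<omega>) \<le> 2 * distortion * contraction ^ N"
      unfolding unstable_def by (rule limit_direction_line_dist[OF range_past[OF \<tau>(1)] range_past[OF \<omega>] agree])
    then have "distortion * line_dist (unstable \<tau>) (unstable \<omega>) \<le> distortion * (2 * distortion * contraction ^ N)"
      using distortion_ge_1 by (intro mult_left_mono) auto
    then have d: "distortion * line_dist (unstable \<tau>) (unstable \<omega>) < e"
      using N by (simp add: power2_eq_square mult_ac)
    show ?thesis
      using d lip[OF letters[OF \<omega>, of 0] unstable[OF \<tau>(1)] unstable[OF \<omega>]]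
        lip[OF letters[OF \<omega>, of 0] unstable[OF \<omega>] unstable[OF \<tau>(1)]]
      by (simp add: 0 line_dist_commute abs_less_iff)
  qed
  then show "\<exists>N. \<forall>\<tau>\<in>full_shift k \<inter> cylinder \<omega> N. \<bar>\<phi> (\<tau> 0) (unstable \<tau>) - \<phi> (\<omega> 0) (unstable \<omega>)\<bar> < e"
    by blast
qed

lemma continuous_on_log_growth: "continuous_on (full_shift k) log_growth"
proof -
  have lip: "ln (norm (A i *v u)) \<le> ln (norm (A i *v v)) + distortion * line_dist u v"
    if "i \<in> {1..k}" "u \<in> M" "norm u = 1" "v \<in> M" "norm v = 1" for i u v
    using ln_norm_word_prod_lipschitz[of "[i]" u v] that by (simp add: matrix_mul_rid)
  show ?thesis unfolding log_growth_def[abs_def]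
    by (rule continuous_on_unstable[where \<phi> = "\<lambda>i u. ln (norm (A i *v u))"]) (rule lip)
qed

lemma continuous_on_barabanov:
  assumes "growth_bounded s \<beta>" "s \<in> {1, -1}"
  shows "continuous_on (full_shift k) (\<lambda>\<omega>. barabanov s \<beta> (unstable \<omega>))"
  by (rule continuous_on_unstable) (rule barabanov_lipschitz[OF assms])

lemma continuous_on_ln_onorm:
  "continuous_on (full_shift k) (\<lambda>\<omega>. ln (onorm ((*v) (cocycle_prod A n \<omega>))) / real n)"
proof (rule continuous_on_full_shift)
  fix \<omega> and e :: real assume "\<omega> \<in> full_shift k" "0 < e"
  have "cocycle_prod A m \<tau> = cocycle_prod A m \<omega>" if "\<tau> \<in> cylinder \<omega> n" "m \<le> n" for \<tau> m
    using that(2) by (induction m) (use that(1) in \<open>auto simp: cylinder_def\<close>)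
  then show "\<exists>N. \<forall>\<tau>\<in>full_shift k \<inter> cylinder \<omega> N.
     \<bar>ln (onorm ((*v) (cocycle_prod A n \<tau>))) / real n - ln (onorm ((*v) (cocycle_prod A n \<omega>))) / real n\<bar> < e"
    using \<open>0 < e\<close> by (intro exI[of _ n]) auto
qed

lemma log_growth_bounded_observable:
  assumes m: "\<mu> \<in> invariant_measures k"
  obtains B where "bounded_observable \<mu> left_shift log_growth B"
proof -
  obtain B where B: "\<And>\<omega>. \<omega> \<in> full_shift k \<Longrightarrow> \<bar>log_growth \<omega>\<bar> \<le> B"
    using continuous_on_full_shift_bounded[OF continuous_on_log_growth] by blast
  interpret prob_space \<mu> by (rule invariant_measuresD(1)[OF m])
  have "bounded_observable \<mu> left_shift log_growth B"
  proof
    show "left_shift \<in> measurable \<mu> \<mu>" by (rule left_shift_measurable[OF m])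
    show "distr \<mu> \<mu> left_shift = \<mu>" by (rule invariant_measuresD(3)[OF m])
    show "log_growth \<in> borel_measurable \<mu>"
      by (rule continuous_on_full_shift_measurable[OF m continuous_on_log_growth])
    show "\<bar>log_growth \<omega>\<bar> \<le> B" if "\<omega> \<in> space \<mu>" for \<omega>
      using that B by (simp add: invariant_measuresD(4)[OF m])
  qed
  then show thesis by (rule that)
qed

text \<open>
  The norm of the products and the growth along the limit directions differ by a bounded factor, so
  the Lyapunov exponent is a Birkhoff average of a continuous function.
\<close>

lemma lyap_measure_eq_integral:
  assumes m: "\<mu> \<in> invariant_measures k"
  shows "lyap_measure A \<mu> = (LINT \<omega>|\<mu>. log_growth \<omega>)"
proof -
  obtain B where B: "bounded_observable \<mu> left_shift log_growth B"
    by (rule log_growth_bounded_observable[OF m])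
  interpret bounded_observable \<mu> left_shift log_growth B by (rule B)
  note sp = invariant_measuresD(4)[OF m]
  define S where "S = (\<lambda>n \<omega>. ln (onorm ((*v) (cocycle_prod A n \<omega>))) / real n)"
  define l where "l = ln distortion"
  have l: "0 \<le> l" using distortion_ge_1 by (simp add: l_def)
  have S_meas [measurable]: "S n \<in> borel_measurable \<mu>" for n
    unfolding S_def by (rule continuous_on_full_shift_measurable[OF m continuous_on_ln_onorm])
  have lyap: "lyap_point A = (\<lambda>\<omega>. lim (\<lambda>n. S n \<omega>))" by (rule ext) (simp add: lyap_point_def S_def)
  have lyap_meas [measurable]: "lyap_point A \<in> borel_measurable \<mu>" unfolding lyap by measurable
  have close: "\<bar>S n \<omega> - orbit_sum left_shift log_growth n \<omega> / real n\<bar> \<le> l / real n"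
    if "\<omega> \<in> space \<mu>" for n \<omega>
    using ln_onorm_cocycle[of \<omega> n] that
    by (simp add: S_def sp l_def diff_divide_distrib[symmetric] abs_divide divide_right_mono)
  have l0: "(\<lambda>n. l / real n) \<longlonglongrightarrow> 0" by (rule lim_const_over_n)
  have conv: "AE \<omega> in \<mu>. (\<lambda>n. S n \<omega>) \<longlonglongrightarrow> lyap_point A \<omega>"
    using averages_converge
  proof (rule AE_mp, intro AE_I2 impI)
    fix \<omega> assume \<omega>: "\<omega> \<in> space \<mu>" and c: "convergent (\<lambda>n. orbit_sum left_shift log_growth n \<omega> / real n)"
    have "(\<lambda>n. S n \<omega> - orbit_sum left_shift log_growth n \<omega> / real n) \<longlonglongrightarrow> 0"
      by (rule Lim_null_comparison[OF _ l0]) (use close[OF \<omega>] in auto)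
    then have "convergent (\<lambda>n. (S n \<omega> - orbit_sum left_shift log_growth n \<omega> / real n)
        + orbit_sum left_shift log_growth n \<omega> / real n)"
      by (intro convergent_add[OF convergentI c])
    then show "(\<lambda>n. S n \<omega>) \<longlonglongrightarrow> lyap_point A \<omega>" by (simp add: lyap convergent_LIMSEQ_iff)
  qed
  have bd: "\<bar>S n \<omega>\<bar> \<le> B + l" if "\<omega> \<in> space \<mu>" for n \<omega>
  proof -
    have "l / real n \<le> l"
      using l mult_left_mono[of 1 "real n" l] by (cases "n = 0") (simp_all add: pos_divide_le_eq)
    then show ?thesis using close[OF that, of n] average_bounded[OF that, of n] by linarith
  qed
  have int_S: "integrable \<mu> (S n)" for n
    by (rule integrable_const_bound[of _ "B + l"]) (use bd in auto)
  have "(\<lambda>n. LINT \<omega>|\<mu>. S n \<omega>) \<longlonglongrightarrow> (LINT \<omega>|\<mu>. lyap_point A \<omega>)"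
  proof (rule integral_dominated_convergence[where w = "\<lambda>_. B + l"])
    show "AE \<omega> in \<mu>. norm (S n \<omega>) \<le> B + l" for n using bd by (intro AE_I2) simp
  qed (use conv in auto)
  moreover have "(\<lambda>n. LINT \<omega>|\<mu>. S n \<omega>) \<longlonglongrightarrow> (LINT \<omega>|\<mu>. log_growth \<omega>)"
  proof -
    have "\<bar>(LINT \<omega>|\<mu>. S n \<omega>) - (LINT \<omega>|\<mu>. log_growth \<omega>)\<bar> \<le> l / real n" if n: "n \<ge> 1" for n
    proof -
      have i2: "integrable \<mu> (\<lambda>\<omega>. orbit_sum left_shift log_growth n \<omega> / real n)"
        by (rule integrable_const_bound[of _ B]) (use average_bounded in auto)
      have "(LINT \<omega>|\<mu>. log_growth \<omega>) = (LINT \<omega>|\<mu>. orbit_sum left_shift log_growth n \<omega> / real n)"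
        using integral_orbit_sum[of n] n by simp
      then have eq: "(LINT \<omega>|\<mu>. S n \<omega>) - (LINT \<omega>|\<mu>. log_growth \<omega>)
          = (LINT \<omega>|\<mu>. S n \<omega> - orbit_sum left_shift log_growth n \<omega> / real n)"
        by (simp only: Bochner_Integration.integral_diff[OF int_S i2])
      show ?thesis unfolding eq
        by (rule abs_integral_le_const[OF Bochner_Integration.integrable_diff[OF int_S i2] close])
    qed
    then have "(\<lambda>n. (LINT \<omega>|\<mu>. S n \<omega>) - (LINT \<omega>|\<mu>. log_growth \<omega>)) \<longlonglongrightarrow> 0"
      by (intro Lim_null_comparison[OF _ l0]) (auto simp: eventually_sequentially)
    then show ?thesis by (simp add: LIM_zero_iff)
  qed
  ultimately show ?thesis unfolding lyap_measure_def by (rule LIMSEQ_unique)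
qed

definition optimal_exponent :: "real \<Rightarrow> real" where
  "optimal_exponent s = (SUP \<mu>\<in>invariant_measures k. s * (LINT \<omega>|\<mu>. log_growth \<omega>))"

lemma exponent_le_optimal:
  assumes m: "\<mu> \<in> invariant_measures k" and s: "s \<in> {1, -1}"
  shows "s * (LINT \<omega>|\<mu>. log_growth \<omega>) \<le> optimal_exponent s"
  unfolding optimal_exponent_def
proof (rule cSUP_upper[OF m])
  obtain B where B: "\<And>\<omega>. \<omega> \<in> full_shift k \<Longrightarrow> \<bar>log_growth \<omega>\<bar> \<le> B"
    using continuous_on_full_shift_bounded[OF continuous_on_log_growth] by blast
  have "s * (LINT \<omega>|\<nu>. log_growth \<omega>) \<le> B" if n: "\<nu> \<in> invariant_measures k" for \<nu>
  proof -
    interpret prob_space \<nu> by (rule invariant_measuresD(1)[OF n])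
    have i: "integrable \<nu> log_growth"
      by (rule integrable_const_bound[of _ B])
        (use B continuous_on_full_shift_measurable[OF n continuous_on_log_growth] in
          \<open>auto simp: invariant_measuresD(4)[OF n]\<close>)
    have "\<bar>LINT \<omega>|\<nu>. log_growth \<omega>\<bar> \<le> B"
      by (rule abs_integral_le_const[OF i]) (use B in \<open>simp add: invariant_measuresD(4)[OF n]\<close>)
    then show ?thesis using s by (auto simp: abs_le_iff)
  qed
  then show "bdd_above ((\<lambda>\<mu>. s * (LINT \<omega>|\<mu>. log_growth \<omega>)) ` invariant_measures k)"
    by (rule bdd_aboveI2)
qed

text \<open>Periodic orbits realise every word, and bounded distortion transfers the bound to all of the multicone.\<close>

lemma growth_bounded_optimal:
  assumes s: "s \<in> {1, -1}"
  shows "growth_bounded s (optimal_exponent s)"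
proof -
  have "s * ln (norm (word_prod A w *v u)) - optimal_exponent s * real (length w) \<le> 2 * distortion"
    if w: "set w \<subseteq> {1..k}" and u: "u \<in> M" "norm u = 1" for w u
  proof (cases "w = []")
    case True
    then show ?thesis using u distortion_ge_1 by simp
  next
    case False
    define n where "n = length w"
    have n: "0 < n" using False by (simp add: n_def)
    define \<omega> where "\<omega> = (\<lambda>i::int. rev w ! nat (i mod int n))"
    have idx: "nat (i mod int n) < length (rev w)" for i
      using n by (simp add: n_def[symmetric] nat_less_iff)
    have letter: "rev w ! nat (i mod int n) \<in> {1..k}" for i
    proof -
      have "rev w ! nat (i mod int n) \<in> set (rev w)" by (rule nth_mem[OF idx])
      then show ?thesis using w by auto
    qed
    have \<omega>: "\<omega> \<in> full_shift k"
      unfolding full_shift_def \<omega>_def using letter by blast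
    have per: "(left_shift ^^ n) \<omega> = \<omega>" by (rule ext) (simp add: left_shift_funpow \<omega>_def)
    have "map (future \<omega>) [0..<n] = rev w"
      by (rule nth_equalityI) (simp_all add: n_def future_def \<omega>_def)
    then have W: "cocycle_prod A n \<omega> = word_prod A w" by (simp add: cocycle_prod_word_prod)
    obtain \<mu> where m: "\<mu> \<in> invariant_measures k" and
      avg: "\<And>g. continuous_on (full_shift k) (g :: _ \<Rightarrow> real) \<Longrightarrow> (LINT \<tau>|\<mu>. g \<tau>) = orbit_sum left_shift g n \<omega> / real n"
      using periodic_invariant_measure[OF \<omega> n per] by metis
    have "s * (orbit_sum left_shift log_growth n \<omega> / real n) \<le> optimal_exponent s"
      using exponent_le_optimal[OF m s] avg[OF continuous_on_log_growth] by simp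
    then have le: "s * ln (norm (word_prod A w *v unstable \<omega>)) \<le> optimal_exponent s * real n"
      using n ln_norm_cocycle[OF \<omega>, of n] by (simp add: W pos_divide_le_eq)
    have "line_dist u (unstable \<omega>) \<le> 2"
      using norm_triangle_ineq4[of u "unstable \<omega>"] u(2) unstable(2)[OF \<omega>] by (simp add: line_dist_def)
    then have "distortion * line_dist u (unstable \<omega>) \<le> distortion * 2"
      using distortion_ge_1 by (intro mult_left_mono) auto
    then have "s * ln (norm (word_prod A w *v u)) \<le> s * ln (norm (word_prod A w *v unstable \<omega>)) + 2 * distortion"
      using s ln_norm_word_prod_lipschitz[OF w u unstable[OF \<omega>]]
        ln_norm_word_prod_lipschitz[OF w unstable[OF \<omega>] u] by (auto simp: line_dist_commute)
    then show ?thesis using le by (simp add: n_def)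
  qed
  then show ?thesis unfolding growth_bounded_def by blast
qed

definition potential :: "real \<Rightarrow> (int \<Rightarrow> nat) \<Rightarrow> real" where
  "potential s \<omega> = barabanov s (optimal_exponent s) (unstable \<omega>)"

text \<open>
  The defect at \<open>\<omega>\<close> in the inequality \<open>H (A\<^sub>i v) \<le> H v + \<beta>\<close> for the extremal function \<open>H\<close>,
  with \<open>v\<close> the limit direction of \<open>\<omega>\<close>. The potential enters as a coboundary, so the integral of the
  gap is what a measure lacks to be optimal.
\<close>

definition gap :: "real \<Rightarrow> (int \<Rightarrow> nat) \<Rightarrow> real" where
  "gap s \<omega> = optimal_exponent s + potential s \<omega> - s * log_growth \<omega> - potential s (left_shift \<omega>)"

lemma continuous_on_potential: "s \<in> {1, -1} \<Longrightarrow> continuous_on (full_shift k) (potential s)"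
  unfolding potential_def[abs_def] by (rule continuous_on_barabanov[OF growth_bounded_optimal])

lemma continuous_on_potential_shift:
  "s \<in> {1, -1} \<Longrightarrow> continuous_on (full_shift k) (\<lambda>\<omega>. potential s (left_shift \<omega>))"
  by (rule continuous_on_compose2[OF continuous_on_potential])
    (auto intro: shift_full_shift continuous_on_subset[OF continuous_on_left_shift])

lemma continuous_on_gap: "s \<in> {1, -1} \<Longrightarrow> continuous_on (full_shift k) (gap s)"
  unfolding gap_def[abs_def]
  by (intro continuous_intros continuous_on_potential continuous_on_potential_shift continuous_on_log_growth)

lemma gap_nonneg:
  assumes s: "s \<in> {1, -1}" and \<omega>: "\<omega> \<in> full_shift k"
  shows "gap s \<omega> \<ge> 0"
proof -
  let ?H = "barabanov s (optimal_exponent s)"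
  obtain c where c: "A (\<omega> 0) *v unstable \<omega> = c *\<^sub>R unstable (left_shift \<omega>)" "c \<noteq> 0" "ln \<bar>c\<bar> = log_growth \<omega>"
    by (rule unstable_step[OF \<omega>])
  have "?H (A (\<omega> 0) *v unstable \<omega>) = potential s (left_shift \<omega>) + s * log_growth \<omega>"
    unfolding c(1) potential_def
    using barabanov_scaleR[OF growth_bounded_optimal[OF s] unstable(1)[OF shift_full_shift(1)[OF \<omega>]] c(2)] c(3)
    by simp
  moreover have "?H (A (\<omega> 0) *v unstable \<omega>) \<le> potential s \<omega> + optimal_exponent s"
    using barabanov_word[OF growth_bounded_optimal[OF s] unstable(1)[OF \<omega>], of "[\<omega> 0]"] letters[OF \<omega>, of 0]
    by (simp add: potential_def matrix_mul_rid)
  ultimately show ?thesis by (simp add: gap_def)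
qed

lemma optimal_iff_AE_gap:
  assumes s: "s \<in> {1, -1}" and m: "\<mu> \<in> invariant_measures k"
  shows "s * (LINT \<omega>|\<mu>. log_growth \<omega>) = optimal_exponent s \<longleftrightarrow> (AE \<omega> in \<mu>. gap s \<omega> = 0)"
proof -
  interpret prob_space \<mu> by (rule invariant_measuresD(1)[OF m])
  have int: "integrable \<mu> g" if g: "continuous_on (full_shift k) (g :: _ \<Rightarrow> real)" for g
  proof -
    obtain B where "\<And>\<omega>. \<omega> \<in> full_shift k \<Longrightarrow> \<bar>g \<omega>\<bar> \<le> B"
      using continuous_on_full_shift_bounded[OF g] by blast
    then show ?thesis using continuous_on_full_shift_measurable[OF m g]
      by (intro integrable_const_bound[of _ B]) (auto simp: invariant_measuresD(4)[OF m])
  qed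
  note I = int[OF continuous_on_potential[OF s]] int[OF continuous_on_potential_shift[OF s]]
    int[OF continuous_on_log_growth] int[OF continuous_on_gap[OF s]]
  have "(LINT \<omega>|\<mu>. potential s (left_shift \<omega>)) = (LINT \<omega>|distr \<mu> \<mu> left_shift. potential s \<omega>)"
    by (rule integral_distr[symmetric, OF left_shift_measurable[OF m]])
      (rule continuous_on_full_shift_measurable[OF m continuous_on_potential[OF s]])
  then have "(LINT \<omega>|\<mu>. gap s \<omega>) = optimal_exponent s - s * (LINT \<omega>|\<mu>. log_growth \<omega>)"
    unfolding gap_def using I by (simp add: invariant_measuresD(3)[OF m] prob_space)
  moreover have "(LINT \<omega>|\<mu>. gap s \<omega>) = 0 \<longleftrightarrow> (AE \<omega> in \<mu>. gap s \<omega> = 0)"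
    using I(4) gap_nonneg[OF s] by (intro integral_nonneg_eq_0_iff_AE) (auto simp: invariant_measuresD(4)[OF m])
  ultimately show ?thesis by auto
qed

definition optimal_measures :: "real \<Rightarrow> (int \<Rightarrow> nat) measure set" where
  "optimal_measures s = {\<mu> \<in> invariant_measures k. s * (LINT \<omega>|\<mu>. log_growth \<omega>) = optimal_exponent s}"

definition mather :: "real \<Rightarrow> (int \<Rightarrow> nat) set" where
  "mather s = \<Union>(measure_support ` optimal_measures s)"

lemma mather_top_eq: "mather_top k A = mather 1"
proof -
  have "lyap_top k A = optimal_exponent 1"
    unfolding lyap_top_def optimal_exponent_def
    by (rule arg_cong[where f = Sup], rule image_cong) (simp_all add: lyap_measure_eq_integral)
  then show ?thesis
    unfolding mather_top_def mather_def optimal_measures_def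
    using lyap_measure_eq_integral by (fastforce simp: image_def)
qed

lemma mather_bot_eq: "mather_bot k A = mather (-1)"
proof -
  have "(INF \<mu>\<in>invariant_measures k. lyap_measure A \<mu>) = (INF \<mu>\<in>invariant_measures k. LINT \<omega>|\<mu>. log_growth \<omega>)"
    by (rule arg_cong[where f = Inf], rule image_cong) (simp_all add: lyap_measure_eq_integral)
  also have "\<dots> = - optimal_exponent (-1)"
    unfolding optimal_exponent_def Inf_real_def by (simp add: image_image)
  finally have "lyap_bot k A = - optimal_exponent (-1)" by (simp add: lyap_bot_def)
  then have "lyap_measure A \<mu> = lyap_bot k A \<longleftrightarrow> -1 * (LINT \<omega>|\<mu>. log_growth \<omega>) = optimal_exponent (-1)"
    if "\<mu> \<in> invariant_measures k" for \<mu>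
    using lyap_measure_eq_integral[OF that] by auto
  then show ?thesis
    unfolding mather_bot_def mather_def optimal_measures_def by (fastforce simp: image_def)
qed

lemma mather_full_shift: "\<omega> \<in> mather s \<Longrightarrow> \<omega> \<in> full_shift k"
  by (auto simp: mather_def optimal_measures_def support_iff)

lemma left_shift_mather: "\<omega> \<in> mather s \<Longrightarrow> left_shift \<omega> \<in> mather s"
  using left_shift_support by (auto simp: mather_def optimal_measures_def)

lemma right_shift_mather: "\<omega> \<in> mather s \<Longrightarrow> right_shift \<omega> \<in> mather s"
  using right_shift_support by (auto simp: mather_def optimal_measures_def)

lemma funpow_mather:
  assumes "\<omega> \<in> mather s"
  shows "(left_shift ^^ n) \<omega> \<in> mather s" "(right_shift ^^ n) \<omega> \<in> mather s"
  by (induction n) (use assms in \<open>auto intro: left_shift_mather right_shift_mather\<close>)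

lemma gap_mather:
  assumes "s \<in> {1, -1}" "\<omega> \<in> mather s"
  shows "gap s \<omega> = 0"
proof -
  obtain \<mu> where m: "\<mu> \<in> invariant_measures k" "s * (LINT \<omega>|\<mu>. log_growth \<omega>) = optimal_exponent s"
    "\<omega> \<in> measure_support \<mu>" using assms(2) by (auto simp: mather_def optimal_measures_def)
  show ?thesis
    by (rule AE_eq_0_on_support[OF m(1) continuous_on_gap[OF assms(1)] _ m(3)])
      (use optimal_iff_AE_gap[OF assms(1) m(1)] m(2) in blast)
qed

lemma barabanov_mather:
  assumes s: "s \<in> {1, -1}" and \<omega>: "\<omega> \<in> mather s"
  shows "barabanov s (optimal_exponent s) (word_prod A (rev (map (future \<omega>) [0..<n])) *v unstable \<omega>)
    = barabanov s (optimal_exponent s) (unstable \<omega>) + optimal_exponent s * real n"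
proof -
  let ?T = "\<lambda>n. (left_shift ^^ n) \<omega>"
  have sum: "potential s (?T n) + s * orbit_sum left_shift log_growth n \<omega> = potential s \<omega> + optimal_exponent s * real n"
  proof (induction n)
    case (Suc n)
    have "gap s (?T n) = 0" by (rule gap_mather[OF s funpow_mather(1)[OF \<omega>]])
    then show ?case using Suc by (simp add: gap_def orbit_sum_def algebra_simps)
  qed (simp add: orbit_sum_def)
  have \<omega>': "\<omega> \<in> full_shift k" by (rule mather_full_shift[OF \<omega>])
  obtain c where c: "cocycle_prod A n \<omega> *v unstable \<omega> = c *\<^sub>R unstable (?T n)" "c \<noteq> 0"
    "ln \<bar>c\<bar> = orbit_sum left_shift log_growth n \<omega>" using cocycle_unstable[OF \<omega>', of n] by blast
  show ?thesis unfolding cocycle_prod_word_prod[symmetric] c(1)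
    using barabanov_scaleR[OF growth_bounded_optimal[OF s] unstable(1)[OF funpow_full_shift[OF \<omega>', of n]] c(2)]
      sum c(3) by (simp add: potential_def)
qed

text \<open>
  A mixture of countably many optimal measures, one for each basic open set that some optimal
  measure charges, is optimal and its support contains all the others.
\<close>

lemma closed_mather:
  assumes s: "s \<in> {1, -1}"
  shows "closed (mather s)"
proof (cases "optimal_measures s = {}")
  case True
  then show ?thesis by (simp add: mather_def)
next
  case False
  then obtain \<mu>0 where \<mu>0: "\<mu>0 \<in> optimal_measures s" by blast
  obtain \<B> :: "(int \<Rightarrow> nat) set set" where \<B>: "countable \<B>" "topological_basis \<B>"
    using ex_countable_basis by blast
  have ne: "\<B> \<noteq> {}"
    using topological_basisE[OF \<B>(2) open_UNIV UNIV_I] by blast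
  define pick where "pick = (\<lambda>b. if \<exists>\<mu>. \<mu> \<in> optimal_measures s \<and> emeasure \<mu> (b \<inter> full_shift k) > 0
    then SOME \<mu>. \<mu> \<in> optimal_measures s \<and> emeasure \<mu> (b \<inter> full_shift k) > 0 else \<mu>0)"
  have pick: "pick b \<in> optimal_measures s \<and> emeasure (pick b) (b \<inter> full_shift k) > 0"
    if ex: "\<exists>\<mu>. \<mu> \<in> optimal_measures s \<and> emeasure \<mu> (b \<inter> full_shift k) > 0" for b
  proof -
    have "pick b = (SOME \<mu>. \<mu> \<in> optimal_measures s \<and> emeasure \<mu> (b \<inter> full_shift k) > 0)"
      unfolding pick_def by (rule if_P[OF ex])
    then show ?thesis using someI_ex[OF ex] by (simp only:)
  qed
  have pick_opt: "pick b \<in> optimal_measures s" for b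
  proof (cases "\<exists>\<mu>. \<mu> \<in> optimal_measures s \<and> emeasure \<mu> (b \<inter> full_shift k) > 0")
    case True
    then show ?thesis using pick by simp
  next
    case False
    then have "pick b = \<mu>0" unfolding pick_def by (rule if_not_P)
    then show ?thesis using \<mu>0 by simp
  qed
  define \<mu> where "\<mu> = (\<lambda>n. pick (from_nat_into \<B> n))"
  have m: "\<mu> n \<in> invariant_measures k" for n
    using pick_opt by (auto simp: \<mu>_def optimal_measures_def)
  obtain \<nu> where \<nu>: "\<nu> \<in> invariant_measures k"
    and ae: "\<forall>g. continuous_on (full_shift k) (g :: _ \<Rightarrow> real) \<longrightarrow> (\<forall>n. AE \<omega> in \<mu> n. g \<omega> = 0) \<longrightarrow> (AE \<omega> in \<nu>. g \<omega> = 0)"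
    and pos: "\<forall>U n. open U \<longrightarrow> emeasure (\<mu> n) (U \<inter> full_shift k) > 0 \<longrightarrow> emeasure \<nu> (U \<inter> full_shift k) > 0"
    using invariant_measure_mixture[of \<mu>, OF m] by (elim bexE conjE) (rule that; assumption)
  have "AE \<omega> in \<mu> n. gap s \<omega> = 0" for n
    using optimal_iff_AE_gap[OF s m] pick_opt by (auto simp: \<mu>_def optimal_measures_def)
  then have "AE \<omega> in \<nu>. gap s \<omega> = 0" using ae continuous_on_gap[OF s] by blast
  then have opt: "\<nu> \<in> optimal_measures s"
    using optimal_iff_AE_gap[OF s \<nu>] \<nu> by (simp add: optimal_measures_def)
  have "mather s = measure_support \<nu>"
  proof
    show "measure_support \<nu> \<subseteq> mather s" using opt by (auto simp: mather_def)
    show "mather s \<subseteq> measure_support \<nu>"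
    proof
      fix \<omega> assume "\<omega> \<in> mather s"
      then obtain \<mu>' where \<mu>': "\<mu>' \<in> optimal_measures s" "\<omega> \<in> measure_support \<mu>'" by (auto simp: mather_def)
      then have m': "\<mu>' \<in> invariant_measures k" by (simp add: optimal_measures_def)
      show "\<omega> \<in> measure_support \<nu>"
        unfolding support_iff[OF \<nu>]
      proof (intro conjI allI impI)
        show "\<omega> \<in> full_shift k" using \<mu>'(2) by (simp add: support_iff[OF m'])
        fix U assume U: "open U" "\<omega> \<in> U"
        obtain b where b: "b \<in> \<B>" "\<omega> \<in> b" "b \<subseteq> U" by (rule topological_basisE[OF \<B>(2) U])
        have ob: "open b" using topological_basis_open[OF \<B>(2) b(1)] .
        have "emeasure \<mu>' (b \<inter> full_shift k) > 0" using \<mu>'(2) ob b(2) by (simp add: support_iff[OF m'])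
        then have "emeasure (pick b) (b \<inter> full_shift k) > 0" using pick[of b] \<mu>'(1) by blast
        moreover obtain n where "from_nat_into \<B> n = b" using from_nat_into_surj[OF \<B>(1) b(1)] by blast
        ultimately have "emeasure (\<mu> n) (b \<inter> full_shift k) > 0" by (simp add: \<mu>_def)
        then have "emeasure \<nu> (b \<inter> full_shift k) > 0" using pos ob by blast
        also have "emeasure \<nu> (b \<inter> full_shift k) \<le> emeasure \<nu> (U \<inter> full_shift k)"
          using b(3) open_Int_full_shift_sets[OF \<nu> U(1)] by (intro emeasure_mono) auto
        finally show "emeasure \<nu> (U \<inter> full_shift k) > 0" .
      qed
    qed
  qed
  moreover have "closed (measure_support \<nu>)"
    unfolding closed_def
  proof (subst open_subopen, intro ballI)
    fix \<omega> assume "\<omega> \<in> - measure_support \<nu>"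
    then consider "\<omega> \<notin> full_shift k" | U where "open U" "\<omega> \<in> U" "\<not> emeasure \<nu> (U \<inter> full_shift k) > 0"
      using support_iff[OF \<nu>] by auto
    then show "\<exists>T. open T \<and> \<omega> \<in> T \<and> T \<subseteq> - measure_support \<nu>"
    proof cases
      case 1
      then show ?thesis
        using closed_full_shift[of k] support_iff[OF \<nu>]
        by (intro exI[of _ "- full_shift k"]) auto
    next
      case 2
      then have "x \<notin> measure_support \<nu>" if "x \<in> U" for x using that unfolding support_iff[OF \<nu>] by blast
      then show ?thesis using 2 by (intro exI[of _ U]) blast
    qed
  qed
  ultimately show ?thesis by simp
qed

lemma compact_mather: "s \<in> {1, -1} \<Longrightarrow> compact (mather s)"
  using compact_Int_closed[OF compact_full_shift closed_mather, of s k] mather_full_shift[of _ s]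
  by (metis Int_absorb1 subsetI)

end

section \<open>Counting cells\<close>

text \<open>
  A pair that is first neither among the pairs with the same second component nor among those with
  the same first component is a corner. Without corners there are thus at most as many pairs as
  first and second components together.
\<close>

lemma card_corner_free_le:
  fixes E :: "('a \<times> 'b) set"
  assumes fin: "finite E"
    and Q: "\<And>a a'. a \<noteq> a' \<Longrightarrow> Q a a' \<or> Q a' a" and R: "\<And>b b'. b \<noteq> b' \<Longrightarrow> R b b' \<or> R b' b"
    and corner: "\<And>a b a' b'. (a, b) \<in> E \<Longrightarrow> (a', b) \<in> E \<Longrightarrow> Q a' a \<Longrightarrow> (a, b') \<in> E \<Longrightarrow> R b' b \<Longrightarrow> False"
  shows "card E \<le> card (fst ` E) + card (snd ` E)"
proof -
  define E1 where "E1 = {e \<in> E. \<forall>a'. (a', snd e) \<in> E \<longrightarrow> \<not> Q a' (fst e)}"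
  define E2 where "E2 = {e \<in> E. \<forall>b'. (fst e, b') \<in> E \<longrightarrow> \<not> R b' (snd e)}"
  have cover: "E = E1 \<union> E2"
  proof
    show "E \<subseteq> E1 \<union> E2"
    proof
      fix e assume e: "e \<in> E"
      show "e \<in> E1 \<union> E2"
      proof (rule ccontr)
        assume n: "e \<notin> E1 \<union> E2"
        obtain a where "(a, snd e) \<in> E" "Q a (fst e)" using n e by (auto simp: E1_def)
        moreover obtain b where "(fst e, b) \<in> E" "R b (snd e)" using n e by (auto simp: E2_def)
        ultimately show False using corner[of "fst e" "snd e" a b] e by simp
      qed
    qed
  qed (auto simp: E1_def E2_def)
  have "inj_on snd E1"
  proof (rule inj_onI)
    fix e e' assume e: "e \<in> E1" "e' \<in> E1" "snd e = snd e'"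
    have "(fst e, snd e') \<in> E" "(fst e', snd e) \<in> E"
      using e by (simp_all add: E1_def) (metis e(3) prod.collapse)+
    then have "fst e = fst e'" using Q[of "fst e" "fst e'"] e unfolding E1_def by blast
    then show "e = e'" using e(3) by (simp add: prod_eq_iff)
  qed
  then have 1: "card E1 \<le> card (snd ` E)"
    using fin by (intro card_inj_on_le) (auto simp: E1_def)
  have "inj_on fst E2"
  proof (rule inj_onI)
    fix e e' assume e: "e \<in> E2" "e' \<in> E2" "fst e = fst e'"
    have "(fst e', snd e) \<in> E" "(fst e, snd e') \<in> E"
      using e by (simp_all add: E2_def) (metis e(3) prod.collapse)+
    then have "snd e = snd e'" using R[of "snd e" "snd e'"] e unfolding E2_def by blast
    then show "e = e'" using e(3) by (simp add: prod_eq_iff)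
  qed
  then have 2: "card E2 \<le> card (fst ` E)"
    using fin by (intro card_inj_on_le) (auto simp: E2_def)
  have "card E \<le> card E1 + card E2" using card_Un_le[of E1 E2] cover by simp
  then show ?thesis using 1 2 by linarith
qed

text \<open>
  If both points \<open>a, a'\<close> are on the same side of both \<open>b, b'\<close>, comparing the cross ratio with 1
  amounts to the identity
  \<open>(b - a) (b' - a') - (b - a') (b' - a) = (a' - a) (b' - b)\<close>.
\<close>

lemma cross_ratio_ln_sign:
  fixes a b a' b' :: real
  assumes s: "s \<in> {1, -1}"
    and side: "(a < b \<and> a < b' \<and> a' < b \<and> a' < b') \<or> (b < a \<and> b' < a \<and> b < a' \<and> b' < a')"
    and ratio: "s * ((ln \<bar>a - b\<bar> - ln \<bar>a' - b\<bar>) + (ln \<bar>a' - b'\<bar> - ln \<bar>a - b'\<bar>)) \<ge> 0"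
  shows "s * ((a' - a) * (b' - b)) \<ge> 0"
proof -
  have nz: "0 < \<bar>a - b\<bar>" "0 < \<bar>a' - b\<bar>" "0 < \<bar>a' - b'\<bar>" "0 < \<bar>a - b'\<bar>" using side by auto
  have ln: "ln (\<bar>a - b\<bar> * \<bar>a' - b'\<bar>) = ln \<bar>a - b\<bar> + ln \<bar>a' - b'\<bar>"
    "ln (\<bar>a' - b\<bar> * \<bar>a - b'\<bar>) = ln \<bar>a' - b\<bar> + ln \<bar>a - b'\<bar>"
    using nz by (simp_all add: ln_mult_pos)
  have P: "0 < \<bar>a - b\<bar> * \<bar>a' - b'\<bar>" "0 < \<bar>a' - b\<bar> * \<bar>a - b'\<bar>" using nz by simp_all
  have id: "\<bar>a - b\<bar> * \<bar>a' - b'\<bar> - \<bar>a' - b\<bar> * \<bar>a - b'\<bar> = (a' - a) * (b' - b)"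
    using side by (auto simp: abs_if algebra_simps)
  show ?thesis
  proof (cases "s = 1")
    case True
    then have "ln (\<bar>a' - b\<bar> * \<bar>a - b'\<bar>) \<le> ln (\<bar>a - b\<bar> * \<bar>a' - b'\<bar>)" using ratio ln by simp
    then have "\<bar>a' - b\<bar> * \<bar>a - b'\<bar> \<le> \<bar>a - b\<bar> * \<bar>a' - b'\<bar>" using ln_le_cancel_iff[OF P(2,1)] by blast
    then show ?thesis using id True by simp
  next
    case False
    then have "ln (\<bar>a - b\<bar> * \<bar>a' - b'\<bar>) \<le> ln (\<bar>a' - b\<bar> * \<bar>a - b'\<bar>)" using ratio ln s by simp
    then have "\<bar>a - b\<bar> * \<bar>a' - b'\<bar> \<le> \<bar>a' - b\<bar> * \<bar>a - b'\<bar>" using ln_le_cancel_iff[OF P(1,2)] by blast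
    then show ?thesis using id False s by auto
  qed
qed

text \<open>
  The maps \<open>\<rho>\<close> and \<open>\<gamma>\<close> assign to a point the interval of the real line that contains its
  coordinate \<open>a\<close>, respectively \<open>b\<close>; the order assumptions say that the intervals are disjoint. The
  sign of the cross ratio makes the relation between intervals monotone on either side of the
  diagonal, and a monotone relation has few pairs.
\<close>

lemma card_cell_pairs_le:
  fixes a b :: "'p \<Rightarrow> real" and \<rho> :: "'p \<Rightarrow> 'r" and \<gamma> :: "'p \<Rightarrow> 'c"
  assumes s: "s \<in> {1, -1}" and fin: "finite (\<rho> ` X)" "finite (\<gamma> ` X)"
    and rows: "\<And>x x' y y'. x \<in> X \<Longrightarrow> x' \<in> X \<Longrightarrow> y \<in> X \<Longrightarrow> y' \<in> X \<Longrightarrow>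
       \<rho> x = \<rho> x' \<Longrightarrow> \<rho> y = \<rho> y' \<Longrightarrow> \<rho> x \<noteq> \<rho> y \<Longrightarrow> a x < a y \<Longrightarrow> a x' < a y'"
    and rows_neq: "\<And>x y. x \<in> X \<Longrightarrow> y \<in> X \<Longrightarrow> \<rho> x \<noteq> \<rho> y \<Longrightarrow> a x \<noteq> a y"
    and cols: "\<And>x x' y y'. x \<in> X \<Longrightarrow> x' \<in> X \<Longrightarrow> y \<in> X \<Longrightarrow> y' \<in> X \<Longrightarrow>
       \<gamma> x = \<gamma> x' \<Longrightarrow> \<gamma> y = \<gamma> y' \<Longrightarrow> \<gamma> x \<noteq> \<gamma> y \<Longrightarrow> b x < b y \<Longrightarrow> b x' < b y'"
    and cols_neq: "\<And>x y. x \<in> X \<Longrightarrow> y \<in> X \<Longrightarrow> \<gamma> x \<noteq> \<gamma> y \<Longrightarrow> b x \<noteq> b y"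
    and mixed: "\<And>x x' y y'. x \<in> X \<Longrightarrow> x' \<in> X \<Longrightarrow> y \<in> X \<Longrightarrow> y' \<in> X \<Longrightarrow>
       \<rho> x = \<rho> x' \<Longrightarrow> \<gamma> y = \<gamma> y' \<Longrightarrow> a x < b y \<Longrightarrow> a x' < b y'"
    and mixed_neq: "\<And>x y. x \<in> X \<Longrightarrow> y \<in> X \<Longrightarrow> a x \<noteq> b y"
    and ratio: "\<And>x y. x \<in> X \<Longrightarrow> y \<in> X \<Longrightarrow>
       s * ((ln \<bar>a x - b x\<bar> - ln \<bar>a y - b x\<bar>) + (ln \<bar>a y - b y\<bar> - ln \<bar>a x - b y\<bar>)) \<ge> 0"
  shows "card ((\<lambda>x. (\<rho> x, \<gamma> x)) ` X) \<le> 2 * (card (\<rho> ` X) + card (\<gamma> ` X))"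
proof -
  define \<alpha> where "\<alpha> = (\<lambda>r. a (SOME x. x \<in> X \<and> \<rho> x = r))"
  define \<beta> where "\<beta> = (\<lambda>c. b (SOME x. x \<in> X \<and> \<gamma> x = c))"
  have rep_a: "\<exists>y\<in>X. \<rho> y = \<rho> x \<and> \<alpha> (\<rho> x) = a y" if "x \<in> X" for x
    using someI[of "\<lambda>y. y \<in> X \<and> \<rho> y = \<rho> x" x] that unfolding \<alpha>_def by auto
  have rep_b: "\<exists>y\<in>X. \<gamma> y = \<gamma> x \<and> \<beta> (\<gamma> x) = b y" if "x \<in> X" for x
    using someI[of "\<lambda>y. y \<in> X \<and> \<gamma> y = \<gamma> x" x] that unfolding \<beta>_def by auto
  have a_less: "a x < a y" if xy: "x \<in> X" "y \<in> X" and l: "\<alpha> (\<rho> x) < \<alpha> (\<rho> y)" for x y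
  proof -
    obtain x' where x': "x' \<in> X" "\<rho> x' = \<rho> x" "\<alpha> (\<rho> x) = a x'" using rep_a[OF xy(1)] by blast
    obtain y' where y': "y' \<in> X" "\<rho> y' = \<rho> y" "\<alpha> (\<rho> y) = a y'" using rep_a[OF xy(2)] by blast
    have "\<rho> x \<noteq> \<rho> y" using l by auto
    then show ?thesis using rows[OF x'(1) xy(1) y'(1) xy(2)] x' y' l by simp
  qed
  have b_less: "b x < b y" if xy: "x \<in> X" "y \<in> X" and l: "\<beta> (\<gamma> x) < \<beta> (\<gamma> y)" for x y
  proof -
    obtain x' where x': "x' \<in> X" "\<gamma> x' = \<gamma> x" "\<beta> (\<gamma> x) = b x'" using rep_b[OF xy(1)] by blast
    obtain y' where y': "y' \<in> X" "\<gamma> y' = \<gamma> y" "\<beta> (\<gamma> y) = b y'" using rep_b[OF xy(2)] by blast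
    have "\<gamma> x \<noteq> \<gamma> y" using l by auto
    then show ?thesis using cols[OF x'(1) xy(1) y'(1) xy(2)] x' y' l by simp
  qed
  have ab_iff: "a x < b y \<longleftrightarrow> \<alpha> (\<rho> x) < \<beta> (\<gamma> y)" if xy: "x \<in> X" "y \<in> X" for x y
  proof -
    obtain x' where x': "x' \<in> X" "\<rho> x' = \<rho> x" "\<alpha> (\<rho> x) = a x'" using rep_a[OF xy(1)] by blast
    obtain y' where y': "y' \<in> X" "\<gamma> y' = \<gamma> y" "\<beta> (\<gamma> y) = b y'" using rep_b[OF xy(2)] by blast
    show ?thesis
      using mixed[OF x'(1) xy(1) y'(1) xy(2) x'(2) y'(2)] mixed[OF xy(1) x'(1) xy(2) y'(1) x'(2)[symmetric] y'(2)[symmetric]]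
      by (auto simp: x'(3) y'(3))
  qed
  have inj_a: "\<rho> x = \<rho> y" if xy: "x \<in> X" "y \<in> X" and "\<alpha> (\<rho> x) = \<alpha> (\<rho> y)" for x y
    using rep_a[OF xy(1)] rep_a[OF xy(2)] that(3) rows_neq by metis
  have inj_b: "\<gamma> x = \<gamma> y" if xy: "x \<in> X" "y \<in> X" and "\<beta> (\<gamma> x) = \<beta> (\<gamma> y)" for x y
    using rep_b[OF xy(1)] rep_b[OF xy(2)] that(3) cols_neq by metis
  define f where "f = (\<lambda>(r, c). (\<alpha> r, \<beta> c))"
  define P where "P = (\<lambda>x. (\<alpha> (\<rho> x), \<beta> (\<gamma> x))) ` X"
  have finpairs: "finite ((\<lambda>x. (\<rho> x, \<gamma> x)) ` X)"
    by (rule finite_subset[of _ "\<rho> ` X \<times> \<gamma> ` X"]) (use fin in auto)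
  have P: "P = f ` (\<lambda>x. (\<rho> x, \<gamma> x)) ` X" by (simp add: P_def f_def image_image)
  have "inj_on f ((\<lambda>x. (\<rho> x, \<gamma> x)) ` X)"
    by (rule inj_onI) (use inj_a inj_b in \<open>fastforce simp: f_def\<close>)
  then have cardP: "card ((\<lambda>x. (\<rho> x, \<gamma> x)) ` X) = card P" unfolding P by (simp add: card_image)
  have finP: "finite P" unfolding P using finpairs by simp
  have fstP: "card (fst ` P) \<le> card (\<rho> ` X)" "card (snd ` P) \<le> card (\<gamma> ` X)"
  proof -
    have "fst ` P = \<alpha> ` \<rho> ` X" "snd ` P = \<beta> ` \<gamma> ` X" by (auto simp: P_def image_image)
    then show "card (fst ` P) \<le> card (\<rho> ` X)" "card (snd ` P) \<le> card (\<gamma> ` X)"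
      using card_image_le[OF fin(1)] card_image_le[OF fin(2)] by simp_all
  qed
  \<comment> \<open>on either side of the diagonal the sign of the cross ratio excludes one kind of corner\<close>
  define P1 where "P1 = {e \<in> P. fst e < snd e}"
  define P2 where "P2 = {e \<in> P. snd e < fst e}"
  have tot: "s * x < s * y \<or> s * y < s * x" if "x \<noteq> y" for x y :: real
    using s that by auto
  have P12: "P \<subseteq> P1 \<union> P2"
  proof
    fix e assume e: "e \<in> P"
    then obtain x where x: "x \<in> X" "e = (\<alpha> (\<rho> x), \<beta> (\<gamma> x))" by (auto simp: P_def)
    have "\<alpha> (\<rho> x) \<noteq> \<beta> (\<gamma> x)"
      using rep_a[OF x(1)] rep_b[OF x(1)] mixed_neq by metis
    then show "e \<in> P1 \<union> P2" using e x by (auto simp: P1_def P2_def)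
  qed
  have key: "s * ((a z - a y) * (b z - b y)) \<ge> 0"
    if "y \<in> X" "z \<in> X" "(a y < b y \<and> a y < b z \<and> a z < b y \<and> a z < b z) \<or>
        (b y < a y \<and> b z < a y \<and> b y < a z \<and> b z < a z)" for y z
    using cross_ratio_ln_sign[OF s that(3) ratio[OF that(1,2)]] .
  have c1: "card P1 \<le> card (fst ` P1) + card (snd ` P1)"
  proof (rule card_corner_free_le[where Q = "(<)" and R = "\<lambda>b' b. s * b' < s * b"])
    show "finite P1" using finP by (simp add: P1_def)
    fix A B A' B' assume e: "(A, B) \<in> P1" "(A', B) \<in> P1" "A' < A" "(A, B') \<in> P1" "s * B' < s * B"
    obtain y where y: "y \<in> X" "A' = \<alpha> (\<rho> y)" "B = \<beta> (\<gamma> y)" using e(2) by (auto simp: P1_def P_def)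
    obtain z where z: "z \<in> X" "A = \<alpha> (\<rho> z)" "B' = \<beta> (\<gamma> z)" using e(4) by (auto simp: P1_def P_def)
    have "A < B" "A' < B" "A < B'" "A' < B'" using e by (auto simp: P1_def)
    then have "a y < b y \<and> a y < b z \<and> a z < b y \<and> a z < b z"
      using y z by (simp add: ab_iff)
    then have k: "s * ((a z - a y) * (b z - b y)) \<ge> 0" using key y z by blast
    have a: "0 < a z - a y" using a_less[OF y(1) z(1)] e(3) y z by simp
    have "s * b z < s * b y"
      using s e(5) b_less[OF z(1) y(1)] b_less[OF y(1) z(1)] y z by auto
    then have "s * (b z - b y) < 0" unfolding right_diff_distrib by linarith
    with a have "(a z - a y) * (s * (b z - b y)) < 0" by (rule mult_pos_neg)
    then show False using k by (simp add: mult_ac)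
  qed (use tot in auto)
  have c2: "card P2 \<le> card (fst ` P2) + card (snd ` P2)"
  proof (rule card_corner_free_le[where Q = "(>)" and R = "\<lambda>b' b. s * b < s * b'"])
    show "finite P2" using finP by (simp add: P2_def)
    fix A B A' B' assume e: "(A, B) \<in> P2" "(A', B) \<in> P2" "A < A'" "(A, B') \<in> P2" "s * B < s * B'"
    obtain y where y: "y \<in> X" "A' = \<alpha> (\<rho> y)" "B = \<beta> (\<gamma> y)" using e(2) by (auto simp: P2_def P_def)
    obtain z where z: "z \<in> X" "A = \<alpha> (\<rho> z)" "B' = \<beta> (\<gamma> z)" using e(4) by (auto simp: P2_def P_def)
    have "B < A" "B < A'" "B' < A" "B' < A'" using e by (auto simp: P2_def)
    then have "\<not> a y < b y \<and> \<not> a y < b z \<and> \<not> a z < b y \<and> \<not> a z < b z"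
      using y z by (simp add: ab_iff)
    then have "b y < a y \<and> b z < a y \<and> b y < a z \<and> b z < a z"
      using mixed_neq y(1) z(1) by (meson linorder_neqE_linordered_idom)
    then have k: "s * ((a z - a y) * (b z - b y)) \<ge> 0" using key y z by blast
    have a: "a z - a y < 0" using a_less[OF z(1) y(1)] e(3) y z by simp
    have "s * b y < s * b z"
      using s e(5) b_less[OF z(1) y(1)] b_less[OF y(1) z(1)] y z by auto
    then have "s * (b z - b y) > 0" unfolding right_diff_distrib by linarith
    with a have "(a z - a y) * (s * (b z - b y)) < 0" by (rule mult_neg_pos)
    then show False using k by (simp add: mult_ac)
  qed (use tot in auto)
  have sub: "card (fst ` P1) \<le> card (fst ` P)" "card (snd ` P1) \<le> card (snd ` P)"
    "card (fst ` P2) \<le> card (fst ` P)" "card (snd ` P2) \<le> card (snd ` P)"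
    using finP by (auto intro!: card_mono simp: P1_def P2_def)
  have "card P \<le> card (P1 \<union> P2)" using finP P12 by (intro card_mono) (auto simp: P1_def P2_def)
  also have "\<dots> \<le> card P1 + card P2" by (rule card_Un_le)
  finally have le: "card P \<le> card P1 + card P2" .
  have "card P1 \<le> card (fst ` P) + card (snd ` P)"
    by (rule order_trans[OF c1 add_mono[OF sub(1,2)]])
  moreover have "card P2 \<le> card (fst ` P) + card (snd ` P)"
    by (rule order_trans[OF c2 add_mono[OF sub(3,4)]])
  ultimately have "card P \<le> 2 * (card (fst ` P) + card (snd ` P))"
    unfolding mult_2 by (intro order_trans[OF le] add_mono)
  also have "\<dots> \<le> 2 * (card (\<rho> ` X) + card (\<gamma> ` X))" using fstP by simp
  finally show ?thesis by (simp only: cardP)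
qed

section \<open>Polynomial word complexity\<close>

definition words :: "(int \<Rightarrow> nat) set \<Rightarrow> nat \<Rightarrow> nat list set" where
  "words K n = (\<lambda>\<omega>. map (future \<omega>) [0..<n]) ` K"

lemma finite_words:
  assumes "K \<subseteq> full_shift k"
  shows "finite (words K n)"
proof (rule finite_subset)
  show "words K n \<subseteq> {w. set w \<subseteq> {1..k} \<and> length w = n}"
    using assms range_future by (fastforce simp: words_def)
  show "finite {w. set w \<subseteq> {1..k} \<and> length w = n}" by (rule finite_lists_length_eq) simp
qed

lemma card_words_mono:
  assumes "K \<subseteq> full_shift k" "m \<le> n"
  shows "card (words K m) \<le> card (words K n)"
proof -
  have "take m (map (future \<omega>) [0..<n]) = map (future \<omega>) [0..<m]" for \<omega>
    using assms(2) by (simp add: take_map)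
  then have "words K m = take m ` words K n" by (simp add: words_def image_image)
  then show ?thesis using card_image_le[OF finite_words[OF assms(1)]] by simp
qed

lemma past_word_eq:
  "map (past \<omega>) [0..<n] = rev (map (future ((right_shift ^^ n) \<omega>)) [0..<n])"
  by (rule nth_equalityI)
    (auto simp: rev_nth past_def future_def right_shift_funpow intro!: arg_cong[where f = \<omega>])

lemma future_split:
  "map (future ((right_shift ^^ n) \<omega>)) [0..<2 * n] = rev (map (past \<omega>) [0..<n]) @ map (future \<omega>) [0..<n]"
proof -
  have "[0..<2 * n] = [0..<n] @ map (\<lambda>i. i + n) [0..<n]"
    using upt_add_eq_append[of 0 n n] by (simp add: map_add_upt mult_2)
  moreover have "map (future ((right_shift ^^ n) \<omega>)) (map (\<lambda>i. i + n) [0..<n]) = map (future \<omega>) [0..<n]"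
    by (simp add: future_def right_shift_funpow)
  ultimately show ?thesis by (simp only: map_append past_word_eq rev_rev_ident)
qed

context cone_system
begin

text \<open>
  Every cell of positive level lies in the interior of the multicone, so a boundary direction is a
  point at infinity for which all of these cells are intervals.
\<close>

lemma boundary_vector:
  obtains p where "p \<in> M" "p \<notin> interior M"
proof -
  obtain C where C: "C \<in> Cs" using cones_nonempty by blast
  note pc = plane_cones[OF C]
  define e :: "real^2" where "e = vector [1, 0]"
  have e: "e \<in> standard_cone" by (simp add: e_def standard_cone_def vec_eq_iff forall_2)
  have p: "frame C *v e \<in> C" by (rule frame_in_plane_cone[OF pc e])
  have "frame C *v e \<notin> interior M"
  proof
    assume "frame C *v e \<in> interior M"
    then have i: "frame C *v e \<in> interior C" by (rule interior_M_in_cone[OF _ p C])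
    have "e $ 1 * e $ 2 > 0" by (rule interior_plane_cone_coordinates[OF pc i])
    then show False by (simp add: e_def)
  qed
  then show thesis using that[of "frame C *v e"] p C by blast
qed

lemma nonempty_cell_in_interior:
  assumes "w \<noteq> []" "set w \<subseteq> {1..k}" "C \<in> Cs"
  shows "(*v) (word_prod A w) ` C \<subseteq> interior M"
proof
  fix v assume "v \<in> (*v) (word_prod A w) ` C"
  then obtain c where c: "c \<in> C" "v = word_prod A w *v c" by blast
  obtain i w' where w: "w = i # w'" using assms(1) by (cases w) auto
  have "word_prod A w' *v c \<in> M" using word_prod_M[of w' c] assms c w by auto
  moreover have "v = A i *v (word_prod A w' *v c)" by (simp add: c w matrix_vector_mul_assoc)
  moreover have "i \<in> {1..k}" using assms w by simp
  ultimately show "v \<in> interior M" using strictly_invariant by blast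
qed

definition direction_cell :: "nat \<Rightarrow> (nat \<Rightarrow> nat) \<Rightarrow> (real^2) set" where
  "direction_cell n x = (SOME C. C \<in> Cs \<and> limit_direction x \<in> (*v) (word_prod A (map x [0..<n])) ` C)"

lemma direction_cell:
  assumes "range x \<subseteq> {1..k}"
  shows "direction_cell n x \<in> Cs"
    "limit_direction x \<in> (*v) (word_prod A (map x [0..<n])) ` direction_cell n x"
proof -
  have "\<exists>C. C \<in> Cs \<and> limit_direction x \<in> (*v) (word_prod A (map x [0..<n])) ` C"
    using limit_direction_in_image[OF assms, of n] by blast
  from someI_ex[OF this] show "direction_cell n x \<in> Cs"
    "limit_direction x \<in> (*v) (word_prod A (map x [0..<n])) ` direction_cell n x"
    unfolding direction_cell_def by blast+
qed

lemma cells_disjoint: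
  assumes "length w = length w'" "set w \<subseteq> {1..k}" "set w' \<subseteq> {1..k}" "C \<in> Cs" "C' \<in> Cs" "(w, C) \<noteq> (w', C')"
  shows "(*v) (word_prod A w) ` C \<inter> (*v) (word_prod A w') ` C' = {}"
proof (rule ccontr)
  assume "\<not> ?thesis"
  then obtain v where "v \<in> (*v) (word_prod A w) ` C" "v \<in> (*v) (word_prod A w') ` C'" by blast
  from cell_unique[OF assms(1-5) this] show False using assms(6) by simp
qed

end

context opposite_cone_systems
begin

definition stable :: "(int \<Rightarrow> nat) \<Rightarrow> real^2" where
  "stable \<omega> = bwd.limit_direction (future \<omega>)"

lemma mather_slope_ratio:
  assumes s: "s \<in> {1, -1}" and x: "x \<in> fwd.mather s" and y: "y \<in> fwd.mather s" and p: "p \<noteq> 0"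
    and nz: "cross2 p (fwd.unstable x) \<noteq> 0" "cross2 p (fwd.unstable y) \<noteq> 0"
      "cross2 p (stable x) \<noteq> 0" "cross2 p (stable y) \<noteq> 0"
  defines "a \<equiv> \<lambda>\<omega>. slope p (fwd.unstable \<omega>)" and "b \<equiv> \<lambda>\<omega>. slope p (stable \<omega>)"
  shows "s * ((ln \<bar>a x - b x\<bar> - ln \<bar>a y - b x\<bar>) + (ln \<bar>a y - b y\<bar> - ln \<bar>a x - b y\<bar>)) \<ge> 0"
proof -
  have xy: "x \<in> full_shift k" "y \<in> full_shift k" using x y fwd.mather_full_shift by auto
  have E: "fwd.unstable x \<in> fwd.M" "fwd.unstable y \<in> fwd.M" using fwd.unstable xy by auto
  have ln_slope: "ln \<bar>slope p u - slope p v\<bar>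
      = ln ((norm p)\<^sup>2) + ln \<bar>cross2 u v\<bar> - ln \<bar>cross2 p u\<bar> - ln \<bar>cross2 p v\<bar>"
    if "cross2 p u \<noteq> 0" "cross2 p v \<noteq> 0" "cross2 u v \<noteq> 0" for u v
    using that p by (simp add: slope_diff abs_mult abs_divide ln_div ln_mult)
  have t: "cross2 (fwd.unstable \<omega>) (stable \<tau>) \<noteq> 0" if "\<omega> \<in> full_shift k" "\<tau> \<in> full_shift k" for \<omega> \<tau>
    unfolding stable_def using transverse_limit_direction[OF range_future fwd.unstable(1)] that by blast
  have cross: "s * ((ln \<bar>cross2 (fwd.unstable x) (stable x)\<bar> - ln \<bar>cross2 (fwd.unstable y) (stable x)\<bar>)
      + (ln \<bar>cross2 (fwd.unstable y) (stable y)\<bar> - ln \<bar>cross2 (fwd.unstable x) (stable y)\<bar>)) \<ge> 0"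
    unfolding stable_def
    by (rule extremal_cross_ratio[OF fwd.growth_bounded_optimal[OF s] s range_future[OF xy(1)]
          range_future[OF xy(2)] E fwd.barabanov_mather[OF s x] fwd.barabanov_mather[OF s y]])
  \<comment> \<open>the contributions of \<open>p\<close> cancel\<close>
  have "(ln \<bar>a x - b x\<bar> - ln \<bar>a y - b x\<bar>) + (ln \<bar>a y - b y\<bar> - ln \<bar>a x - b y\<bar>)
      = (ln \<bar>cross2 (fwd.unstable x) (stable x)\<bar> - ln \<bar>cross2 (fwd.unstable y) (stable x)\<bar>)
      + (ln \<bar>cross2 (fwd.unstable y) (stable y)\<bar> - ln \<bar>cross2 (fwd.unstable x) (stable y)\<bar>)"
    unfolding a_def b_def using nz t xy by (simp add: ln_slope)
  with cross show ?thesis by (simp only:)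
qed

text \<open>
  A word of length \<open>2 n\<close> is read off from the cells of level \<open>n\<close> of the two directions at its
  centre. The multicones are cut open at a boundary direction of the forward one, which lies in no
  cell.
\<close>

lemma card_words_double_le:
  assumes s: "s \<in> {1, -1}" and n: "n \<ge> 1" and dom: "dominance n < 1"
  shows "card (words (fwd.mather s) (2 * n)) \<le> 2 * (card Cs + card Ds) * card (words (fwd.mather s) n)"
proof -
  let ?K = "fwd.mather s" and ?iA = "\<lambda>i. matrix_inv (A i)"
  have K: "?K \<subseteq> full_shift k" using fwd.mather_full_shift by auto
  define pw where "pw = (\<lambda>\<omega>. map (past \<omega>) [0..<n])"
  define fw where "fw = (\<lambda>\<omega>. map (future \<omega>) [0..<n])"
  define \<rho> where "\<rho> = (\<lambda>\<omega>. (pw \<omega>, fwd.direction_cell n (past \<omega>)))"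
  define \<gamma> where "\<gamma> = (\<lambda>\<omega>. (fw \<omega>, bwd.direction_cell n (future \<omega>)))"
  define row where "row = (\<lambda>\<omega>. (*v) (word_prod A (pw \<omega>)) ` fwd.direction_cell n (past \<omega>))"
  define col where "col = (\<lambda>\<omega>. (*v) (word_prod ?iA (fw \<omega>)) ` bwd.direction_cell n (future \<omega>))"
  have letters: "set (pw \<omega>) \<subseteq> {1..k}" "set (fw \<omega>) \<subseteq> {1..k}" "length (pw \<omega>) = n" "length (fw \<omega>) = n"
    if "\<omega> \<in> ?K" for \<omega>
    using that K range_past range_future unfolding pw_def fw_def by fastforce+
  have cells: "fwd.direction_cell n (past \<omega>) \<in> Cs" "fwd.unstable \<omega> \<in> row \<omega>"
    "bwd.direction_cell n (future \<omega>) \<in> Ds" "stable \<omega> \<in> col \<omega>" if "\<omega> \<in> ?K" for \<omega>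
  proof -
    have "\<omega> \<in> full_shift k" using that K by blast
    then show "fwd.direction_cell n (past \<omega>) \<in> Cs" "fwd.unstable \<omega> \<in> row \<omega>"
      "bwd.direction_cell n (future \<omega>) \<in> Ds" "stable \<omega> \<in> col \<omega>"
      using fwd.direction_cell[OF range_past] bwd.direction_cell[OF range_future]
      by (simp_all add: fwd.unstable_def stable_def row_def col_def pw_def fw_def)
  qed
  obtain p where p: "p \<in> fwd.M" "p \<notin> interior fwd.M" by (rule fwd.boundary_vector)
  have p0: "p \<noteq> 0" using fwd.M_nonzero[OF p(1)] .
  have row_cone: "plane_cone (row \<omega>)" "p \<notin> row \<omega>" "row \<omega> \<subseteq> fwd.M" if "\<omega> \<in> ?K" for \<omega>
  proof -
    have ne: "pw \<omega> \<noteq> []" using letters(3)[OF that] n by auto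
    show "plane_cone (row \<omega>)" unfolding row_def
      by (rule fwd.plane_cone_cell[OF letters(1)[OF that] cells(1)[OF that]])
    show "p \<notin> row \<omega>"
      using fwd.nonempty_cell_in_interior[OF ne letters(1)[OF that] cells(1)[OF that]] p(2)
      unfolding row_def by blast
    show "row \<omega> \<subseteq> fwd.M" unfolding row_def
      by (rule fwd.cell_subset_M[OF letters(1)[OF that] cells(1)[OF that]])
  qed
  have col_trans: "cross2 u z \<noteq> 0" if "\<omega> \<in> ?K" "u \<in> fwd.M" "z \<in> col \<omega>" for \<omega> u z
  proof (rule transverse[OF letters(2)[OF that(1)] _ that(2)])
    show "dominance (length (fw \<omega>)) < 1" using dom letters(4)[OF that(1)] by simp
    show "z \<in> (*v) (word_prod ?iA (fw \<omega>)) ` bwd.M"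
      using that(3) cells(3)[OF that(1)] unfolding col_def by blast
  qed
  have col_cone: "plane_cone (col \<omega>)" "p \<notin> col \<omega>" if "\<omega> \<in> ?K" for \<omega>
  proof -
    show "plane_cone (col \<omega>)" unfolding col_def
      by (rule bwd.plane_cone_cell[OF letters(2)[OF that] cells(3)[OF that]])
    show "p \<notin> col \<omega>" using col_trans[OF that p(1), of p] by auto
  qed
  have row_disj: "row \<omega> \<inter> row \<tau> = {}" if "\<omega> \<in> ?K" "\<tau> \<in> ?K" "\<rho> \<omega> \<noteq> \<rho> \<tau>" for \<omega> \<tau>
    unfolding row_def using that letters cells by (intro fwd.cells_disjoint) (simp_all add: \<rho>_def)
  have col_disj: "col \<omega> \<inter> col \<tau> = {}" if "\<omega> \<in> ?K" "\<tau> \<in> ?K" "\<gamma> \<omega> \<noteq> \<gamma> \<tau>" for \<omega> \<tau>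
    unfolding col_def using that letters cells by (intro bwd.cells_disjoint) (simp_all add: \<gamma>_def)
  have mix_disj: "row \<omega> \<inter> col \<tau> = {}" if "\<omega> \<in> ?K" "\<tau> \<in> ?K" for \<omega> \<tau>
  proof (rule ccontr)
    assume "\<not> ?thesis"
    then obtain u where "u \<in> row \<omega>" "u \<in> col \<tau>" by blast
    then show False using col_trans[OF that(2), of u u] row_cone(3)[OF that(1)] by auto
  qed
  have row_eq: "row \<omega> = row \<tau>" if "\<rho> \<omega> = \<rho> \<tau>" for \<omega> \<tau>
    using that by (simp add: \<rho>_def row_def)
  have col_eq: "col \<omega> = col \<tau>" if "\<gamma> \<omega> = \<gamma> \<tau>" for \<omega> \<tau>
    using that by (simp add: \<gamma>_def col_def)
  have Cs0: "finite Cs" "finite Ds" by (rule fwd.finite_cones, rule bwd.finite_cones)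
  have pw_words: "pw ` ?K \<subseteq> rev ` words ?K n"
  proof
    fix w assume "w \<in> pw ` ?K"
    then obtain \<omega> where \<omega>: "\<omega> \<in> ?K" "w = pw \<omega>" by blast
    have "w = rev (map (future ((right_shift ^^ n) \<omega>)) [0..<n])" using \<omega>(2) by (simp add: pw_def past_word_eq)
    moreover have "map (future ((right_shift ^^ n) \<omega>)) [0..<n] \<in> words ?K n"
      unfolding words_def using fwd.funpow_mather(2)[OF \<omega>(1)] by blast
    ultimately show "w \<in> rev ` words ?K n" by blast
  qed
  have fin_words: "finite (words ?K n)" by (rule finite_words[OF K])
  have rho_sub: "\<rho> ` ?K \<subseteq> rev ` words ?K n \<times> Cs"
    using pw_words cells(1) by (auto simp: \<rho>_def)
  have gamma_sub: "\<gamma> ` ?K \<subseteq> words ?K n \<times> Ds"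
    using cells(3) by (auto simp: \<gamma>_def fw_def words_def)
  have fin: "finite (\<rho> ` ?K)" "finite (\<gamma> ` ?K)"
    using finite_subset[OF rho_sub] finite_subset[OF gamma_sub] fin_words Cs0 by auto
  have "card (\<rho> ` ?K) \<le> card (rev ` words ?K n \<times> Cs)"
    by (rule card_mono[OF _ rho_sub]) (use fin_words Cs0 in auto)
  then have card_rho: "card (\<rho> ` ?K) \<le> card (words ?K n) * card Cs"
    using card_image_le[OF fin_words, of rev] by (simp add: card_cartesian_product) (meson mult_le_mono1 order_trans)
  have "card (\<gamma> ` ?K) \<le> card (words ?K n \<times> Ds)"
    by (rule card_mono[OF _ gamma_sub]) (use fin_words Cs0 in auto)
  then have card_gamma: "card (\<gamma> ` ?K) \<le> card (words ?K n) * card Ds"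
    by (simp add: card_cartesian_product)
  define a where "a = (\<lambda>\<omega>. slope p (fwd.unstable \<omega>))"
  define b where "b = (\<lambda>\<omega>. slope p (stable \<omega>))"
  note nz_row = cross2_nonzero_outside_cone[OF row_cone(1) p0 row_cone(2) cells(2)]
  note nz_col = cross2_nonzero_outside_cone[OF col_cone(1) p0 col_cone(2) cells(4)]
  have pairs: "card ((\<lambda>\<omega>. (\<rho> \<omega>, \<gamma> \<omega>)) ` ?K) \<le> 2 * (card (\<rho> ` ?K) + card (\<gamma> ` ?K))"
  proof (rule card_cell_pairs_le[OF s fin, where a = a and b = b])
    fix x x' y y' assume m: "x \<in> ?K" "x' \<in> ?K" "y \<in> ?K" "y' \<in> ?K"
    show "a x' < a y'" if e: "\<rho> x = \<rho> x'" "\<rho> y = \<rho> y'" "\<rho> x \<noteq> \<rho> y" "a x < a y"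
      using disjoint_cones_ordered[OF row_cone(1,2)[OF m(1)] row_cone(1,2)[OF m(3)] p0 row_disj[OF m(1,3) e(3)]
          cells(2)[OF m(1)] _ cells(2)[OF m(3)]] cells(2)[OF m(2)] cells(2)[OF m(4)] row_eq[OF e(1)] row_eq[OF e(2)] e(4)
      by (simp add: a_def)
    show "b x' < b y'" if e: "\<gamma> x = \<gamma> x'" "\<gamma> y = \<gamma> y'" "\<gamma> x \<noteq> \<gamma> y" "b x < b y"
      using disjoint_cones_ordered[OF col_cone(1,2)[OF m(1)] col_cone(1,2)[OF m(3)] p0 col_disj[OF m(1,3) e(3)]
          cells(4)[OF m(1)] _ cells(4)[OF m(3)]] cells(4)[OF m(2)] cells(4)[OF m(4)] col_eq[OF e(1)] col_eq[OF e(2)] e(4)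
      by (simp add: b_def)
    show "a x' < b y'" if e: "\<rho> x = \<rho> x'" "\<gamma> y = \<gamma> y'" "a x < b y"
      using disjoint_cones_ordered[OF row_cone(1,2)[OF m(1)] col_cone(1,2)[OF m(3)] p0 mix_disj[OF m(1,3)]
          cells(2)[OF m(1)] _ cells(4)[OF m(3)]] cells(2)[OF m(2)] cells(4)[OF m(4)] row_eq[OF e(1)] col_eq[OF e(2)] e(3)
      by (simp add: a_def b_def)
  next
    fix x y assume m: "x \<in> ?K" "y \<in> ?K"
    show "a x \<noteq> a y" if "\<rho> x \<noteq> \<rho> y"
      unfolding a_def
      by (rule slope_neq_in_disjoint_cones[OF row_cone(1,2)[OF m(1)] row_cone(1,2)[OF m(2)] p0
            row_disj[OF m that] cells(2)[OF m(1)] cells(2)[OF m(2)]])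
    show "b x \<noteq> b y" if "\<gamma> x \<noteq> \<gamma> y"
      unfolding b_def
      by (rule slope_neq_in_disjoint_cones[OF col_cone(1,2)[OF m(1)] col_cone(1,2)[OF m(2)] p0
            col_disj[OF m that] cells(4)[OF m(1)] cells(4)[OF m(2)]])
    show "a x \<noteq> b y"
      unfolding a_def b_def
      by (rule slope_neq_in_disjoint_cones[OF row_cone(1,2)[OF m(1)] col_cone(1,2)[OF m(2)] p0
            mix_disj[OF m] cells(2)[OF m(1)] cells(4)[OF m(2)]])
    show "s * ((ln \<bar>a x - b x\<bar> - ln \<bar>a y - b x\<bar>) + (ln \<bar>a y - b y\<bar> - ln \<bar>a x - b y\<bar>)) \<ge> 0"
      unfolding a_def b_def
      by (rule mather_slope_ratio[OF s m p0]) (use nz_row nz_col m in auto)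
  qed
  have "words ?K (2 * n) \<subseteq> (\<lambda>(r, c). rev (fst r) @ fst c) ` (\<lambda>\<omega>. (\<rho> \<omega>, \<gamma> \<omega>)) ` ?K"
  proof
    fix w assume "w \<in> words ?K (2 * n)"
    then obtain \<omega> where \<omega>: "\<omega> \<in> ?K" "w = map (future \<omega>) [0..<2 * n]" by (auto simp: words_def)
    define \<tau> where "\<tau> = (left_shift ^^ n) \<omega>"
    have "\<omega> = (right_shift ^^ n) \<tau>"
      by (rule ext) (simp add: \<tau>_def right_shift_funpow left_shift_funpow)
    then have "w = rev (pw \<tau>) @ fw \<tau>" using \<omega>(2) by (simp only: future_split pw_def fw_def)
    moreover have "\<tau> \<in> ?K" unfolding \<tau>_def by (rule fwd.funpow_mather(1)[OF \<omega>(1)])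
    ultimately show "w \<in> (\<lambda>(r, c). rev (fst r) @ fst c) ` (\<lambda>\<omega>. (\<rho> \<omega>, \<gamma> \<omega>)) ` ?K"
      by (auto simp: \<rho>_def \<gamma>_def image_image)
  qed
  moreover have finp: "finite ((\<lambda>\<omega>. (\<rho> \<omega>, \<gamma> \<omega>)) ` ?K)"
    by (rule finite_subset[of _ "\<rho> ` ?K \<times> \<gamma> ` ?K"]) (use fin in auto)
  ultimately have "card (words ?K (2 * n)) \<le> card ((\<lambda>\<omega>. (\<rho> \<omega>, \<gamma> \<omega>)) ` ?K)"
    by (rule surj_card_le[rotated])
  also note pairs
  also have "2 * (card (\<rho> ` ?K) + card (\<gamma> ` ?K)) \<le> 2 * (card (words ?K n) * card Cs + card (words ?K n) * card Ds)"
    using card_rho card_gamma by (intro mult_le_mono2 add_mono)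
  also have "\<dots> = 2 * (card Cs + card Ds) * card (words ?K n)" by (simp add: algebra_simps)
  finally show ?thesis .
qed

end

text \<open>
  Doubling the length multiplies the bound by a constant; the shift from \<open>m\<close> to \<open>m - 1\<close> makes the
  induction pass through odd lengths, which are rounded up before halving.
\<close>

lemma polynomial_growth_if_doubling:
  fixes q :: "nat \<Rightarrow> nat"
  assumes mono: "\<And>m n. m \<le> n \<Longrightarrow> q m \<le> q n" and double: "\<And>n. n \<ge> N \<Longrightarrow> q (2 * n) \<le> c * q n"
  shows "\<exists>C d N. \<forall>m\<ge>N. q m \<le> C * m ^ d"
proof -
  define N0 where "N0 = max N 2"
  define d where "d = c"
  have cd: "c \<le> 2 ^ d" unfolding d_def by (rule less_imp_le[OF less_exp])
  define C where "C = q (2 * N0)"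
  have "q m \<le> C * (m - 1) ^ d" if "m \<ge> N0" for m
    using that
  proof (induction m rule: less_induct)
    case (less m)
    show ?case
    proof (cases "m \<le> 2 * N0")
      case True
      have "1 \<le> m - 1" using less.prems unfolding N0_def by linarith
      then have "1 \<le> (m - 1) ^ d" by (rule one_le_power)
      then have "C * 1 \<le> C * (m - 1) ^ d" by (rule mult_le_mono2)
      then have "C \<le> C * (m - 1) ^ d" by (simp only: mult_1_right)
      then show ?thesis using mono[OF True] unfolding C_def by (rule order_trans[rotated])
    next
      case False
      define n where "n = (m + 1) div 2"
      have n: "N0 \<le> n" "n < m" "m \<le> 2 * n" "2 * n \<le> m + 1" "1 \<le> n"
        using False by (auto simp: n_def N0_def)
      have "q m \<le> q (2 * n)" by (rule mono[OF n(3)])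
      also have "\<dots> \<le> c * q n" using n(1) by (intro double) (simp add: N0_def)
      also have "\<dots> \<le> 2 ^ d * (C * (n - 1) ^ d)" by (intro mult_le_mono cd less.IH[OF n(2,1)])
      also have "\<dots> = C * (2 * (n - 1)) ^ d" by (simp add: power_mult_distrib)
      also have "\<dots> \<le> C * (m - 1) ^ d" using n by (intro mult_le_mono2 power_mono) auto
      finally show ?thesis .
    qed
  qed
  moreover have "C * (m - 1) ^ d \<le> C * m ^ d" for m by (intro mult_le_mono2 power_mono) auto
  ultimately show ?thesis by (meson order_trans)
qed

section \<open>Topological entropy\<close>

text \<open>A Lebesgue number of the cover, for the metric whose balls are the cylinders.\<close>

lemma lebesgue_number_cylinders:
  assumes K: "compact K" and U: "open_cover (top_of_set K) \<U>"
  shows "\<exists>N. \<forall>\<omega>\<in>K. \<exists>u\<in>\<U>. cylinder \<omega> N \<inter> K \<subseteq> u"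
proof -
  have ex: "\<exists>N. \<exists>u\<in>\<U>. cylinder \<omega> N \<inter> K \<subseteq> u" if \<omega>: "\<omega> \<in> K" for \<omega>
  proof -
    obtain u where u: "u \<in> \<U>" "\<omega> \<in> u" using U \<omega> by (auto simp: open_cover_def)
    then obtain V where V: "open V" "u = K \<inter> V"
      using U by (auto simp: open_cover_def openin_open)
    then obtain N where "cylinder \<omega> N \<subseteq> V" using cylinder_basis[of V \<omega>] u by blast
    then show ?thesis using u V by blast
  qed
  define r where "r = (\<lambda>\<omega>. SOME N. \<exists>u\<in>\<U>. cylinder \<omega> N \<inter> K \<subseteq> u)"
  have r: "\<exists>u\<in>\<U>. cylinder \<omega> (r \<omega>) \<inter> K \<subseteq> u" if "\<omega> \<in> K" for \<omega>
    unfolding r_def by (rule someI_ex[OF ex[OF that]])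
  obtain F where F: "F \<subseteq> K" "finite F" "K \<subseteq> (\<Union>\<omega>\<in>F. cylinder \<omega> (r \<omega>))"
  proof (rule compactE_image[OF K, of K "\<lambda>\<omega>. cylinder \<omega> (r \<omega>)"])
    show "K \<subseteq> (\<Union>\<omega>\<in>K. cylinder \<omega> (r \<omega>))" using in_cylinder_self by blast
  qed (auto intro: open_cylinder)
  define N where "N = Max (insert 0 (r ` F))"
  have N: "r \<tau> \<le> N" if "\<tau> \<in> F" for \<tau> unfolding N_def using F(2) that by (intro Max_ge) auto
  have "\<exists>u\<in>\<U>. cylinder \<omega> N \<inter> K \<subseteq> u" if \<omega>: "\<omega> \<in> K" for \<omega>
  proof -
    obtain \<tau> where \<tau>: "\<tau> \<in> F" "\<omega> \<in> cylinder \<tau> (r \<tau>)" using F(3) \<omega> by blast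
    have "cylinder \<omega> N \<subseteq> cylinder \<tau> (r \<tau>)" using \<tau>(2) N[OF \<tau>(1)] by (auto simp: cylinder_def)
    moreover obtain u where "u \<in> \<U>" "cylinder \<tau> (r \<tau>) \<inter> K \<subseteq> u" using r[of \<tau>] \<tau>(1) F(1) by blast
    ultimately show ?thesis by blast
  qed
  then show ?thesis by blast
qed

lemma cover_entropy_nonneg: "0 \<le> cover_entropy X \<U>"
  unfolding cover_entropy_def
proof (rule INF_greatest)
  fix \<V> :: "'a set set"
  show "0 \<le> ereal (ln (real (card \<V>)))" by (cases "card \<V> = 0") auto
qed

text \<open>
  Points that share the coordinates from \<open>-N\<close> to \<open>N + n - 1\<close> can use the same member of the
  refined cover, so one member for each word of this length suffices.
\<close>

lemma cover_entropy_iterated_join_le: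
  assumes K: "K \<subseteq> full_shift k" and inv: "\<And>\<omega>. \<omega> \<in> K \<Longrightarrow> left_shift \<omega> \<in> K" "\<And>\<omega>. \<omega> \<in> K \<Longrightarrow> right_shift \<omega> \<in> K"
    and N: "\<forall>\<omega>\<in>K. \<exists>u\<in>\<U>. cylinder \<omega> N \<inter> K \<subseteq> u" and C: "card (words K (2 * N + n)) \<le> C" "1 \<le> C"
  shows "cover_entropy (top_of_set K) (iterated_join (top_of_set K) left_shift \<U> n) \<le> ereal (ln (real C))"
proof -
  obtain u where u: "\<And>\<omega>. \<omega> \<in> K \<Longrightarrow> u \<omega> \<in> \<U> \<and> cylinder \<omega> N \<inter> K \<subseteq> u \<omega>" using N by metis
  have left: "(left_shift ^^ i) \<omega> \<in> K" and right: "(right_shift ^^ i) \<omega> \<in> K" if "\<omega> \<in> K" for i \<omega>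
    using that inv by (induction i) auto
  define wd where "wd = (\<lambda>\<omega>. map (future ((right_shift ^^ N) \<omega>)) [0..<2 * N + n])"
  have wd: "wd ` K \<subseteq> words K (2 * N + n)" using right by (auto simp: wd_def words_def)
  define rep where "rep = (\<lambda>w. SOME \<omega>. \<omega> \<in> K \<and> wd \<omega> = w)"
  have rep: "rep (wd \<omega>) \<in> K" "wd (rep (wd \<omega>)) = wd \<omega>" if "\<omega> \<in> K" for \<omega>
    using someI[of "\<lambda>\<tau>. \<tau> \<in> K \<and> wd \<tau> = wd \<omega>" \<omega>] that by (auto simp: rep_def)
  define J where "J = (\<lambda>\<omega>. topspace (top_of_set K) \<inter> (\<Inter>i<n. (left_shift ^^ i) -` u ((left_shift ^^ i) \<omega>)))"
  define \<V> where "\<V> = (\<lambda>w. J (rep w)) ` wd ` K"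
  have "\<V> \<subseteq> iterated_join (top_of_set K) left_shift \<U> n"
  proof
    fix v assume "v \<in> \<V>"
    then obtain \<omega> where \<omega>: "\<omega> \<in> K" "v = J (rep (wd \<omega>))" by (auto simp: \<V>_def)
    have "\<forall>i<n. u ((left_shift ^^ i) (rep (wd \<omega>))) \<in> \<U>" using u left rep(1)[OF \<omega>(1)] by blast
    then show "v \<in> iterated_join (top_of_set K) left_shift \<U> n"
      unfolding iterated_join_def \<omega>(2) J_def
      by (intro CollectI exI[of _ "\<lambda>i. u ((left_shift ^^ i) (rep (wd \<omega>)))"] conjI refl)
  qed
  moreover have fin: "finite (wd ` K)" by (rule finite_subset[OF wd finite_words[OF K]])
  then have "finite \<V>" by (simp add: \<V>_def)
  moreover have "\<Union> \<V> = topspace (top_of_set K)"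
  proof
    show "\<Union> \<V> \<subseteq> topspace (top_of_set K)" by (auto simp: \<V>_def J_def)
    show "topspace (top_of_set K) \<subseteq> \<Union> \<V>"
    proof
      fix \<omega> assume "\<omega> \<in> topspace (top_of_set K)"
      then have \<omega>: "\<omega> \<in> K" by simp
      define \<tau> where "\<tau> = rep (wd \<omega>)"
      have \<tau>: "\<tau> \<in> K" "wd \<tau> = wd \<omega>" unfolding \<tau>_def using rep[OF \<omega>] by auto
      have agree: "\<omega> (int j - int N) = \<tau> (int j - int N)" if j: "j < 2 * N + n" for j
      proof -
        have "wd \<tau> ! j = wd \<omega> ! j" by (simp only: \<tau>(2))
        then show ?thesis using j by (simp add: wd_def future_def right_shift_funpow)
      qed
      have "(left_shift ^^ i) \<omega> \<in> u ((left_shift ^^ i) \<tau>)" if i: "i < n" for i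
      proof -
        have "(left_shift ^^ i) \<omega> \<in> cylinder ((left_shift ^^ i) \<tau>) N"
          unfolding cylinder_def
        proof (intro CollectI ballI)
          fix m :: int assume m: "m \<in> {- int N..int N}"
          define j where "j = nat (m + int i + int N)"
          have "int j = m + int i + int N" "j < 2 * N + n" using m i by (auto simp: j_def)
          then show "(left_shift ^^ i) \<omega> m = (left_shift ^^ i) \<tau> m"
            using agree[of j] by (simp add: left_shift_funpow)
        qed
        then show ?thesis using u[OF left[OF \<tau>(1), of i]] left[OF \<omega>, of i] by blast
      qed
      then have "\<omega> \<in> J \<tau>" using \<omega> by (simp add: J_def)
      then show "\<omega> \<in> \<Union> \<V>" using \<omega> by (auto simp: \<V>_def \<tau>_def)
    qed
  qed
  ultimately have "cover_entropy (top_of_set K) (iterated_join (top_of_set K) left_shift \<U> n) \<le> ereal (ln (real (card \<V>)))"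
    unfolding cover_entropy_def by (intro INF_lower) blast
  also have "ln (real (card \<V>)) \<le> ln (real C)"
  proof (cases "card \<V> = 0")
    case True
    then show ?thesis using C(2) by simp
  next
    case False
    have "card \<V> \<le> card (wd ` K)" unfolding \<V>_def by (rule card_image_le[OF fin])
    also have "\<dots> \<le> C" using card_mono[OF finite_words[OF K] wd] C(1) by linarith
    finally show ?thesis using False by (intro ln_mono) auto
  qed
  finally show ?thesis by simp
qed

text \<open>The logarithm of a polynomial bound is sublinear.\<close>

lemma topological_entropy_0_if_polynomial_words:
  assumes comp: "compact K" and K: "K \<subseteq> full_shift k"
    and inv: "\<And>\<omega>. \<omega> \<in> K \<Longrightarrow> left_shift \<omega> \<in> K" "\<And>\<omega>. \<omega> \<in> K \<Longrightarrow> right_shift \<omega> \<in> K"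
    and poly: "\<exists>C d N. \<forall>m\<ge>N. card (words K m) \<le> C * m ^ d"
  shows "topological_entropy (top_of_set K) left_shift = 0"
proof -
  obtain C d N0 where poly: "\<And>m. m \<ge> N0 \<Longrightarrow> card (words K m) \<le> C * m ^ d" using poly by blast
  let ?h = "\<lambda>\<U> n. cover_entropy (top_of_set K) (iterated_join (top_of_set K) left_shift \<U> n) / ereal (real n)"
  have "limsup (?h \<U>) = 0" if U: "open_cover (top_of_set K) \<U>" for \<U>
  proof (rule antisym)
    obtain N where N: "\<forall>\<omega>\<in>K. \<exists>u\<in>\<U>. cylinder \<omega> N \<inter> K \<subseteq> u"
      using lebesgue_number_cylinders[OF comp U] by blast
    define e where "e = (\<lambda>n. ln (real (Suc C * (2 * N + n) ^ d)) / real n)"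
    have bound: "?h \<U> n \<le> ereal (e n)" if n: "n \<ge> N0 + 1" for n
    proof -
      have "C * (2 * N + n) ^ d \<le> Suc C * (2 * N + n) ^ d" by simp
      then have c1: "card (words K (2 * N + n)) \<le> Suc C * (2 * N + n) ^ d"
        using poly[of "2 * N + n"] n by linarith
      have c2: "1 \<le> Suc C * (2 * N + n) ^ d" using n by (simp add: Suc_le_eq)
      have "?h \<U> n \<le> ereal (ln (real (Suc C * (2 * N + n) ^ d))) / ereal (real n)"
        by (rule ereal_divide_right_mono[OF cover_entropy_iterated_join_le[OF K inv N c1 c2]]) (use n in auto)
      then show ?thesis using n by (simp add: e_def)
    qed
    have "e \<longlonglongrightarrow> 0"
      unfolding e_def of_nat_mult of_nat_power of_nat_add by real_asymp
    then have lim: "(\<lambda>n. ereal (e n)) \<longlonglongrightarrow> ereal 0" by simp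
    have "limsup (?h \<U>) \<le> limsup (\<lambda>n. ereal (e n))"
      by (rule Limsup_mono) (use bound in \<open>auto simp: eventually_sequentially\<close>)
    also have "\<dots> = 0" using lim_imp_Limsup[OF _ lim] by simp
    finally show "limsup (?h \<U>) \<le> 0" .
    have nonneg: "0 \<le> ?h \<U> n" for n
      by (rule zero_le_divide_ereal[OF cover_entropy_nonneg]) simp
    have "0 \<le> liminf (?h \<U>)" by (rule Liminf_bounded) (use nonneg in auto)
    also have "\<dots> \<le> limsup (?h \<U>)" by (rule Liminf_le_Limsup) simp
    finally show "0 \<le> limsup (?h \<U>)" .
  qed
  moreover have "open_cover (top_of_set K) {K}" by (simp add: open_cover_def)
  ultimately show ?thesis unfolding topological_entropy_def
    by (intro antisym SUP_least SUP_upper2[of "{K}"]) auto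
qed

lemma (in opposite_cone_systems) topological_entropy_mather:
  assumes s: "s \<in> {1, -1}"
  shows "topological_entropy (top_of_set (fwd.mather s)) left_shift = 0"
proof (rule topological_entropy_0_if_polynomial_words[OF fwd.compact_mather[OF s]])
  show K: "fwd.mather s \<subseteq> full_shift k" using fwd.mather_full_shift by blast
  have "eventually (\<lambda>n. dominance n < 1) sequentially"
    using order_tendstoD(2)[OF dominance_tendsto_0, of 1] by simp
  then obtain N where N: "\<And>n. n \<ge> N \<Longrightarrow> dominance n < 1" by (auto simp: eventually_sequentially)
  show "\<exists>C d N. \<forall>m\<ge>N. card (words (fwd.mather s) m) \<le> C * m ^ d"
  proof (rule polynomial_growth_if_doubling)
    show "card (words (fwd.mather s) m) \<le> card (words (fwd.mather s) n)" if "m \<le> n" for m n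
      by (rule card_words_mono[OF K that])
    show "card (words (fwd.mather s) (2 * n)) \<le> 2 * (card Cs + card Ds) * card (words (fwd.mather s) n)"
      if "n \<ge> max N 1" for n
      using that by (intro card_words_double_le[OF s] N) auto
  qed
qed (auto intro: fwd.left_shift_mather fwd.right_shift_mather)

lemma forward_NOC_cone_system:
  assumes "forward_NOC k A" and inv: "\<forall>i\<in>{1..k}. invertible (A i)"
  shows "\<exists>Cs. cone_system k A Cs"
proof -
  obtain M where M: "multicone M" "strictly_forward_invariant k A M"
    "\<forall>i\<in>{1..k}. \<forall>j\<in>{1..k}. i \<noteq> j \<longrightarrow> (*v) (A i) ` M \<inter> (*v) (A j) ` M = {}"
    using assms(1) unfolding forward_NOC_def by blast
  obtain Cs where Cs: "finite Cs" "Cs \<noteq> {}" "\<forall>C\<in>Cs. plane_cone C" "disjoint Cs" "M = \<Union> Cs"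
    using M(1) unfolding multicone_def by blast
  have "cone_system k A Cs"
  proof
    show "(*v) (A i) ` \<Union>Cs \<subseteq> interior (\<Union>Cs)" if "i \<in> {1..k}" for i
      using M(2) that unfolding strictly_forward_invariant_def Cs(5) by blast
    show "(*v) (A i) ` \<Union>Cs \<inter> (*v) (A j) ` \<Union>Cs = {}" if "i \<in> {1..k}" "j \<in> {1..k}" "i \<noteq> j" for i j
      using M(3) that unfolding Cs(5) by blast
  qed (use Cs inv in auto)
  then show ?thesis by blast
qed

theorem theorem2:
  fixes k :: nat and A :: "nat \<Rightarrow> real^2^2"
  assumes "k \<ge> 2"
    and "\<forall>i\<in>{1..k}. invertible (A i)"
    and "dominated k A"
    and "NOC k A"
  shows "topological_entropy (top_of_set (mather_top k A)) left_shift = 0 \<and>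
         topological_entropy (top_of_set (mather_bot k A)) left_shift = 0"
proof -
  have noc: "forward_NOC k A" "forward_NOC k (\<lambda>i. matrix_inv (A i))"
    using assms(4) by (simp_all add: NOC_def backwards_NOC_def)
  have "\<forall>i\<in>{1..k}. invertible (matrix_inv (A i))"
    using assms(2) matrix_inv_mult unfolding invertible_def by blast
  then obtain Cs Ds where "cone_system k A Cs" "cone_system k (\<lambda>i. matrix_inv (A i)) Ds"
    using forward_NOC_cone_system[OF noc(1) assms(2)] forward_NOC_cone_system[OF noc(2)] by blast
  then interpret opposite_cone_systems k A Cs Ds
    by (simp add: opposite_cone_systems_def)
  show ?thesis
    unfolding fwd.mather_top_eq fwd.mather_bot_eq using topological_entropy_mather[of 1] topological_entropy_mather[of "-1"] by simp
qed

end
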